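(* Let $s\in(0,1)$, $p>1$, $N>ps$, and let $\Omega\subset\mathbb{R}^N$ be a bounded domain. Let $\varepsilon_n\downarrow 0$ and, for each $n$, let $u_n$ be a ground state solution of $$(-\Delta_p)^s u=|u|^{p^*-2-\varepsilon_n}u\ \text{ in }\Omega,\qquad u=0\ \text{ in }\mathbb{R}^N\setminus\Omega .$$ For each subsequence (not relabelled) such that $|u_n|^{p^*}$ converges weakly in the sense of measures, the following hold: 1. $u_n\to 0$ in $L^q(\mathbb{R}^N)$ for every $q\in[1,p^* )$; 2. there exists $\bar x\in\overline\Omega$ such that $|D^su_n|^p\rightharpoonup \mathbb{S}^{\frac{N}{ps}}\delta_{\bar x}$ and $|u_n|^{p^*}\rightharpoonup \mathbb{S}^{\frac{N}{ps}}\delta_{\bar x}$ weakly in the sense of measures.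
   Context: Notation: $p^*=Np/(N-ps)$; $[u]_{s,p}^p=\int_{\mathbb{R}^{2N}}\frac{|u(x)-u(y)|^p}{|x-y|^{N+ps}}\,dx\,dy$; $|u|_q$ is the $L^q(\mathbb{R}^N)$ norm; $W^{s,p}_0(\Omega)=\{u\in L^{p^*}(\mathbb{R}^N): u=0 \text{ in }\mathbb{R}^N\setminus\Omega,\ [u]_{s,p}<\infty\}$, normed by $[\cdot]_{s,p}$. The Sobolev constant is $\mathbb{S}=\inf\{[u]_{s,p}^p/|u|_{p^*}^p: u\in W^{s,p}_0(\mathbb{R}^N)\setminus\{0\}\}$ (the same infimum is obtained on $W^{s,p}_0(\Omega)$ for every domain $\Omega$). For $u\in W^{s,p}_0(\Omega)$, $|D^su|^p(x)=\int_{\mathbb{R}^N}\frac{|u(x)-u(y)|^p}{|x-y|^{N+ps}}\,dy$ for a.e. $x\in\mathbb{R}^N$. The operator $(-\Delta_p)^s$ is the differential of $u\mapsto\frac1p[u]_{s,p}^p$ on $W^{s,p}_0(\Omega)$, i.e. $\langle(-\Delta_p)^su,\varphi\rangle=\int_{\mathbb{R}^{2N}}\frac{|u(x)-u(y)|^{p-2}(u(x)-u(y))(\varphi(x)-\varphi(y))}{|x-y|^{N+ps}}\,dx\,dy$. For small $\varepsilon>0$ (so that $p<p^*-\varepsilon$), a weak solution of the problem with exponent $p^*-2-\varepsilon$ is a critical point of the $C^1$ functional $I_\varepsilon(u)=\frac1p[u]_{s,p}^p-\frac1{p^*-\varepsilon}\int_\Omega|u|^{p^*-\varepsilon}dx$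 on $W^{s,p}_0(\Omega)$. A ground state solution is a minimizer of $I_\varepsilon$ over the Nehari manifold $\{u\in W^{s,p}_0(\Omega)\setminus\{0\}:\langle dI_\varepsilon(u),u\rangle=0\}$. Weak convergence in the sense of measures is convergence against test functions in $C_0(\mathbb{R}^N)$; $\delta_{\bar x}$ is the Dirac mass at $\bar x$. *)

theory Defs
  imports "HOL-Probability.Probability"
begin

text \<open>
  The Euclidean space $\mathbf{R}^N$ is a type \<open>'a\<close> of class \<open>euclidean_space\<close>, with \<open>N = DIM('a)\<close>.
  Elements of \<open>L\<^sup>q\<close> are represented by Lebesgue measurable functions; every notion below is
  invariant under changes on null sets, and \<open>u = 0\<close> is always meant almost everywhere.
  The space $\mathbf{R}^{2N}$ is \<open>'a \<times> 'a\<close>, again of class \<open>euclidean_space\<close>.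
\<close>

definition Lspace :: "real \<Rightarrow> ('a::euclidean_space \<Rightarrow> real) set" where
  "Lspace q = {u \<in> borel_measurable lebesgue. integrable lebesgue (\<lambda>x. \<bar>u x\<bar> powr q)}"

definition Lnorm :: "real \<Rightarrow> ('a::euclidean_space \<Rightarrow> real) \<Rightarrow> real" where
  "Lnorm q u = (\<integral>x. \<bar>u x\<bar> powr q \<partial>lebesgue) powr (1 / q)"

definition zero_ae :: "('a::euclidean_space \<Rightarrow> real) \<Rightarrow> bool" where
  "zero_ae u \<longleftrightarrow> (AE x in lebesgue. u x = 0)"

definition crit_exp :: "nat \<Rightarrow> real \<Rightarrow> real \<Rightarrow> real" where
  "crit_exp N s p = real N * p / (real N - p * s)"

text \<open>On the diagonal \<open>x = y\<close>, a null set, the value is \<open>0\<close>.\<close>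
definition diff_quot :: "real \<Rightarrow> real \<Rightarrow> ('a::euclidean_space \<Rightarrow> real) \<Rightarrow> 'a \<Rightarrow> 'a \<Rightarrow> real" where
  "diff_quot s p u x y = \<bar>u x - u y\<bar> powr p / norm (x - y) powr (real DIM('a) + p * s)"

text \<open>The \<open>p\<close>-th power of the seminorm, $[u]_{s,p}^p$.\<close>
definition gagliardo_pow :: "real \<Rightarrow> real \<Rightarrow> ('a::euclidean_space \<Rightarrow> real) \<Rightarrow> real" where
  "gagliardo_pow s p u = (\<integral>(x, y). diff_quot s p u x y \<partial>lebesgue)"

text \<open>As the integrand is nonnegative, its integrability says $[u]_{s,p} < \infty$.\<close>
definition W0 :: "real \<Rightarrow> real \<Rightarrow> 'a::euclidean_space set \<Rightarrow> ('a \<Rightarrow> real) set" where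
  "W0 s p \<Omega> = {u \<in> Lspace (crit_exp DIM('a) s p).
      (AE x in lebesgue. x \<notin> \<Omega> \<longrightarrow> u x = 0) \<and>
      integrable lebesgue (\<lambda>(x, y). diff_quot s p u x y)}"

definition sobolev_const :: "'a::euclidean_space itself \<Rightarrow> real \<Rightarrow> real \<Rightarrow> real" where
  "sobolev_const _ s p =
    Inf {gagliardo_pow s p u / Lnorm (crit_exp DIM('a) s p) u powr p |u.
         u \<in> W0 s p (UNIV :: 'a set) \<and> \<not> zero_ae u}"

text \<open>The function $|D^s u|^p$; for \<open>u\<close> in \<open>W0\<close> the integral is finite for almost every \<open>x\<close>.\<close>
definition Ds_pow :: "real \<Rightarrow> real \<Rightarrow> ('a::euclidean_space \<Rightarrow> real) \<Rightarrow> 'a \<Rightarrow> real" where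
  "Ds_pow s p u x = (\<integral>y. diff_quot s p u x y \<partial>lebesgue)"

text \<open>
  The pairing of \<open>(-\<Delta>\<^sub>p)\<^sup>s u\<close> with \<open>\<phi>\<close>. For \<open>p < 2\<close> and \<open>u x = u y\<close> the factor
  \<open>\<bar>t\<bar>\<^sup>p\<^sup>-\<^sup>2 t\<close> is \<open>0\<close>, as usual; likewise for the power nonlinearity below.
\<close>
definition frac_plap ::
  "real \<Rightarrow> real \<Rightarrow> ('a::euclidean_space \<Rightarrow> real) \<Rightarrow> ('a \<Rightarrow> real) \<Rightarrow> real" where
  "frac_plap s p u \<phi> =
    (\<integral>(x, y). \<bar>u x - u y\<bar> powr (p - 2) * (u x - u y) * (\<phi> x - \<phi> y)
        / norm (x - y) powr (real DIM('a) + p * s) \<partial>lebesgue)"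

definition energy ::
  "real \<Rightarrow> real \<Rightarrow> 'a::euclidean_space set \<Rightarrow> real \<Rightarrow> ('a \<Rightarrow> real) \<Rightarrow> real" where
  "energy s p \<Omega> \<epsilon> u = 1 / p * gagliardo_pow s p u
    - 1 / (crit_exp DIM('a) s p - \<epsilon>) * (LINT x:\<Omega>|lebesgue. \<bar>u x\<bar> powr (crit_exp DIM('a) s p - \<epsilon>))"

text \<open>The differential of the energy at \<open>u\<close>, applied to \<open>\<phi>\<close>.\<close>
definition d_energy ::
  "real \<Rightarrow> real \<Rightarrow> 'a::euclidean_space set \<Rightarrow> real \<Rightarrow> ('a \<Rightarrow> real) \<Rightarrow> ('a \<Rightarrow> real) \<Rightarrow> real" where
  "d_energy s p \<Omega> \<epsilon> u \<phi> = frac_plap s p u \<phi>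
    - (LINT x:\<Omega>|lebesgue. \<bar>u x\<bar> powr (crit_exp DIM('a) s p - 2 - \<epsilon>) * u x * \<phi> x)"

definition nehari ::
  "real \<Rightarrow> real \<Rightarrow> 'a::euclidean_space set \<Rightarrow> real \<Rightarrow> ('a \<Rightarrow> real) set" where
  "nehari s p \<Omega> \<epsilon> = {u \<in> W0 s p \<Omega>. \<not> zero_ae u \<and> d_energy s p \<Omega> \<epsilon> u u = 0}"

definition ground_state ::
  "real \<Rightarrow> real \<Rightarrow> 'a::euclidean_space set \<Rightarrow> real \<Rightarrow> ('a \<Rightarrow> real) \<Rightarrow> bool" where
  "ground_state s p \<Omega> \<epsilon> u \<longleftrightarrow> u \<in> nehari s p \<Omega> \<epsilon> \<and>
    (\<forall>v \<in> nehari s p \<Omega> \<epsilon>. energy s p \<Omega> \<epsilon> u \<le> energy s p \<Omega> \<epsilon> v)"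

text \<open>Continuous functions vanishing at infinity.\<close>
definition C0_funs :: "('a::euclidean_space \<Rightarrow> real) set" where
  "C0_funs = {\<phi>. continuous_on UNIV \<phi> \<and> (\<phi> \<longlongrightarrow> 0) at_infinity}"

text \<open>
  The functions \<open>f n \<ge> 0\<close> are identified with the measures \<open>f n dx\<close>;
  the limit is a finite Borel measure.
\<close>
definition weak_lim_measure ::
  "(nat \<Rightarrow> 'a::euclidean_space \<Rightarrow> real) \<Rightarrow> 'a measure \<Rightarrow> bool" where
  "weak_lim_measure f \<mu> \<longleftrightarrow> sets \<mu> = sets borel \<and> finite_measure \<mu> \<and>
    (\<forall>\<phi> \<in> C0_funs.
      (\<lambda>n. \<integral>x. \<phi> x \<partial>density lebesgue (\<lambda>x. ennreal (f n x))) \<longlonglongrightarrow> (\<integral>x. \<phi> x \<partial>\<mu>))"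

end

theory Submission
  imports Defs
begin

text \<open>
  Write \<open>P\<close> for the critical exponent \<open>p\<^sup>*\<close>, \<open>q\<^sub>n = P - \<epsilon>\<^sub>n\<close>, \<open>S\<close> for the Sobolev constant and
  \<open>T = S\<^bsup>N/(ps)\<^esup>\<close>.

  \<^bold>\<open>The ground states form an almost extremal sequence.\<close> Scaling a function onto the Nehari manifold
  shows that a ground state minimises the quotient \<open>[w]\<^sup>p / |w|\<^sup>p\<close> with the norm of \<open>L\<^bsup>q\<^sub>n\<^esup>\<close>
  (\<open>ground_state_representative\<close>). Functions in the whole space can be truncated, cut off and shrunk into
  \<open>\<Omega>\<close> at almost no cost (\<open>almost_extremal_supported\<close>), so the minimal quotients are asymptotically at
  most \<open>S\<close>; Hoelder's inequality on the bounded set \<open>\<Omega>\<close> gives the reverse bound. Hence both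
  \<open>[u\<^sub>n]\<^sup>p\<close> and the integral of \<open>|u\<^sub>n|\<^sup>P\<close> tend to \<open>T\<close>, and the Sobolev inequality for
  \<open>u\<^sub>n\<close> is asymptotically sharp (\<open>deficit_limit\<close>). That \<open>S\<close> is positive is the fractional
  Sobolev inequality, for which there is a short pointwise proof (\<open>sobolev_pointwise\<close>).

  \<^bold>\<open>Vanishing.\<close> The operator is nonlocal: adding to \<open>|u\<^sub>n|\<close> a small bump \<open>t g\<close> that lives away from
  \<open>\<Omega>\<close> lowers the energy by an amount of order \<open>t\<close> times the integral of \<open>|u\<^sub>n|\<^bsup>p-1\<^esup>\<close>,
  raises it by at most an amount of order \<open>t\<^sup>p\<close>, and increases the \<open>L\<^sup>P\<close> norm. As \<open>p > 1\<close>, asymptotic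
  sharpness forces the integral of \<open>|u\<^sub>n|\<^bsup>p-1\<^esup>\<close> to tend to \<open>0\<close> (\<open>lower_power_limit\<close>), and
  interpolation with the bounded \<open>L\<^sup>P\<close> norm gives all subcritical exponents. This is a
  quantitative form of the fact that no extremal function vanishes on an open set.

  \<^bold>\<open>Concentration.\<close> Since \<open>u\<^sub>n \<rightarrow> 0\<close> in \<open>L\<^sup>p\<close>, multiplication by a Lipschitz function
  \<open>\<eta>\<close> commutes with the energy up to vanishing errors. The Sobolev inequality for \<open>\<eta> u\<^sub>n\<close> and
  \<open>(1 - \<eta>) u\<^sub>n\<close> then yields, for the limit measure \<open>\<nu>\<close> of \<open>|u\<^sub>n|\<^sup>P\<close>,
  \<open>\<nu>(F)\<^bsup>p/P\<^esup> + \<nu>(-F)\<^bsup>p/P\<^esup> \<le> T\<^bsup>p/P\<^esup>\<close> for closed \<open>F\<close>, where \<open>T\<close> is the total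
  mass. As \<open>p/P < 1\<close>, one of the two masses is zero (\<open>nu_zero_one\<close>), so \<open>\<nu>\<close> is a point mass at some
  point of the closure of \<open>\<Omega>\<close>. The energy near that point is at least \<open>S T\<^bsup>p/P\<^esup> = T\<close>, which is
  all the energy there is; hence the energy density concentrates at the same point.
\<close>

section \<open>Elementary inequalities\<close>

text \<open>
  Convexity of \<open>t \<mapsto> t\<^sup>p\<close> at \<open>l (a / l) + (1 - l) (b / (1 - l))\<close>. With \<open>l\<close> close to \<open>1\<close> the
  coefficient of \<open>\<bar>a\<bar>\<^sup>p\<close> is close to \<open>1\<close>, at the price of a large coefficient on an error term \<open>b\<close>.
\<close>

lemma powr_convex_combination:
  fixes a b l p :: real
  assumes "0 < l" "l < 1" "1 \<le> p"
  shows "\<bar>a + b\<bar> powr p \<le> l powr (1 - p) * \<bar>a\<bar> powr p + (1 - l) powr (1 - p) * \<bar>b\<bar> powr p"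
proof -
  have pos: "(x + y) powr p \<le> l powr (1 - p) * x powr p + (1 - l) powr (1 - p) * y powr p"
    if "0 < x" "0 < y" for x y :: real
  proof -
    have "((1 - (1 - l)) *\<^sub>R (x / l) + (1 - l) *\<^sub>R (y / (1 - l))) powr p
        \<le> (1 - (1 - l)) * (x / l) powr p + (1 - l) * (y / (1 - l)) powr p"
      using assms that by (intro convex_onD[OF powr_convex[OF assms(3)]]) auto
    moreover have "l * (x / l) powr p = l powr (1 - p) * x powr p"
      using assms that by (simp add: powr_divide powr_diff)
    moreover have "(1 - l) * (y / (1 - l)) powr p = (1 - l) powr (1 - p) * y powr p"
      using assms that by (simp add: powr_divide powr_diff)
    ultimately show ?thesis using assms by simp
  qed
  have one: "1 \<le> l powr (1 - p)" "1 \<le> (1 - l) powr (1 - p)"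
    using assms powr_mono'[of "1 - p" 0 l] powr_mono'[of "1 - p" 0 "1 - l"] by auto
  have "(\<bar>a\<bar> + \<bar>b\<bar>) powr p \<le> l powr (1 - p) * \<bar>a\<bar> powr p + (1 - l) powr (1 - p) * \<bar>b\<bar> powr p"
  proof (cases "a = 0 \<or> b = 0")
    case True
    then show ?thesis
      using mult_right_mono[OF one(1), of "\<bar>a\<bar> powr p"] mult_right_mono[OF one(2), of "\<bar>b\<bar> powr p"] assms
      by auto
  next
    case False then show ?thesis using pos[of "\<bar>a\<bar>" "\<bar>b\<bar>"] by auto
  qed
  moreover have "\<bar>a + b\<bar> powr p \<le> (\<bar>a\<bar> + \<bar>b\<bar>) powr p"
    using assms by (intro powr_mono2) auto
  ultimately show ?thesis by linarith
qed

text \<open>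
  For small \<open>b\<close> the gain is linear in \<open>b\<close> and the loss only of order \<open>b\<^sup>p\<close>; this asymmetry is the
  reason why almost extremal functions with bounded support must vanish in the limit.
\<close>

lemma powr_diff_le_linear:
  fixes a b p :: real
  assumes "0 \<le> a" "0 \<le> b" "1 \<le> p"
  shows "\<bar>a - b\<bar> powr p \<le> a powr p - a powr (p - 1) * b + 2 * b powr p"
proof (cases "b \<le> a")
  case True
  show ?thesis
  proof (cases "a = 0")
    case False
    have *: "a powr p = a powr (p - 1) * a"
      using False assms powr_mult_base[of a "p - 1"] by (simp add: mult.commute)
    have "(a - b) powr p = (a - b) powr (p - 1) * (a - b)"
      using True assms powr_mult_base[of "a - b" "p - 1"] by (simp add: mult.commute)
    also have "\<dots> \<le> a powr (p - 1) * (a - b)"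
      using True assms by (intro mult_right_mono powr_mono2) auto
    finally have "(a - b) powr p + a powr (p - 1) * b \<le> a powr p"
      using * by (simp add: algebra_simps)
    then show ?thesis using True powr_ge_zero[of b p] by linarith
  qed (use True assms in auto)
next
  case False
  have "\<bar>a - b\<bar> powr p \<le> b powr p" using False assms by (intro powr_mono2) auto
  moreover have "a powr (p - 1) * b \<le> b powr (p - 1) * b"
    using False assms by (intro mult_right_mono powr_mono2) auto
  moreover have "b powr (p - 1) * b = b powr p"
    using assms False powr_mult_base[of b "p - 1"] by (simp add: mult.commute)
  ultimately show ?thesis using False assms powr_ge_zero[of a p] by linarith
qed

section \<open>Dilations and cut-off functions\<close>

lemma
  fixes f :: "'b::euclidean_space \<Rightarrow> real"
  assumes c: "0 < c"
  shows integrable_lborel_rescale: "integrable lborel f \<Longrightarrow> integrable lborel (\<lambda>x. f ((x - t) /\<^sub>R c))"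
    and integral_lborel_rescale: "f \<in> borel_measurable borel \<Longrightarrow>
      (\<integral>x. f ((x - t) /\<^sub>R c) \<partial>lborel) = c ^ DIM('b) * (\<integral>x. f x \<partial>lborel)"
proof -
  have lb: "lborel = density (distr lborel borel (\<lambda>x. t + c *\<^sub>R x)) (\<lambda>_. ennreal (c ^ DIM('b)) :: ennreal)"
    using lborel_affine[of c t] c by (simp add: ennreal_power)
  have eq: "(t + c *\<^sub>R x - t) /\<^sub>R c = x" for x :: 'b using c by simp
  show "integrable lborel (\<lambda>x. f ((x - t) /\<^sub>R c))" if i: "integrable lborel f"
  proof -
    have [measurable]: "f \<in> borel_measurable borel" using i by auto
    show ?thesis
      using i c by (subst lb) (simp add: integrable_density integrable_distr_eq)
  qed
  show "(\<integral>x. f ((x - t) /\<^sub>R c) \<partial>lborel) = c ^ DIM('b) * (\<integral>x. f x \<partial>lborel)"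
    if [measurable]: "f \<in> borel_measurable borel"
    using c by (subst lb) (simp add: integral_density integral_distr)
qed

definition cutoff :: "'a::euclidean_space \<Rightarrow> real \<Rightarrow> 'a \<Rightarrow> real" where
  "cutoff a \<rho> x = max 0 (min 1 (2 - norm (x - a) / \<rho>))"

lemma cutoff_bounds [simp]: "0 \<le> cutoff a \<rho> x" "cutoff a \<rho> x \<le> 1"
  by (auto simp: cutoff_def)

lemma cutoff_measurable [measurable]: "cutoff a \<rho> \<in> borel_measurable borel"
  unfolding cutoff_def[abs_def] by measurable

lemma cutoff_continuous: "continuous_on UNIV (cutoff a \<rho>)"
  unfolding cutoff_def[abs_def] by (cases "\<rho> = 0") (auto intro!: continuous_intros)

lemma cutoff_eq_0: "0 < \<rho> \<Longrightarrow> 2 * \<rho> \<le> norm (x - a) \<Longrightarrow> cutoff a \<rho> x = 0"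
  by (auto simp: cutoff_def field_simps max_def min_def)

lemma cutoff_eq_1: "0 < \<rho> \<Longrightarrow> norm (x - a) \<le> \<rho> \<Longrightarrow> cutoff a \<rho> x = 1"
  by (auto simp: cutoff_def field_simps max_def min_def)

lemma cutoff_oscillation:
  assumes "0 < \<rho>"
  shows "\<bar>cutoff a \<rho> x - cutoff a \<rho> y\<bar> \<le> min 1 (norm (x - y) / \<rho>)"
proof -
  have "\<bar>norm (x - a) - norm (y - a)\<bar> \<le> norm (x - y)"
    using norm_triangle_ineq3[of "x - a" "y - a"] by simp
  then have "\<bar>norm (x - a) / \<rho> - norm (y - a) / \<rho>\<bar> \<le> norm (x - y) / \<rho>"
    using assms by (simp add: divide_right_mono flip: diff_divide_distrib)
  then show ?thesis by (auto simp: cutoff_def)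
qed

section \<open>Exponents and kernel\<close>

text \<open>
  The parameters \<open>N\<close>, \<open>P\<close> and \<open>S\<close> are names for the dimension, the critical exponent and the Sobolev
  constant; as constants of the theory they would each carry the space as an additional type argument.
\<close>

locale fractional_exponents =
  fixes s p N P S :: real and ty :: "'a::euclidean_space itself"
  assumes s_pos: "0 < s" and s_less: "s < 1" and p_gt: "1 < p" and ps_less: "p * s < N"
    and N_eq: "N = real DIM('a)" and P_eq: "P = crit_exp DIM('a) s p"
    and S_eq: "S = sobolev_const TYPE('a) s p"
begin

lemma N_pos: "0 < N" by (simp add: N_eq)

lemma ps_pos: "0 < p * s" using s_pos p_gt by simp

lemma N_ps_pos: "0 < N + p * s" using N_pos ps_pos by simp

lemma ps_less_p: "p * s < p" using s_less p_gt by simp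

lemma P_formula: "P = N * p / (N - p * s)"
  by (simp add: P_eq crit_exp_def N_eq)

lemma P_gt: "p < P"
proof -
  have "p * (N - p * s) < N * p" using ps_pos p_gt by (simp add: algebra_simps)
  then show ?thesis using ps_less by (simp add: P_formula pos_less_divide_eq)
qed

lemma P_pos: "0 < P" and P_gt_1: "1 < P" using P_gt p_gt by auto

lemma p_div_P: "p / P = 1 - p * s / N"
  using ps_less p_gt N_pos by (simp add: P_formula diff_divide_distrib)

lemma N_div_ps: "N / (p * s) = P / (P - p)"
proof -
  have "P - p = p * (p * s) / (N - p * s)"
    using ps_less by (simp add: P_formula divide_simps) (simp add: algebra_simps)
  then show ?thesis using ps_less p_gt ps_pos by (simp add: P_formula)
qed

lemma powr_N: "0 < r \<Longrightarrow> r ^ DIM('a) = r powr N"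
  by (simp add: N_eq powr_realpow)

definition kernel :: "'a \<Rightarrow> real" where
  "kernel z = 1 / norm z powr (N + p * s)"

lemma kernel_nonneg: "0 \<le> kernel z" by (simp add: kernel_def)

lemma kernel_measurable [measurable]: "kernel \<in> borel_measurable borel"
  unfolding kernel_def[abs_def] by measurable

lemma diff_quot_eq: "diff_quot s p u x y = \<bar>u x - u y\<bar> powr p * kernel (x - y)"
  for u :: "'a \<Rightarrow> real"
  by (simp add: diff_quot_def kernel_def flip: N_eq)

text \<open>
  The dyadic shell of radius \<open>2\<^bsup>-k\<^esup>\<close> contributes a multiple of \<open>2\<^bsup>-k(p-ps)\<^esup>\<close> and the one of
  radius \<open>2\<^sup>k\<close> a multiple of \<open>2\<^bsup>-kps\<^esup>\<close>: both series are geometric because \<open>0 < s < 1\<close>.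
\<close>

lemma kernel_integrable: "integrable lborel (\<lambda>z. min 1 (norm z) powr p * kernel z)"
proof -
  define V where "V = unit_ball_vol (real DIM('a))"
  define a where "a k = 2 powr (- real k * p) * 2 powr ((real k + 1) * (N + p * s))" for k :: nat
  define b where "b k = 2 powr (- real k * (N + p * s))" for k :: nat
  define F where "F k z = ennreal (a k) * indicator (cball 0 (2 powr (- real k))) z
      + ennreal (b k) * indicator (cball 0 (2 powr (real k + 1))) z" for k and z :: 'a
  have [measurable]: "F k \<in> borel_measurable borel" for k
    unfolding F_def by (intro borel_measurable_add borel_measurable_times_ennreal borel_measurable_indicator) auto
  have ab: "0 \<le> a k" "0 \<le> b k" for k by (auto simp: a_def b_def)
  have V: "0 \<le> V" by (simp add: V_def)
  have dom: "ennreal (min 1 (norm z) powr p * kernel z) \<le> (\<Sum>k. F k z)" for z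
  proof -
    have "\<exists>k. ennreal (min 1 (norm z) powr p * kernel z) \<le> F k z"
    proof (cases "z = 0")
      case True then show ?thesis by (simp add: kernel_def)
    next
      case z: False
      show ?thesis
      proof (cases "norm z \<le> 1")
        case True
        define k where "k = nat \<lfloor>- log 2 (norm z)\<rfloor>"
        have l: "0 \<le> - log 2 (norm z)" using True z by simp
        then have "real k \<le> - log 2 (norm z)" "- log 2 (norm z) \<le> real k + 1"
          unfolding k_def by linarith+
        then have k: "norm z \<le> 2 powr (- real k)" "2 powr (- (real k + 1)) \<le> norm z"
          using z by (simp_all add: le_powr_iff powr_le_iff)
        have "min 1 (norm z) powr p * kernel z \<le> (2 powr (- real k)) powr p * (1 / (2 powr (- (real k + 1))) powr (N + p * s))"
          unfolding kernel_def using k True z p_gt N_ps_pos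
          by (intro mult_mono powr_mono2 divide_left_mono) auto
        also have "\<dots> = a k" unfolding a_def powr_powr powr_minus_divide[symmetric] by (simp only: minus_mult_minus mult_minus_left minus_minus)
        finally have "ennreal (min 1 (norm z) powr p * kernel z) \<le> ennreal (a k)" by (rule ennreal_leI)
        also have "\<dots> \<le> F k z" using k by (simp add: F_def)
        finally show ?thesis by blast
      next
        case False
        define k where "k = nat \<lfloor>log 2 (norm z)\<rfloor>"
        have l: "0 \<le> log 2 (norm z)" using False z by simp
        then have "real k \<le> log 2 (norm z)" "log 2 (norm z) \<le> real k + 1"
          unfolding k_def by linarith+
        then have k: "2 powr real k \<le> norm z" "norm z \<le> 2 powr (real k + 1)"
          using z by (simp_all add: le_powr_iff powr_le_iff)
        have "min 1 (norm z) powr p * kernel z \<le> 1 * (1 / (2 powr real k) powr (N + p * s))"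
          unfolding kernel_def using k False z p_gt N_ps_pos
          by (intro mult_mono powr_mono2 divide_left_mono) auto
        also have "\<dots> = b k" unfolding b_def powr_powr powr_minus_divide[symmetric] by simp
        finally have "ennreal (min 1 (norm z) powr p * kernel z) \<le> ennreal (b k)" by (rule ennreal_leI)
        also have "\<dots> \<le> F k z" using k by (simp add: F_def)
        finally show ?thesis by blast
      qed
    qed
    then obtain k where "ennreal (min 1 (norm z) powr p * kernel z) \<le> F k z" by blast
    also have "F k z \<le> (\<Sum>k. F k z)"
      using sum_le_suminf[OF summableI, of "{k}" "\<lambda>k. F k z"] by simp
    finally show ?thesis .
  qed
  define c where "c k = V * 2 powr (N + p * s) * (2 powr (- (p - p * s))) ^ k
      + V * 2 powr N * (2 powr (- (p * s))) ^ k" for k :: nat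
  have int: "(\<integral>\<^sup>+z. F k z \<partial>lborel) = ennreal (c k)" for k
  proof -
    have "(\<integral>\<^sup>+z. F k z \<partial>lborel) = ennreal (a k) * ennreal (V * (2 powr (- real k)) ^ DIM('a))
        + ennreal (b k) * ennreal (V * (2 powr (real k + 1)) ^ DIM('a))"
      unfolding F_def V_def
      by (subst nn_integral_add)
         (auto simp: nn_integral_cmult_indicator emeasure_cball
           intro!: borel_measurable_times_ennreal borel_measurable_indicator)
    also have "\<dots> = ennreal (a k * (V * (2 powr (- real k)) ^ DIM('a)) + b k * (V * (2 powr (real k + 1)) ^ DIM('a)))"
      using ab V by (simp add: ennreal_mult ennreal_plus)
    also have "a k * (V * (2 powr (- real k)) ^ DIM('a)) = V * 2 powr (N + p * s) * (2 powr (- (p - p * s))) ^ k"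
    proof -
      have "2 powr (- real k * p) * 2 powr ((real k + 1) * (N + p * s)) * 2 powr (- real k * N)
          = 2 powr (N + p * s) * 2 powr (- (p - p * s) * real k)"
        unfolding powr_add[symmetric] by (rule arg_cong[where f = "\<lambda>e. 2 powr e"]) (simp add: algebra_simps)
      moreover have "(2 powr (- real k)) ^ DIM('a) = 2 powr (- real k * N)"
        by (simp add: powr_N powr_powr)
      ultimately show ?thesis by (simp add: a_def powr_powr flip: powr_realpow)
    qed
    also have "b k * (V * (2 powr (real k + 1)) ^ DIM('a)) = V * 2 powr N * (2 powr (- (p * s))) ^ k"
    proof -
      have "2 powr (- real k * (N + p * s)) * 2 powr ((real k + 1) * N) = 2 powr N * 2 powr (- (p * s) * real k)"
        unfolding powr_add[symmetric] by (rule arg_cong[where f = "\<lambda>e. 2 powr e"]) (simp add: algebra_simps)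
      moreover have "(2 powr (real k + 1)) ^ DIM('a) = 2 powr ((real k + 1) * N)"
        by (simp add: powr_N powr_powr)
      ultimately show ?thesis by (simp add: b_def powr_powr flip: powr_realpow)
    qed
    also have "V * 2 powr (N + p * s) * (2 powr (- (p - p * s))) ^ k + V * 2 powr N * (2 powr (- (p * s))) ^ k = c k"
      by (simp add: c_def)
    finally show ?thesis .
  qed
  have "summable c" unfolding c_def
    using ps_pos ps_less_p by (intro summable_add summable_mult summable_geometric) (auto simp: powr_less_one)
  then have fin: "(\<Sum>k. ennreal (c k)) \<noteq> \<infinity>"
    using V by (subst suminf_ennreal2) (auto simp: c_def)
  have "(\<integral>\<^sup>+z. ennreal (min 1 (norm z) powr p * kernel z) \<partial>lborel) \<le> (\<integral>\<^sup>+z. (\<Sum>k. F k z) \<partial>lborel)"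
    by (intro nn_integral_mono dom)
  also have "\<dots> = (\<Sum>k. ennreal (c k))" by (simp add: nn_integral_suminf int)
  finally have "(\<integral>\<^sup>+z. ennreal (min 1 (norm z) powr p * kernel z) \<partial>lborel) < \<infinity>"
    using fin by (simp add: top.not_eq_extremum)
  then show ?thesis
    by (intro integrableI_nonneg) (auto simp: kernel_nonneg)
qed


section \<open>Functions of finite energy\<close>

text \<open>
  Borel functions and \<open>lborel\<close> make Fubini's theorem directly applicable, because \<open>lborel\<close> on the product
  space is the product measure, while \<open>lebesgue\<close> is only its completion.
\<close>

definition finite_energy :: "('a \<Rightarrow> real) set" where
  "finite_energy = {u \<in> borel_measurable borel. integrable lborel (\<lambda>x. \<bar>u x\<bar> powr P) \<and>
     integrable lborel (\<lambda>(x, y). diff_quot s p u x y)}"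

definition mass :: "('a \<Rightarrow> real) \<Rightarrow> real" where
  "mass u = (\<integral>x. \<bar>u x\<bar> powr P \<partial>lborel)"

definition seminorm_pow :: "('a \<Rightarrow> real) \<Rightarrow> real" where
  "seminorm_pow u = (\<integral>(x, y). diff_quot s p u x y \<partial>lborel)"

definition dens :: "('a \<Rightarrow> real) \<Rightarrow> 'a \<Rightarrow> real" where
  "dens u x = (\<integral>y. diff_quot s p u x y \<partial>lborel)"

lemma diff_quot_nonneg: "0 \<le> diff_quot s p u x y" for u :: "'a \<Rightarrow> real"
  by (simp add: diff_quot_def)

lemma finite_energyD:
  assumes "u \<in> finite_energy"
  shows "u \<in> borel_measurable borel" "integrable lborel (\<lambda>x. \<bar>u x\<bar> powr P)"
    "integrable lborel (\<lambda>(x, y). diff_quot s p u x y)"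
  using assms by (auto simp: finite_energy_def)

lemma measurable_diff_quot [measurable]:
  fixes u :: "'a \<Rightarrow> real"
  assumes [measurable]: "u \<in> borel_measurable borel"
  shows "(\<lambda>(x, y). diff_quot s p u x y) \<in> borel_measurable (borel \<Otimes>\<^sub>M borel)"
  unfolding diff_quot_eq by measurable

lemma measurable_pair_lborel:
  fixes F :: "'a \<times> 'a \<Rightarrow> real"
  assumes "F \<in> borel_measurable (borel \<Otimes>\<^sub>M borel)"
  shows "F \<in> borel_measurable lborel"
  using assms by (simp add: borel_prod)

lemma integrable_pair_bound:
  fixes F G :: "'a \<times> 'a \<Rightarrow> real"
  assumes "integrable lborel G" "F \<in> borel_measurable (borel \<Otimes>\<^sub>M borel)"
    and "\<And>x y. \<bar>F (x, y)\<bar> \<le> G (x, y)"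
  shows "integrable lborel F"
proof (rule Bochner_Integration.integrable_bound[OF assms(1) measurable_pair_lborel[OF assms(2)]], rule AE_I2)
  fix z :: "'a \<times> 'a"
  show "norm (F z) \<le> norm (G z)" using assms(3)[of "fst z" "snd z"] by simp
qed

lemma mass_nonneg: "0 \<le> mass u"
  by (simp add: mass_def)

lemma seminorm_nonneg: "0 \<le> seminorm_pow u"
  unfolding seminorm_pow_def by (rule integral_nonneg_AE) (auto simp: diff_quot_nonneg)

lemma dens_nonneg: "0 \<le> dens u x"
  by (simp add: dens_def diff_quot_nonneg)

lemma dens_measurable [measurable]:
  assumes [measurable]: "u \<in> borel_measurable borel"
  shows "dens u \<in> borel_measurable borel"
proof -
  have "(\<lambda>(x, y). diff_quot s p u x y) \<in> borel_measurable (lborel \<Otimes>\<^sub>M lborel)" by measurable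
  then have "(\<lambda>x. \<integral>y. diff_quot s p u x y \<partial>lborel) \<in> borel_measurable lborel"
    by (rule lborel.borel_measurable_lebesgue_integral)
  then show ?thesis by (simp add: dens_def[abs_def])
qed

lemma integrable_weighted_diff_quot:
  assumes u: "u \<in> finite_energy" and g[measurable]: "g \<in> borel_measurable borel"
    and b: "\<And>x. \<bar>g x\<bar> \<le> M"
  shows "integrable lborel (\<lambda>(x, y). g x * diff_quot s p u x y)"
proof -
  note [measurable] = finite_energyD(1)[OF u]
  have "integrable lborel (\<lambda>z. M * (\<lambda>(x, y). diff_quot s p u x y) z)"
    using finite_energyD(3)[OF u] by (rule integrable_mult_right)
  then show ?thesis
    by (rule integrable_pair_bound) (auto simp: abs_mult diff_quot_nonneg intro!: mult_right_mono b)
qed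

lemma
  assumes u: "u \<in> finite_energy" and g[measurable]: "g \<in> borel_measurable borel"
    and b: "\<And>x. \<bar>g x\<bar> \<le> M"
  shows integrable_weighted_dens: "integrable lborel (\<lambda>x. g x * dens u x)"
    and integral_weighted_dens:
      "(\<integral>x. g x * dens u x \<partial>lborel) = (\<integral>(x, y). g x * diff_quot s p u x y \<partial>lborel)"
proof -
  have int: "integrable (lborel \<Otimes>\<^sub>M lborel) (\<lambda>(x, y). g x * diff_quot s p u x y)"
    using integrable_weighted_diff_quot[OF assms] by (simp add: lborel_prod)
  show "integrable lborel (\<lambda>x. g x * dens u x)"
    using lborel_pair.integrable_fst'[OF int] by (simp add: dens_def)
  show "(\<integral>x. g x * dens u x \<partial>lborel) = (\<integral>(x, y). g x * diff_quot s p u x y \<partial>lborel)"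
    using lborel_pair.integral_fst'[OF int] by (simp add: dens_def lborel_prod)
qed

lemma integrable_dens: "u \<in> finite_energy \<Longrightarrow> integrable lborel (dens u)"
  and integral_dens: "u \<in> finite_energy \<Longrightarrow> (\<integral>x. dens u x \<partial>lborel) = seminorm_pow u"
  using integrable_weighted_dens[of u "\<lambda>_. 1" 1] integral_weighted_dens[of u "\<lambda>_. 1" 1]
  by (simp_all add: seminorm_pow_def)

lemma AE_integrable_diff_quot:
  assumes u: "u \<in> finite_energy"
  shows "AE x in lborel. integrable lborel (diff_quot s p u x)"
  using lborel_pair.AE_integrable_fst'[of "\<lambda>(x, y). diff_quot s p u x y"] finite_energyD(3)[OF u]
  by (simp add: lborel_prod)

section \<open>The fractional Sobolev inequality\<close>

definition "sobolev_factor = 2 / unit_ball_vol N * 2 powr p * (2 * 2 powr P / unit_ball_vol N) powr (p * s / N)"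

lemma sobolev_factor_pos: "0 < sobolev_factor"
proof -
  have "unit_ball_vol N \<noteq> 0" using unit_ball_vol_pos[OF less_imp_le[OF N_pos]] by linarith
  then show ?thesis
    using N_pos unfolding sobolev_factor_def by (intro mult_pos_pos divide_pos_pos) auto
qed

text \<open>
  Let \<open>a = \<bar>u x\<bar>\<close>. For every \<open>y\<close> either \<open>\<bar>u y\<bar>\<close> or \<open>\<bar>u x - u y\<bar>\<close> is at least \<open>a / 2\<close>, so
  \<open>1 \<le> (2 \<bar>u y\<bar> / a)\<^sup>P + (2 \<bar>u x - u y\<bar> / a)\<^sup>p\<close>. Integrating over the ball of radius \<open>r\<close> around
  \<open>x\<close> bounds its volume by a term with the total mass and one with \<open>dens u x\<close>. The radius for which the
  first term is half the volume gives the claim; in it the powers of \<open>a\<close> add up to \<open>P\<close>.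
\<close>

lemma sobolev_pointwise:
  assumes u: "u \<in> finite_energy" and B: "0 < mass u"
    and int: "integrable lborel (diff_quot s p u x)"
  shows "\<bar>u x\<bar> powr P \<le> sobolev_factor * mass u powr (p * s / N) * dens u x"
proof (cases "u x = 0")
  case True
  then show ?thesis
    using P_pos sobolev_factor_pos dens_nonneg[of u x] by simp
next
  case False
  define a where "a = \<bar>u x\<bar>"
  have a: "0 < a" using False by (simp add: a_def)
  define V where "V = unit_ball_vol N"
  have V: "0 < V" using N_pos by (simp add: V_def)
  \<comment> \<open>With this radius the mass term is half the volume of the ball.\<close>
  define r where "r = (2 * (2 / a) powr P * mass u / V) powr (1 / N)"
  have r: "0 < r" using a B V by (simp add: r_def)
  have rN: "V * r powr N = 2 * ((2 / a) powr P * mass u)"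
    using a B V N_pos by (simp add: r_def powr_powr)
  have dich: "indicator (cball x r) y \<le> (2 / a) powr P * \<bar>u y\<bar> powr P + (2 / a) powr p * r powr (N + p * s) * diff_quot s p u x y"
    (is "_ \<le> ?A y + ?D y") for y :: 'a
  proof (cases "y \<in> cball x r")
    case True
    have pos: "0 \<le> ?A y" "0 \<le> ?D y" by (auto simp: diff_quot_nonneg)
    consider "a \<le> 2 * \<bar>u y\<bar>" | "a \<le> 2 * \<bar>u x - u y\<bar>" 
      unfolding a_def using abs_triangle_ineq[of "u y" "u x - u y"]
      by (cases "\<bar>u x\<bar> \<le> 2 * \<bar>u y\<bar>") auto
    then have "1 \<le> ?A y + ?D y"
    proof cases
      case 1
      have "1 \<le> (2 / a * \<bar>u y\<bar>) powr P"
        using 1 a P_pos by (intro ge_one_powr_ge_zero) (auto simp: field_simps)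
      also have "\<dots> = ?A y" by (rule powr_mult)
      finally show ?thesis using pos by linarith
    next
      case 2
      then have "x \<noteq> y" using a by auto
      have "1 \<le> (2 / a * \<bar>u x - u y\<bar>) powr p"
        using 2 a p_gt by (intro ge_one_powr_ge_zero) (auto simp: field_simps)
      also have "\<dots> = (2 / a) powr p * (norm (x - y) powr (N + p * s) * diff_quot s p u x y)"
        using a \<open>x \<noteq> y\<close> powr_mult[of "2 / a" "\<bar>u x - u y\<bar>" p] by (simp add: diff_quot_eq kernel_def)
      also have "\<dots> \<le> (2 / a) powr p * (r powr (N + p * s) * diff_quot s p u x y)"
        using True N_ps_pos
        by (intro mult_left_mono mult_right_mono powr_mono2) (auto simp: diff_quot_nonneg dist_norm)
      also have "\<dots> = ?D y" by simp
      finally show ?thesis using pos by linarith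
    qed
    then show ?thesis using True by simp
  qed (simp add: diff_quot_nonneg)
  have "V * r powr N = (\<integral>y. indicator (cball x r) y \<partial>lborel)"
    using r V by (simp add: V_def[symmetric] enn2real_ennreal measure_def emeasure_cball powr_N flip: N_eq)
  also have "\<dots> \<le> (\<integral>y. ?A y + ?D y \<partial>lborel)"
    using dich finite_energyD(2)[OF u] int r
    by (intro integral_mono integrable_real_indicator) (auto simp: emeasure_cball)
  also have "\<dots> = (2 / a) powr P * mass u + (2 / a) powr p * r powr (N + p * s) * dens u x"
    using finite_energyD(2)[OF u] int by (simp add: mass_def dens_def)
  finally have "V * r powr N / 2 \<le> (2 / a) powr p * r powr (N + p * s) * dens u x"
    using rN by linarith
  then have "V / 2 \<le> (2 / a) powr p * r powr (p * s) * dens u x"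
    using r by (simp add: powr_add mult.assoc mult.left_commute[of _ "r powr N"])
  also have "r powr (p * s) = (2 * 2 powr P / V) powr (p * s / N) * mass u powr (p * s / N) * a powr (- P * (p * s / N))"
  proof -
    have "2 * (2 / a) powr P * mass u / V = 2 * 2 powr P / V * mass u * a powr (- P)"
      using a by (simp add: powr_divide powr_minus divide_simps)
    moreover have "r powr (p * s) = (2 * (2 / a) powr P * mass u / V) powr (p * s / N)"
      by (simp add: r_def powr_powr)
    ultimately have "r powr (p * s) = (2 * 2 powr P / V * mass u * a powr (- P)) powr (p * s / N)"
      by (simp only:)
    then show ?thesis by (simp only: powr_mult powr_powr)
  qed
  finally have "V / 2 * a powr P \<le> ((2 / a) powr p * ((2 * 2 powr P / V) powr (p * s / N) * mass u powr (p * s / N) * a powr (- P * (p * s / N))) * dens u x) * a powr P"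
    using a by (intro mult_right_mono) auto
  also have "\<dots> = 2 powr p * (2 * 2 powr P / V) powr (p * s / N) * mass u powr (p * s / N) * dens u x * (a powr (- p) * a powr (- P * (p * s / N)) * a powr P)"
  proof -
    have "(2 / a) powr p = 2 powr p * a powr (- p)" using a by (simp add: powr_divide powr_minus_divide)
    then show ?thesis by (simp only: mult_ac)
  qed
  also have "a powr (- p) * a powr (- P * (p * s / N)) * a powr P = 1"
  proof -
    have "- p + - P * (p * s / N) + P = 0"
      using p_div_P P_pos N_pos by (simp add: field_simps)
    then show ?thesis using a by (simp flip: powr_add)
  qed
  finally show ?thesis
    using V by (simp add: sobolev_factor_def a_def V_def[symmetric] field_simps)
qed

text \<open>
  The pointwise bound is integrated. The factor \<open>mass u\<close> to the power \<open>p s / N = 1 - p / P\<close> on the right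
  can be divided out because \<open>mass u\<close> is finite by assumption.
\<close>

lemma sobolev_inequality:
  assumes u: "u \<in> finite_energy"
  shows "mass u powr (p / P) \<le> sobolev_factor * seminorm_pow u"
proof (cases "mass u = 0")
  case True
  then show ?thesis using sobolev_factor_pos seminorm_nonneg[of u] by simp
next
  case False
  then have B: "0 < mass u" using mass_nonneg[of u] by simp
  have "mass u \<le> (\<integral>x. sobolev_factor * mass u powr (p * s / N) * dens u x \<partial>lborel)"
    unfolding mass_def[of u]
    using AE_integrable_diff_quot[OF u] sobolev_pointwise[OF u B] finite_energyD(2)[OF u] integrable_dens[OF u]
    by (intro integral_mono_AE) (auto simp: mass_def)
  also have "\<dots> = sobolev_factor * mass u powr (p * s / N) * seminorm_pow u"
    using integral_dens[OF u] by simp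
  finally have "mass u powr 1 \<le> sobolev_factor * mass u powr (p * s / N) * seminorm_pow u"
    using B by simp
  moreover have "mass u powr 1 = mass u powr (p / P) * mass u powr (p * s / N)"
    using p_div_P by (simp flip: powr_add)
  ultimately have "mass u powr (p * s / N) * mass u powr (p / P)
      \<le> mass u powr (p * s / N) * (sobolev_factor * seminorm_pow u)"
    by (simp add: mult_ac)
  then show ?thesis using B by simp
qed

section \<open>Cutting off\<close>

lemma
  fixes H :: "'a \<Rightarrow> real"
  assumes H: "integrable lborel H"
  shows integrable_lborel_shift: "integrable lborel (\<lambda>x. H (x - y))"
    and integral_lborel_shift: "(\<integral>x. H (x - y) \<partial>lborel) = (\<integral>x. H x \<partial>lborel)"
proof -
  have [measurable]: "H \<in> borel_measurable borel" using H by auto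
  show "integrable lborel (\<lambda>x. H (x - y))"
    using H by (subst (asm) lborel_distr_plus[of "- y", symmetric]) (simp add: integrable_distr_eq)
  show "(\<integral>x. H (x - y) \<partial>lborel) = (\<integral>x. H x \<partial>lborel)"
    by (subst (2) lborel_distr_plus[of "- y", symmetric]) (simp add: integral_distr)
qed

lemma
  fixes f H :: "'a \<Rightarrow> real"
  assumes f: "integrable lborel f" and H: "integrable lborel H"
  shows integrable_convolution: "integrable lborel (\<lambda>(x, y). f y * H (x - y))"
    and integral_convolution:
      "(\<integral>(x, y). f y * H (x - y) \<partial>lborel) = (\<integral>y. f y \<partial>lborel) * (\<integral>z. H z \<partial>lborel)"
proof -
  have [measurable]: "f \<in> borel_measurable borel" "H \<in> borel_measurable borel" using f H by auto
  have int: "integrable (lborel \<Otimes>\<^sub>M lborel) (\<lambda>(y, x). f y * H (x - y))"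
  proof (rule lborel_pair.Fubini_integrable)
    show "(\<lambda>(y, x). f y * H (x - y)) \<in> borel_measurable (lborel \<Otimes>\<^sub>M lborel)" by measurable
    have "(\<integral>x. norm (f y * H (x - y)) \<partial>lborel) = \<bar>f y\<bar> * (\<integral>z. \<bar>H z\<bar> \<partial>lborel)" for y
      using integral_lborel_shift[of "\<lambda>z. \<bar>H z\<bar>" y] H by (simp add: abs_mult)
    then show "integrable lborel (\<lambda>y. \<integral>x. norm (case (y, x) of (y, x) \<Rightarrow> f y * H (x - y)) \<partial>lborel)"
      using f by simp
    show "AE y in lborel. integrable lborel (\<lambda>x. case (y, x) of (y, x) \<Rightarrow> f y * H (x - y))"
      using integrable_lborel_shift[OF H] by simp
  qed
  have sw: "integrable (lborel \<Otimes>\<^sub>M lborel) (\<lambda>(x, y). f y * H (x - y))"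
    using lborel_pair.integrable_product_swap[OF int] by (simp add: case_prod_beta')
  then show "integrable lborel (\<lambda>(x, y). f y * H (x - y))" by (simp add: lborel_prod)
  have "(\<integral>(x, y). f y * H (x - y) \<partial>lborel) = (\<integral>y. (\<integral>x. f y * H (x - y) \<partial>lborel) \<partial>lborel)"
    using lborel_pair.integral_snd[of "\<lambda>x y. f y * H (x - y)"] sw by (simp add: lborel_prod)
  then show "(\<integral>(x, y). f y * H (x - y) \<partial>lborel) = (\<integral>y. f y \<partial>lborel) * (\<integral>z. H z \<partial>lborel)"
    using integral_lborel_shift[OF H] by simp
qed

text \<open>
  The difference of \<open>\<eta> v\<close> at two points is \<open>\<eta> x (v x - v y) + v y (\<eta> x - \<eta> y)\<close>. The second part is
  controlled by the \<open>L\<^sup>p\<close> norm of \<open>v\<close> alone, through a convolution with \<open>h\<close> times the kernel; the function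
  \<open>h\<close> plays the role of the \<open>p\<close>-th power of a modulus of continuity of \<open>\<eta>\<close>.
\<close>

lemma
  assumes v: "v \<in> finite_energy" and vp: "integrable lborel (\<lambda>x. \<bar>v x\<bar> powr p)"
    and eta[measurable]: "\<eta> \<in> borel_measurable borel" and eta01: "\<And>x. 0 \<le> \<eta> x" "\<And>x. \<eta> x \<le> 1"
    and osc: "\<And>x y. \<bar>\<eta> x - \<eta> y\<bar> powr p \<le> h (x - y)"
    and h: "integrable lborel (\<lambda>z. h z * kernel z)"
  shows cutoff_finite_energy: "(\<lambda>x. \<eta> x * v x) \<in> finite_energy"
    and cutoff_seminorm_le: "\<And>l. 0 < l \<Longrightarrow> l < 1 \<Longrightarrow> seminorm_pow (\<lambda>x. \<eta> x * v x) \<le>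
      l powr (1 - p) * (\<integral>x. \<eta> x powr p * dens v x \<partial>lborel)
      + (1 - l) powr (1 - p) * ((\<integral>z. h z * kernel z \<partial>lborel) * (\<integral>x. \<bar>v x\<bar> powr p \<partial>lborel))"
proof -
  note [measurable] = finite_energyD(1)[OF v]
  have ep: "\<bar>\<eta> x powr q\<bar> \<le> 1" if "0 \<le> q" for x q
    using powr_mono2[of q "\<eta> x" 1] eta01[of x] that by simp
  let ?G = "\<lambda>l (x, y). l powr (1 - p) * (\<eta> x powr p * diff_quot s p v x y)
     + (1 - l) powr (1 - p) * (\<bar>v y\<bar> powr p * (h (x - y) * kernel (x - y)))"
  have pw: "diff_quot s p (\<lambda>x. \<eta> x * v x) x y \<le> ?G l (x, y)" if "0 < l" "l < 1" for l x y
  proof -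
    have "\<bar>\<eta> x * v x - \<eta> y * v y\<bar> powr p = \<bar>\<eta> x * (v x - v y) + v y * (\<eta> x - \<eta> y)\<bar> powr p"
      by (simp add: algebra_simps)
    also have "\<dots> \<le> l powr (1 - p) * \<bar>\<eta> x * (v x - v y)\<bar> powr p + (1 - l) powr (1 - p) * \<bar>v y * (\<eta> x - \<eta> y)\<bar> powr p"
      using that p_gt by (intro powr_convex_combination) auto
    also have "\<dots> = l powr (1 - p) * (\<eta> x powr p * \<bar>v x - v y\<bar> powr p) + (1 - l) powr (1 - p) * (\<bar>v y\<bar> powr p * \<bar>\<eta> x - \<eta> y\<bar> powr p)"
      using eta01[of x] by (simp add: abs_mult powr_mult)
    also have "\<dots> \<le> l powr (1 - p) * (\<eta> x powr p * \<bar>v x - v y\<bar> powr p) + (1 - l) powr (1 - p) * (\<bar>v y\<bar> powr p * h (x - y))"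
      using osc by (intro add_left_mono mult_left_mono) auto
    finally show ?thesis
      unfolding diff_quot_eq prod.case using mult_right_mono[OF _ kernel_nonneg[of "x - y"]] by (fastforce simp: algebra_simps)
  qed
  have i1: "integrable lborel (\<lambda>(x, y). \<eta> x powr p * diff_quot s p v x y)"
    using p_gt by (intro integrable_weighted_diff_quot[OF v _ ep]) auto
  have i2: "integrable lborel (\<lambda>(x, y). \<bar>v y\<bar> powr p * (h (x - y) * kernel (x - y)))"
    by (rule integrable_convolution[OF vp h])
  have iG: "integrable lborel (?G l)" for l
    using Bochner_Integration.integrable_add[OF integrable_mult_right[OF i1, of "l powr (1 - p)"] integrable_mult_right[OF i2, of "(1 - l) powr (1 - p)"]]
    by (simp add: case_prod_beta')
  have [measurable]: "(\<lambda>x. \<eta> x * v x) \<in> borel_measurable borel" by measurable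
  have dq: "integrable lborel (\<lambda>(x, y). diff_quot s p (\<lambda>x. \<eta> x * v x) x y)"
    using pw[of "1/2"] by (intro integrable_pair_bound[OF iG[of "1/2"]]) (auto simp: diff_quot_nonneg)
  have "integrable lborel (\<lambda>x. \<bar>\<eta> x * v x\<bar> powr P)"
  proof (rule Bochner_Integration.integrable_bound[OF finite_energyD(2)[OF v]])
    show "AE x in lborel. norm (\<bar>\<eta> x * v x\<bar> powr P) \<le> norm (\<bar>v x\<bar> powr P)"
    proof (rule AE_I2)
      fix x
      have "\<bar>\<eta> x * v x\<bar> powr P = \<eta> x powr P * \<bar>v x\<bar> powr P"
        using eta01[of x] by (simp add: abs_mult powr_mult)
      also have "\<dots> \<le> 1 * \<bar>v x\<bar> powr P" using ep[of P x] P_pos by (intro mult_right_mono) auto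
      finally show "norm (\<bar>\<eta> x * v x\<bar> powr P) \<le> norm (\<bar>v x\<bar> powr P)" by simp
    qed
  qed measurable
  then show "(\<lambda>x. \<eta> x * v x) \<in> finite_energy" using dq by (simp add: finite_energy_def)
  fix l :: real assume l: "0 < l" "l < 1"
  have "seminorm_pow (\<lambda>x. \<eta> x * v x) \<le> integral\<^sup>L lborel (?G l)"
    unfolding seminorm_pow_def using pw[OF l] by (intro integral_mono dq iG) auto
  also have "\<dots> = l powr (1 - p) * (\<integral>(x, y). \<eta> x powr p * diff_quot s p v x y \<partial>lborel)
      + (1 - l) powr (1 - p) * (\<integral>(x, y). \<bar>v y\<bar> powr p * (h (x - y) * kernel (x - y)) \<partial>lborel)"
    using integrable_mult_right[OF i1, of "l powr (1 - p)"] integrable_mult_right[OF i2, of "(1 - l) powr (1 - p)"]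
    by (simp add: case_prod_beta')
  also have "(\<integral>(x, y). \<eta> x powr p * diff_quot s p v x y \<partial>lborel) = (\<integral>x. \<eta> x powr p * dens v x \<partial>lborel)"
    using p_gt by (intro integral_weighted_dens[OF v _ ep, symmetric]) auto
  also have "(\<integral>(x, y). \<bar>v y\<bar> powr p * (h (x - y) * kernel (x - y)) \<partial>lborel)
      = (\<integral>z. h z * kernel z \<partial>lborel) * (\<integral>x. \<bar>v x\<bar> powr p \<partial>lborel)"
    by (simp add: integral_convolution[OF vp h] mult.commute)
  finally show "seminorm_pow (\<lambda>x. \<eta> x * v x) \<le>
      l powr (1 - p) * (\<integral>x. \<eta> x powr p * dens v x \<partial>lborel)
      + (1 - l) powr (1 - p) * ((\<integral>z. h z * kernel z \<partial>lborel) * (\<integral>x. \<bar>v x\<bar> powr p \<partial>lborel))" .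
qed

end

section \<open>Borel representatives\<close>

lemma AE_lborel_pair:
  fixes R :: "'a::euclidean_space \<Rightarrow> bool"
  assumes "AE x in lborel. R x"
  shows "AE (x, y) in (lborel :: ('a \<times> 'a) measure). R x \<and> R y"
proof -
  from assms obtain Z where Z: "{x \<in> space lborel. \<not> R x} \<subseteq> Z" "emeasure lborel Z = 0" "Z \<in> sets lborel"
    by (rule AE_E)
  have "Z \<times> UNIV \<in> null_sets (lborel \<Otimes>\<^sub>M lborel :: ('a \<times> 'a) measure)"
    using Z by (intro lborel.times_in_null_sets1) auto
  moreover have "UNIV \<times> Z \<in> null_sets (lborel \<Otimes>\<^sub>M lborel :: ('a \<times> 'a) measure)"
    using Z by (intro lborel.times_in_null_sets2) auto
  ultimately have "AE z in (lborel \<Otimes>\<^sub>M lborel :: ('a \<times> 'a) measure). z \<notin> Z \<times> UNIV"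
    "AE z in (lborel \<Otimes>\<^sub>M lborel :: ('a \<times> 'a) measure). z \<notin> UNIV \<times> Z"
    by (auto dest: AE_not_in)
  then show ?thesis
    unfolding lborel_prod by eventually_elim (use Z in auto)
qed

lemma
  fixes f g :: "'b::euclidean_space \<Rightarrow> real"
  assumes g: "g \<in> borel_measurable borel" and ae: "AE x in lborel. f x = g x"
  shows lebesgue_measurable_if_AE_borel: "f \<in> borel_measurable lebesgue"
    and integrable_lebesgue_iff_borel: "integrable lebesgue f \<longleftrightarrow> integrable lborel g"
    and integral_lebesgue_eq_borel: "integral\<^sup>L lebesgue f = integral\<^sup>L lborel g"
proof -
  have g': "g \<in> borel_measurable lebesgue" using g by (simp add: measurable_completion)
  have ae': "AE x in lebesgue. f x = g x" using ae by (rule AE_completion)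
  then have "AE x in lebesgue. g x = f x" by (rule AE_mp) auto
  then show f: "f \<in> borel_measurable lebesgue"
    by (rule borel_measurable_AE[OF g'])
  show "integrable lebesgue f \<longleftrightarrow> integrable lborel g"
    using integrable_cong_AE[OF f g' ae'] integrable_completion[of g lborel] g by simp
  show "integral\<^sup>L lebesgue f = integral\<^sup>L lborel g"
    using integral_cong_AE[OF f g' ae'] integral_completion[of g lborel] g by simp
qed

context fractional_exponents begin

text \<open>
  All notions of the theorem depend on a function only up to null sets. For the double integrals this
  uses that a null set times the whole space is a null set of the product.
\<close>

lemma
  fixes u v :: "'a \<Rightarrow> real"
  assumes v[measurable]: "v \<in> borel_measurable borel" and ae: "AE x in lborel. u x = v x"
  shows integrable_abs_powr_iff: "integrable lebesgue (\<lambda>x. \<bar>u x\<bar> powr q) \<longleftrightarrow> integrable lborel (\<lambda>x. \<bar>v x\<bar> powr q)"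
    and integral_abs_powr_eq: "(\<integral>x. \<bar>u x\<bar> powr q \<partial>lebesgue) = (\<integral>x. \<bar>v x\<bar> powr q \<partial>lborel)"
    and integrable_diff_quot_iff: "integrable lebesgue (\<lambda>(x, y). diff_quot s p u x y)
      \<longleftrightarrow> integrable lborel (\<lambda>(x, y). diff_quot s p v x y)"
    and gagliardo_pow_eq: "gagliardo_pow s p u = seminorm_pow v"
    and Ds_pow_eq: "AE x in lborel. Ds_pow s p u x = dens v x"
    and zero_ae_iff: "zero_ae u \<longleftrightarrow> (AE x in lborel. v x = 0)"
proof -
  have a: "AE x in lborel. \<bar>u x\<bar> powr q = \<bar>v x\<bar> powr q" using ae by eventually_elim simp
  show "integrable lebesgue (\<lambda>x. \<bar>u x\<bar> powr q) \<longleftrightarrow> integrable lborel (\<lambda>x. \<bar>v x\<bar> powr q)"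
    "(\<integral>x. \<bar>u x\<bar> powr q \<partial>lebesgue) = (\<integral>x. \<bar>v x\<bar> powr q \<partial>lborel)"
    by (rule integrable_lebesgue_iff_borel[OF _ a] integral_lebesgue_eq_borel[OF _ a]; measurable)+
  have d: "AE z in lborel. (\<lambda>(x, y). diff_quot s p u x y) z = (\<lambda>(x, y). diff_quot s p v x y) z"
    using AE_lborel_pair[OF ae] by eventually_elim (auto simp: diff_quot_def)
  have m: "(\<lambda>(x, y). diff_quot s p v x y) \<in> borel_measurable borel"
    using measurable_diff_quot[OF v] by (simp add: borel_prod)
  show "integrable lebesgue (\<lambda>(x, y). diff_quot s p u x y)
      \<longleftrightarrow> integrable lborel (\<lambda>(x, y). diff_quot s p v x y)"
    by (rule integrable_lebesgue_iff_borel[OF m d])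
  show "gagliardo_pow s p u = seminorm_pow v"
    unfolding gagliardo_pow_def seminorm_pow_def by (rule integral_lebesgue_eq_borel[OF m d])
  show "AE x in lborel. Ds_pow s p u x = dens v x"
    using ae
  proof eventually_elim
    fix x assume x: "u x = v x"
    have "AE y in lborel. diff_quot s p u x y = diff_quot s p v x y"
      using ae by eventually_elim (simp add: diff_quot_def x)
    moreover have "diff_quot s p v x \<in> borel_measurable borel"
      unfolding diff_quot_eq[abs_def] by measurable
    ultimately show "Ds_pow s p u x = dens v x"
      unfolding Ds_pow_def dens_def by (intro integral_lebesgue_eq_borel)
  qed
  have "(AE x in lborel. u x = 0) \<longleftrightarrow> (AE x in lborel. v x = 0)"
  proof
    assume "AE x in lborel. u x = 0"
    with ae show "AE x in lborel. v x = 0" by eventually_elim simp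
  next
    assume "AE x in lborel. v x = 0"
    with ae show "AE x in lborel. u x = 0" by eventually_elim simp
  qed
  then show "zero_ae u \<longleftrightarrow> (AE x in lborel. v x = 0)"
    by (simp add: zero_ae_def AE_completion_iff)
qed

lemma W0_representative:
  assumes u: "u \<in> W0 s p \<Omega>" and \<Omega>: "open \<Omega>"
  obtains v where "v \<in> finite_energy" "\<And>x. x \<notin> \<Omega> \<Longrightarrow> v x = 0" "AE x in lborel. u x = v x"
proof -
  have um: "u \<in> borel_measurable lebesgue" using u by (simp add: W0_def Lspace_def)
  then obtain v0 where v0[measurable]: "v0 \<in> borel_measurable borel" and ae0: "AE x in lborel. u x = v0 x"
    using completion_ex_borel_measurable_real[of u lborel] by auto
  define v where "v x = indicator \<Omega> x * v0 x" for x
  have [measurable]: "\<Omega> \<in> sets borel" using \<Omega> by simp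
  have v[measurable]: "v \<in> borel_measurable borel" unfolding v_def[abs_def] by measurable
  have "AE x in lborel. x \<notin> \<Omega> \<longrightarrow> u x = 0" using u by (simp add: W0_def AE_completion_iff)
  with ae0 have ae: "AE x in lborel. u x = v x"
    by eventually_elim (auto simp: v_def indicator_def)
  have "v \<in> finite_energy"
    using u integrable_abs_powr_iff[OF v ae, of P] integrable_diff_quot_iff[OF v ae]
    by (simp add: W0_def Lspace_def finite_energy_def flip: P_eq)
  moreover have "v x = 0" if "x \<notin> \<Omega>" for x using that by (simp add: v_def)
  ultimately show thesis using ae that by blast
qed

lemma finite_energy_in_W0:
  assumes v: "v \<in> finite_energy" and 0: "\<And>x. x \<notin> \<Omega> \<Longrightarrow> v x = 0"
  shows "v \<in> W0 s p \<Omega>"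
proof -
  note vm = finite_energyD(1)[OF v]
  have ae: "AE x in lborel. v x = v x" by simp
  show ?thesis
    using finite_energyD[OF v] integrable_abs_powr_iff[OF vm ae, of P] integrable_diff_quot_iff[OF vm ae] 0
    by (auto simp: W0_def Lspace_def measurable_completion simp flip: P_eq)
qed

lemma mass_pos_iff:
  assumes v: "v \<in> finite_energy"
  shows "0 < mass v \<longleftrightarrow> \<not> (AE x in lborel. v x = 0)"
proof -
  have "mass v = 0 \<longleftrightarrow> (AE x in lborel. v x = 0)"
    unfolding mass_def using integral_nonneg_eq_0_iff_AE[OF finite_energyD(2)[OF v]] by simp
  then show ?thesis using mass_nonneg[of v] by linarith
qed

section \<open>The Sobolev constant\<close>

lemma S_eq_Inf: "S = Inf {seminorm_pow v / mass v powr (p / P) | v. v \<in> finite_energy \<and> 0 < mass v}"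
proof -
  have quot: "gagliardo_pow s p u / Lnorm P u powr p = seminorm_pow v / mass v powr (p / P)"
    if "v \<in> finite_energy" "AE x in lborel. u x = v x" for u v :: "'a \<Rightarrow> real"
    using gagliardo_pow_eq[OF finite_energyD(1)[OF that(1)] that(2)]
      integral_abs_powr_eq[OF finite_energyD(1)[OF that(1)] that(2)]
    by (simp add: Lnorm_def mass_def powr_powr)
  have "{gagliardo_pow s p u / Lnorm P u powr p | u. u \<in> W0 s p (UNIV :: 'a set) \<and> \<not> zero_ae u}
      = {seminorm_pow v / mass v powr (p / P) | v. v \<in> finite_energy \<and> 0 < mass v}" (is "?A = ?B")
  proof (intro set_eqI iffI)
    fix c assume "c \<in> ?A"
    then obtain u where u: "c = gagliardo_pow s p u / Lnorm P u powr p" "u \<in> W0 s p (UNIV :: 'a set)" "\<not> zero_ae u"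
      by blast
    from u(2) obtain v where v: "v \<in> finite_energy" "AE x in lborel. u x = v x"
      using W0_representative[OF u(2)] by auto
    have "0 < mass v"
      using u(3) mass_pos_iff[OF v(1)] zero_ae_iff[OF finite_energyD(1)[OF v(1)] v(2)] by simp
    then show "c \<in> ?B" using v(1) u(1) quot[OF v] by blast
  next
    fix c assume "c \<in> ?B"
    then obtain v where v: "c = seminorm_pow v / mass v powr (p / P)" "v \<in> finite_energy" "0 < mass v" by blast
    have ae: "AE x in lborel. v x = v x" by simp
    have "v \<in> W0 s p UNIV" by (rule finite_energy_in_W0[OF v(2)]) simp
    moreover have "\<not> zero_ae v"
      using v(3) mass_pos_iff[OF v(2)] zero_ae_iff[OF finite_energyD(1)[OF v(2)] ae] by simp
    ultimately show "c \<in> ?A" using v(1) quot[OF v(2) ae] by (auto intro!: exI[of _ v])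
  qed
  then show ?thesis by (simp add: S_eq sobolev_const_def flip: P_eq)
qed

lemma S_mass_le_seminorm:
  assumes v: "v \<in> finite_energy"
  shows "S * mass v powr (p / P) \<le> seminorm_pow v"
proof (cases "0 < mass v")
  case True
  have "S \<le> seminorm_pow v / mass v powr (p / P)"
    unfolding S_eq_Inf
    by (rule cInf_lower) (use v True in \<open>auto intro!: bdd_belowI[of _ 0] simp: seminorm_nonneg\<close>)
  then show ?thesis using True by (simp add: pos_le_divide_eq)
next
  case False
  then have "mass v = 0" using mass_nonneg[of v] by simp
  then show ?thesis using p_gt seminorm_nonneg[of v] by simp
qed

text \<open>
  The infimum of the empty set is not determined; hence the assumption that some function of positive
  mass has finite energy.
\<close>

lemma S_pos:
  assumes "v \<in> finite_energy" "0 < mass v"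
  shows "0 < S"
proof -
  have "1 / sobolev_factor \<le> S"
    unfolding S_eq_Inf
  proof (rule cInf_greatest)
    fix c assume "c \<in> {seminorm_pow v / mass v powr (p / P) | v. v \<in> finite_energy \<and> 0 < mass v}"
    then obtain w where w: "c = seminorm_pow w / mass w powr (p / P)" "w \<in> finite_energy" "0 < mass w" by blast
    show "1 / sobolev_factor \<le> c"
      using sobolev_inequality[OF w(2)] sobolev_factor_pos w(3) unfolding w(1)
      by (simp add: divide_le_eq le_divide_eq mult.commute)
  qed (use assms in blast)
  then show ?thesis using sobolev_factor_pos by (meson divide_pos_pos less_le_trans zero_less_one)
qed

section \<open>Almost extremal functions supported in a given open set\<close>

lemma almost_extremal:
  assumes "v \<in> finite_energy" "0 < mass v" "S < c"
  obtains w where "w \<in> finite_energy" "seminorm_pow w < c * mass w powr (p / P)"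
proof -
  have "\<exists>x\<in>{seminorm_pow v / mass v powr (p / P) | v. v \<in> finite_energy \<and> 0 < mass v}. x < c"
    using assms unfolding S_eq_Inf
    by (subst (asm) cInf_less_iff) (auto intro!: bdd_belowI[of _ 0] simp: seminorm_nonneg)
  then show thesis using that by (auto simp: pos_divide_less_eq)
qed

text \<open>
  Cutting off in space needs \<open>v\<close> in \<open>L\<^sup>p\<close>, which for a function in \<open>L\<^sup>P\<close> may fail where it is small. The
  truncation \<open>(\<bar>v\<bar> - 1/k)\<^sup>+\<close> removes the small values, does not increase the energy and loses little mass.
\<close>

lemma almost_extremal_Lp:
  assumes v: "v \<in> finite_energy" and less: "seminorm_pow v < c * mass v powr (p / P)"
  obtains w where "w \<in> finite_energy" "seminorm_pow w < c * mass w powr (p / P)"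
    "integrable lborel (\<lambda>x. \<bar>w x\<bar> powr p)"
proof -
  note [measurable] = finite_energyD(1)[OF v]
  define w where "w k x = max 0 (\<bar>v x\<bar> - 1 / real (Suc k))" for k x
  have [measurable]: "w k \<in> borel_measurable borel" for k unfolding w_def[abs_def] by measurable
  have le: "\<bar>w k x\<bar> \<le> \<bar>v x\<bar>" for k x by (simp add: w_def)
  have le': "\<bar>w k x - w k y\<bar> \<le> \<bar>v x - v y\<bar>" for k x y by (auto simp: w_def)
  have dq: "diff_quot s p (w k) x y \<le> diff_quot s p v x y" for k x y
    unfolding diff_quot_eq using le' p_gt by (intro mult_right_mono powr_mono2 kernel_nonneg) auto
  have w1: "integrable lborel (\<lambda>x. \<bar>w k x\<bar> powr P)" for k
    by (rule Bochner_Integration.integrable_bound[OF finite_energyD(2)[OF v]])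
       (use le P_pos in \<open>auto intro!: powr_mono2\<close>)
  have w2: "integrable lborel (\<lambda>(x, y). diff_quot s p (w k) x y)" for k
    by (rule integrable_pair_bound[OF finite_energyD(3)[OF v]]) (auto simp: dq diff_quot_nonneg)
  have w: "w k \<in> finite_energy" for k using w1 w2 by (simp add: finite_energy_def)
  have sem: "seminorm_pow (w k) \<le> seminorm_pow v" for k
    unfolding seminorm_pow_def by (intro integral_mono w2 finite_energyD(3)[OF v]) (auto simp: dq)
  have "(\<lambda>k. mass (w k)) \<longlonglongrightarrow> mass v"
    unfolding mass_def
  proof (rule integral_dominated_convergence)
    show "integrable lborel (\<lambda>x. \<bar>v x\<bar> powr P)" by (rule finite_energyD(2)[OF v])
    show "AE x in lborel. (\<lambda>k. \<bar>w k x\<bar> powr P) \<longlonglongrightarrow> \<bar>v x\<bar> powr P"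
    proof (rule AE_I2)
      fix x
      have "(\<lambda>k. w k x) \<longlonglongrightarrow> max 0 (\<bar>v x\<bar> - 0)"
        unfolding w_def by (intro tendsto_intros LIMSEQ_Suc[OF lim_1_over_n])
      then have "(\<lambda>k. \<bar>w k x\<bar>) \<longlonglongrightarrow> \<bar>v x\<bar>"
        using tendsto_rabs by fastforce
      then show "(\<lambda>k. \<bar>w k x\<bar> powr P) \<longlonglongrightarrow> \<bar>v x\<bar> powr P"
        using P_pos by (intro tendsto_powr' tendsto_const) auto
    qed
    show "AE x in lborel. norm (\<bar>w k x\<bar> powr P) \<le> \<bar>v x\<bar> powr P" for k
      using le P_pos by (auto intro!: powr_mono2)
  qed measurable
  then have "(\<lambda>k. c * mass (w k) powr (p / P)) \<longlonglongrightarrow> c * mass v powr (p / P)"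
    using p_gt P_pos mass_nonneg by (intro tendsto_intros tendsto_powr') auto
  then have "eventually (\<lambda>k. seminorm_pow v < c * mass (w k) powr (p / P)) sequentially"
    using less by (rule order_tendstoD)
  then obtain k where k: "seminorm_pow v < c * mass (w k) powr (p / P)"
    by (auto simp: eventually_sequentially)
  have "integrable lborel (\<lambda>x. \<bar>w k x\<bar> powr p)"
  proof (rule Bochner_Integration.integrable_bound)
    show "integrable lborel (\<lambda>x. real (Suc k) powr (P - p) * \<bar>v x\<bar> powr P)"
      using finite_energyD(2)[OF v] by simp
    show "AE x in lborel. norm (\<bar>w k x\<bar> powr p) \<le> norm (real (Suc k) powr (P - p) * \<bar>v x\<bar> powr P)"
    proof (rule AE_I2)
      fix x
      show "norm (\<bar>w k x\<bar> powr p) \<le> norm (real (Suc k) powr (P - p) * \<bar>v x\<bar> powr P)"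
      proof (cases "w k x = 0")
        case False
        \<comment> \<open>Where the truncation is nonzero, \<open>k \<bar>v\<bar> > 1\<close>, so the power \<open>p\<close> is dominated by the power \<open>P\<close>.\<close>
        then have v1: "1 / real (Suc k) < \<bar>v x\<bar>" by (auto simp: w_def max_def split: if_splits)
        have "\<bar>w k x\<bar> powr p \<le> \<bar>v x\<bar> powr p" using le p_gt by (intro powr_mono2) auto
        also have "\<dots> = 1 * \<bar>v x\<bar> powr p" by simp
        also have "\<dots> \<le> (real (Suc k) * \<bar>v x\<bar>) powr (P - p) * \<bar>v x\<bar> powr p"
        proof (rule mult_right_mono)
          have "1 \<le> real (Suc k) * \<bar>v x\<bar>"
            using v1 by (simp add: pos_divide_less_eq mult.commute less_imp_le)
          then show "1 \<le> (real (Suc k) * \<bar>v x\<bar>) powr (P - p)"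
            using P_gt by (intro ge_one_powr_ge_zero) auto
        qed simp
        also have "\<dots> = real (Suc k) powr (P - p) * (\<bar>v x\<bar> powr (P - p) * \<bar>v x\<bar> powr p)"
          by (simp only: powr_mult mult.assoc)
        also have "\<dots> = real (Suc k) powr (P - p) * \<bar>v x\<bar> powr P"
          by (simp only: powr_add[symmetric]) simp
        finally show ?thesis by simp
      qed (use p_gt in simp)
    qed
  qed measurable
  moreover have "seminorm_pow (w k) < c * mass (w k) powr (p / P)"
    using sem[of k] k by linarith
  ultimately show thesis using that[OF w] by blast
qed


text \<open>
  The \<open>p\<close>-th power of the modulus of continuity of a cut-off function at scale \<open>\<rho>\<close>.
\<close>

definition cutoff_modulus :: "real \<Rightarrow> 'a \<Rightarrow> real" where
  "cutoff_modulus \<rho> z = min 1 (norm z / \<rho>) powr p"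

lemma cutoff_modulus_measurable [measurable]: "cutoff_modulus \<rho> \<in> borel_measurable borel"
  unfolding cutoff_modulus_def[abs_def] by measurable

lemma cutoff_modulus_nonneg: "0 \<le> cutoff_modulus \<rho> z" by (simp add: cutoff_modulus_def)

lemma cutoff_modulus_bound:
  assumes "0 < \<rho>" shows "\<bar>cutoff a \<rho> x - cutoff a \<rho> y\<bar> powr p \<le> cutoff_modulus \<rho> (x - y)"
  unfolding cutoff_modulus_def using cutoff_oscillation[OF assms, of a x y] p_gt by (intro powr_mono2) auto

lemma cutoff_modulus_le:
  assumes "0 < \<rho>"
  shows "cutoff_modulus \<rho> z \<le> max 1 (1 / \<rho>) powr p * (min 1 (norm z) powr p)"
proof -
  have "min 1 (norm z / \<rho>) \<le> max 1 (1 / \<rho>) * min 1 (norm z)"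
  proof (cases "norm z \<le> 1")
    case True
    have "norm z / \<rho> = (1 / \<rho>) * norm z" by simp
    also have "\<dots> \<le> max 1 (1 / \<rho>) * norm z" by (intro mult_right_mono) auto
    finally show ?thesis using True by simp
  qed auto
  then have "cutoff_modulus \<rho> z \<le> (max 1 (1 / \<rho>) * min 1 (norm z)) powr p"
    unfolding cutoff_modulus_def using assms p_gt by (intro powr_mono2) auto
  then show ?thesis by (simp add: powr_mult)
qed

lemma cutoff_modulus_integrable:
  assumes "0 < \<rho>" shows "integrable lborel (\<lambda>z. cutoff_modulus \<rho> z * kernel z)"
proof (rule Bochner_Integration.integrable_bound)
  show "integrable lborel (\<lambda>z. max 1 (1 / \<rho>) powr p * (min 1 (norm z) powr p * kernel z))"
    using kernel_integrable by simp
  show "AE z in lborel. norm (cutoff_modulus \<rho> z * kernel z) \<le> norm (max 1 (1 / \<rho>) powr p * (min 1 (norm z) powr p * kernel z))"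
    using mult_right_mono[OF cutoff_modulus_le[OF assms] kernel_nonneg] kernel_nonneg
    by (auto simp: abs_mult cutoff_modulus_nonneg mult.assoc)
qed measurable

lemma cutoff_modulus_integral_tendsto_0:
  "(\<lambda>k. \<integral>z. cutoff_modulus (real (Suc k)) z * kernel z \<partial>lborel) \<longlonglongrightarrow> 0"
proof -
  have "(\<lambda>k. \<integral>z. cutoff_modulus (real (Suc k)) z * kernel z \<partial>lborel) \<longlonglongrightarrow> (\<integral>z. 0 \<partial>(lborel :: 'a measure))"
  proof (rule integral_dominated_convergence)
    show "integrable lborel (\<lambda>z. min 1 (norm z) powr p * kernel z)" by (rule kernel_integrable)
    show "AE z in lborel. (\<lambda>k. cutoff_modulus (real (Suc k)) z * kernel z) \<longlonglongrightarrow> 0"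
    proof (rule AE_I2)
      fix z :: 'a
      have "(\<lambda>k. norm z * (1 / real (Suc k))) \<longlonglongrightarrow> norm z * 0"
        by (intro tendsto_intros LIMSEQ_Suc[OF lim_1_over_n])
      then have "(\<lambda>k. min 1 (norm z / real (Suc k))) \<longlonglongrightarrow> min 1 0"
        by (intro tendsto_min tendsto_const) simp
      then have "(\<lambda>k. cutoff_modulus (real (Suc k)) z) \<longlonglongrightarrow> 0 powr p"
        unfolding cutoff_modulus_def using p_gt by (intro tendsto_powr') auto
      then show "(\<lambda>k. cutoff_modulus (real (Suc k)) z * kernel z) \<longlonglongrightarrow> 0"
        by (auto intro: tendsto_mult_left_zero)
    qed
    show "AE z in lborel. norm (cutoff_modulus (real (Suc k)) z * kernel z) \<le> min 1 (norm z) powr p * kernel z" for k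
      using mult_right_mono[OF cutoff_modulus_le[of "real (Suc k)"] kernel_nonneg] kernel_nonneg
      by (auto simp: abs_mult cutoff_modulus_nonneg)
  qed measurable
  then show ?thesis by simp
qed

text \<open>
  By dominated convergence the integral of the modulus against the kernel tends to \<open>0\<close> as the scale of
  the cut-off grows, so for each fixed \<open>l < 1\<close> the cut-off costs at most the factor \<open>l\<^bsup>1-p\<^esup>\<close> in the limit.
\<close>

lemma almost_extremal_bounded_support:
  assumes v: "v \<in> finite_energy" and less: "seminorm_pow v < c * mass v powr (p / P)"
    and vp: "integrable lborel (\<lambda>x. \<bar>v x\<bar> powr p)"
  obtains w R where "w \<in> finite_energy" "seminorm_pow w < c * mass w powr (p / P)"
    "0 < R" "\<And>x. R \<le> norm x \<Longrightarrow> w x = 0"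
proof -
  note [measurable] = finite_energyD(1)[OF v]
  define w where "w k x = cutoff 0 (real (Suc k)) x * v x" for k x
  note cut = cutoff_measurable cutoff_bounds cutoff_modulus_bound cutoff_modulus_integrable
  have w: "w k \<in> finite_energy" for k
    unfolding w_def[abs_def] by (rule cutoff_finite_energy[OF v vp cut]) auto
  have "((\<lambda>l. l powr (1 - p) * seminorm_pow v) \<longlongrightarrow> 1 powr (1 - p) * seminorm_pow v) (at_left 1)"
    by (intro tendsto_intros) auto
  then have "eventually (\<lambda>l. l powr (1 - p) * seminorm_pow v < c * mass v powr (p / P)) (at_left 1)"
    using less by (intro order_tendstoD(2)) auto
  moreover have "eventually (\<lambda>l. l \<in> {0<..<1}) (at_left (1::real))"
    by (intro eventually_at_leftI[of 0]) auto
  ultimately have "eventually (\<lambda>l. l powr (1 - p) * seminorm_pow v < c * mass v powr (p / P) \<and> l \<in> {0<..<1}) (at_left 1)"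
    by (rule eventually_conj)
  then obtain l where l: "l powr (1 - p) * seminorm_pow v < c * mass v powr (p / P)" "0 < l" "l < 1"
    using eventually_happens[of _ "at_left (1::real)"] trivial_limit_at_left_real by auto
  define M where "M = (\<integral>x. \<bar>v x\<bar> powr p \<partial>lborel)"
  have sem: "seminorm_pow (w k) \<le> l powr (1 - p) * seminorm_pow v
      + (1 - l) powr (1 - p) * ((\<integral>z. cutoff_modulus (real (Suc k)) z * kernel z \<partial>lborel) * M)" for k
  proof -
    have le1: "\<bar>cutoff 0 (real (Suc k)) x powr p\<bar> \<le> 1" for x :: 'a
      using powr_mono2[of p "cutoff 0 (real (Suc k)) x" 1] cutoff_bounds[of 0 "real (Suc k)" x] p_gt by simp
    have "(\<integral>x. cutoff 0 (real (Suc k)) x powr p * dens v x \<partial>lborel) \<le> (\<integral>x. dens v x \<partial>lborel)"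
      using le1 by (intro integral_mono integrable_weighted_dens[OF v _ le1] integrable_dens[OF v])
        (auto simp: dens_nonneg intro!: mult_left_le_one_le)
    then have "l powr (1 - p) * (\<integral>x. cutoff 0 (real (Suc k)) x powr p * dens v x \<partial>lborel) \<le> l powr (1 - p) * seminorm_pow v"
      unfolding integral_dens[OF v] by (intro mult_left_mono) auto
    moreover have "seminorm_pow (w k) \<le> l powr (1 - p) * (\<integral>x. cutoff 0 (real (Suc k)) x powr p * dens v x \<partial>lborel)
      + (1 - l) powr (1 - p) * ((\<integral>z. cutoff_modulus (real (Suc k)) z * kernel z \<partial>lborel) * M)"
      unfolding w_def[abs_def] M_def by (rule cutoff_seminorm_le[OF v vp cut]) (use l in auto)
    ultimately show ?thesis by linarith
  qed
  have "(\<lambda>k. l powr (1 - p) * seminorm_pow v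
      + (1 - l) powr (1 - p) * ((\<integral>z. cutoff_modulus (real (Suc k)) z * kernel z \<partial>lborel) * M))
      \<longlonglongrightarrow> l powr (1 - p) * seminorm_pow v + (1 - l) powr (1 - p) * (0 * M)"
    by (intro tendsto_intros cutoff_modulus_integral_tendsto_0)
  moreover have "(\<lambda>k. mass (w k)) \<longlonglongrightarrow> mass v"
    unfolding mass_def
  proof (rule integral_dominated_convergence)
    show "integrable lborel (\<lambda>x. \<bar>v x\<bar> powr P)" by (rule finite_energyD(2)[OF v])
    show "AE x in lborel. (\<lambda>k. \<bar>w k x\<bar> powr P) \<longlonglongrightarrow> \<bar>v x\<bar> powr P"
    proof (rule AE_I2)
      fix x :: 'a
      have "eventually (\<lambda>k. \<bar>w k x\<bar> powr P = \<bar>v x\<bar> powr P) sequentially"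
        using eventually_ge_at_top[of "nat \<lceil>norm x\<rceil>"]
      proof eventually_elim
        case (elim k)
        then have "norm (x - 0) \<le> real (Suc k)" by simp
        then show ?case by (simp add: w_def cutoff_eq_1)
      qed
      then show "(\<lambda>k. \<bar>w k x\<bar> powr P) \<longlonglongrightarrow> \<bar>v x\<bar> powr P" by (rule tendsto_eventually)
    qed
    show "AE x in lborel. norm (\<bar>w k x\<bar> powr P) \<le> \<bar>v x\<bar> powr P" for k
      using P_pos
      by (intro AE_I2) (auto intro!: powr_mono2 mult_left_le_one_le simp: w_def abs_mult)
    show "(\<lambda>x. \<bar>w k x\<bar> powr P) \<in> borel_measurable lborel" for k
      using finite_energyD(1)[OF w[of k]] by simp
  qed simp
  then have "(\<lambda>k. c * mass (w k) powr (p / P)) \<longlonglongrightarrow> c * mass v powr (p / P)"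
    using p_gt P_pos mass_nonneg by (intro tendsto_intros tendsto_powr') auto
  ultimately have "(\<lambda>k. c * mass (w k) powr (p / P) - (l powr (1 - p) * seminorm_pow v
      + (1 - l) powr (1 - p) * ((\<integral>z. cutoff_modulus (real (Suc k)) z * kernel z \<partial>lborel) * M)))
      \<longlonglongrightarrow> c * mass v powr (p / P) - (l powr (1 - p) * seminorm_pow v + (1 - l) powr (1 - p) * (0 * M))"
    by (intro tendsto_diff)
  then have "eventually (\<lambda>k. 0 < c * mass (w k) powr (p / P) - (l powr (1 - p) * seminorm_pow v
      + (1 - l) powr (1 - p) * ((\<integral>z. cutoff_modulus (real (Suc k)) z * kernel z \<partial>lborel) * M))) sequentially"
    using l(1) by (intro order_tendstoD(1)) auto
  then obtain k where "0 < c * mass (w k) powr (p / P) - (l powr (1 - p) * seminorm_pow v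
      + (1 - l) powr (1 - p) * ((\<integral>z. cutoff_modulus (real (Suc k)) z * kernel z \<partial>lborel) * M))"
    by (auto simp: eventually_sequentially)
  with sem[of k] have "seminorm_pow (w k) < c * mass (w k) powr (p / P)" by linarith
  moreover have "w k x = 0" if "2 * real (Suc k) \<le> norm x" for x
    using that cutoff_eq_0[of "real (Suc k)" x 0] by (simp add: w_def)
  ultimately show thesis using that[OF w, of k "2 * real (Suc k)"] by simp
qed

text \<open>
  Energy and mass scale in such a way that the Sobolev quotient is invariant under dilations; this is
  what makes \<open>P\<close> critical.
\<close>

lemma
  assumes w: "w \<in> finite_energy" and c: "0 < c"
  shows rescale_finite_energy: "(\<lambda>x. w ((x - a) /\<^sub>R c)) \<in> finite_energy" (is "?v \<in> _")
    and rescale_mass: "mass (\<lambda>x. w ((x - a) /\<^sub>R c)) = c powr N * mass w"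
    and rescale_seminorm: "seminorm_pow (\<lambda>x. w ((x - a) /\<^sub>R c)) = c powr (N - p * s) * seminorm_pow w"
proof -
  note [measurable] = finite_energyD(1)[OF w]
  have dq: "(\<lambda>(x, y). diff_quot s p ?v x y)
      = (\<lambda>z. c powr (- (N + p * s)) * (\<lambda>(x, y). diff_quot s p w x y) ((z - (a, a)) /\<^sub>R c))"
  proof (rule ext, clarify)
    fix x y :: 'a
    have "norm (x - y) = c * norm ((x - a) /\<^sub>R c - (y - a) /\<^sub>R c)"
      using c by (simp flip: scaleR_diff_right)
    then have "kernel (x - y) = c powr (- (N + p * s)) * kernel ((x - a) /\<^sub>R c - (y - a) /\<^sub>R c)"
      unfolding kernel_def powr_minus_divide using powr_mult by simp
    then show "diff_quot s p ?v x y = c powr (- (N + p * s)) *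
       (\<lambda>(x, y). diff_quot s p w x y) (((x, y) - (a, a)) /\<^sub>R c)"
      by (simp add: diff_quot_eq)
  qed
  have m: "(\<lambda>(x, y). diff_quot s p w x y) \<in> borel_measurable borel"
    using measurable_diff_quot[of w] by (simp add: borel_prod)
  have "integrable lborel (\<lambda>x. \<bar>?v x\<bar> powr P)"
    using integrable_lborel_rescale[OF c finite_energyD(2)[OF w]] .
  moreover have "integrable lborel (\<lambda>(x, y). diff_quot s p ?v x y)"
    unfolding dq using integrable_lborel_rescale[OF c finite_energyD(3)[OF w], of "(a, a)"] by simp
  ultimately show "?v \<in> finite_energy" by (simp add: finite_energy_def)
  show "mass ?v = c powr N * mass w"
    using integral_lborel_rescale[OF c, of "\<lambda>x. \<bar>w x\<bar> powr P" a] c by (simp add: mass_def powr_N)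
  have "seminorm_pow ?v = c powr (- (N + p * s)) * (c ^ DIM('a \<times> 'a) * seminorm_pow w)"
    unfolding seminorm_pow_def dq using integral_lborel_rescale[OF c m, of "(a, a)"] by simp
  also have "c ^ DIM('a \<times> 'a) = c powr (N + N)"
    using c unfolding DIM_prod power_add powr_add by (simp only: powr_N)
  finally show "seminorm_pow ?v = c powr (N - p * s) * seminorm_pow w"
    by (simp add: algebra_simps flip: powr_add mult.assoc)
qed

lemma almost_extremal_supported:
  assumes "v \<in> finite_energy" "0 < mass v" "S < c" and \<Omega>: "open \<Omega>" "\<Omega> \<noteq> {}"
  obtains w where "w \<in> finite_energy" "seminorm_pow w < c * mass w powr (p / P)" "\<And>x. x \<notin> \<Omega> \<Longrightarrow> w x = 0"
proof -
  obtain w0 where "w0 \<in> finite_energy" "seminorm_pow w0 < c * mass w0 powr (p / P)"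
    using almost_extremal[OF assms(1-3)] .
  then obtain w1 where "w1 \<in> finite_energy" "seminorm_pow w1 < c * mass w1 powr (p / P)"
    "integrable lborel (\<lambda>x. \<bar>w1 x\<bar> powr p)"
    by (rule almost_extremal_Lp)
  then obtain w R where w: "w \<in> finite_energy" "seminorm_pow w < c * mass w powr (p / P)"
    and R: "0 < R" "\<And>x. R \<le> norm x \<Longrightarrow> w x = 0"
    by (rule almost_extremal_bounded_support) blast
  obtain a \<rho> where a: "0 < \<rho>" "ball a \<rho> \<subseteq> \<Omega>" using \<Omega> open_contains_ball by blast
  define \<sigma> where "\<sigma> = \<rho> / R"
  have \<sigma>: "0 < \<sigma>" using a R by (simp add: \<sigma>_def)
  let ?v = "\<lambda>x. w ((x - a) /\<^sub>R \<sigma>)"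
  have "?v x = 0" if "x \<notin> \<Omega>" for x
  proof (rule R(2))
    have "\<rho> \<le> norm (x - a)" using that a(2) by (auto simp: dist_norm norm_minus_commute not_less[symmetric])
    moreover have "norm ((x - a) /\<^sub>R \<sigma>) = norm (x - a) * (R / \<rho>)"
      using R(1) a(1) by (simp add: \<sigma>_def)
    ultimately show "R \<le> norm ((x - a) /\<^sub>R \<sigma>)" using R(1) a(1) by (simp add: le_divide_eq mult.commute)
  qed
  moreover have "seminorm_pow ?v < c * mass ?v powr (p / P)"
  proof -
    have "N * p / P = N - p * s" using p_div_P N_pos by (simp add: field_simps)
    then have "mass ?v powr (p / P) = \<sigma> powr (N - p * s) * mass w powr (p / P)"
      by (simp add: rescale_mass[OF w(1) \<sigma>] powr_mult powr_powr)
    then show ?thesis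
      using w(2) \<sigma> by (simp add: rescale_seminorm[OF w(1) \<sigma>] mult.left_commute)
  qed
  ultimately show thesis using that[OF rescale_finite_energy[OF w(1) \<sigma>]] by blast
qed


section \<open>Ground states minimise a scale invariant quotient\<close>

lemma integrable_subcritical:
  assumes v: "v \<in> finite_energy" and 0: "\<And>x. x \<notin> \<Omega> \<Longrightarrow> v x = 0" and \<Omega>: "open \<Omega>" "bounded \<Omega>"
    and q: "0 < q" "q \<le> P"
  shows "integrable lborel (\<lambda>x. \<bar>v x\<bar> powr q)"
    and "\<bar>v x\<bar> powr q \<le> indicator \<Omega> x + \<bar>v x\<bar> powr P"
    and "integrable lborel (\<lambda>x. indicator \<Omega> x + \<bar>v x\<bar> powr P)"
proof -
  note [measurable] = finite_energyD(1)[OF v]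
  show le: "\<bar>v x\<bar> powr q \<le> indicator \<Omega> x + \<bar>v x\<bar> powr P" for x
  proof (cases "v x = 0 \<or> x \<notin> \<Omega>")
    case True
    then show ?thesis using 0[of x] q by auto
  next
    case False
    show ?thesis
    proof (cases "\<bar>v x\<bar> \<le> 1")
      case True
      then have "\<bar>v x\<bar> powr q \<le> 1" using q by (intro powr_le1) auto
      then show ?thesis using False by (simp add: add_increasing2)
    next
      case big: False
      then have "\<bar>v x\<bar> powr q \<le> \<bar>v x\<bar> powr P" using q by (intro powr_mono) auto
      then show ?thesis using False by simp
    qed
  qed
  have "emeasure lborel \<Omega> < \<infinity>" using emeasure_bounded_finite[OF \<Omega>(2)] by simp
  then show dom: "integrable lborel (\<lambda>x. indicator \<Omega> x + \<bar>v x\<bar> powr P)"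
    using \<Omega> finite_energyD(2)[OF v] by (intro Bochner_Integration.integrable_add integrable_real_indicator) auto
  show "integrable lborel (\<lambda>x. \<bar>v x\<bar> powr q)"
    by (rule Bochner_Integration.integrable_bound[OF dom])
      (use le in \<open>auto simp: abs_of_nonneg add_nonneg_nonneg\<close>)
qed

text \<open>
  At points where the base vanishes both \<open>\<bar>t\<bar>\<^bsup>p-2\<^esup> t t\<close> and \<open>\<bar>t\<bar>\<^sup>p\<close> are \<open>0\<close>, also for \<open>p < 2\<close>, so the
  pairing of \<open>u\<close> with itself is the energy.
\<close>

lemma d_energy_eq:
  assumes v: "v \<in> finite_energy" and 0: "\<And>x. x \<notin> \<Omega> \<Longrightarrow> v x = 0" and ae: "AE x in lborel. u x = v x"
    and q: "q = P - e" "0 < q"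
  shows "d_energy s p \<Omega> e u u = seminorm_pow v - (\<integral>x. \<bar>v x\<bar> powr q \<partial>lborel)"
    and "energy s p \<Omega> e u = 1 / p * seminorm_pow v - 1 / q * (\<integral>x. \<bar>v x\<bar> powr q \<partial>lborel)"
proof -
  note [measurable] = finite_energyD(1)[OF v]
  have "frac_plap s p u u = (\<integral>(x, y). diff_quot s p u x y \<partial>lebesgue)"
    unfolding frac_plap_def
  proof (rule Bochner_Integration.integral_cong[OF refl], clarify)
    fix x y :: 'a
    have "\<bar>t\<bar> powr (p - 2) * t * t = \<bar>t\<bar> powr p" for t :: real
    proof (cases "t = 0")
      case False
      have "t * t = \<bar>t\<bar> powr 2" using False by (simp add: power2_eq_square)
      then have "\<bar>t\<bar> powr (p - 2) * t * t = \<bar>t\<bar> powr (p - 2) * \<bar>t\<bar> powr 2" by (simp only: mult.assoc)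
      also have "\<dots> = \<bar>t\<bar> powr p" by (simp only: powr_add[symmetric]) simp
      finally show ?thesis .
    qed simp
    then show "\<bar>u x - u y\<bar> powr (p - 2) * (u x - u y) * (u x - u y) / norm (x - y) powr (real DIM('a) + p * s)
        = diff_quot s p u x y"
      by (simp add: diff_quot_def)
  qed
  then have plap: "frac_plap s p u u = seminorm_pow v"
    using gagliardo_pow_eq[OF finite_energyD(1)[OF v] ae] by (simp add: gagliardo_pow_def)
  have pw: "\<bar>t\<bar> powr (crit_exp DIM('a) s p - 2 - e) * t * t = \<bar>t\<bar> powr q" for t :: real
  proof (cases "t = 0")
    case False
    have "t * t = \<bar>t\<bar> powr 2" using False by (simp add: power2_eq_square)
    then have "\<bar>t\<bar> powr (P - 2 - e) * t * t = \<bar>t\<bar> powr (P - 2 - e) * \<bar>t\<bar> powr 2" by (simp only: mult.assoc)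
    also have "\<dots> = \<bar>t\<bar> powr q" by (simp only: powr_add[symmetric]) (simp add: q)
    finally show ?thesis by (simp flip: P_eq)
  qed simp
  have ind: "AE x in lborel. indicator \<Omega> x *\<^sub>R \<bar>u x\<bar> powr q = \<bar>v x\<bar> powr q"
    using ae by eventually_elim (use 0 q in \<open>auto simp: indicator_def\<close>)
  have set: "(LINT x:\<Omega>|lebesgue. \<bar>u x\<bar> powr q) = (\<integral>x. \<bar>v x\<bar> powr q \<partial>lborel)"
    unfolding set_lebesgue_integral_def by (rule integral_lebesgue_eq_borel[OF _ ind]) measurable
  show "d_energy s p \<Omega> e u u = seminorm_pow v - (\<integral>x. \<bar>v x\<bar> powr q \<partial>lborel)"
    unfolding d_energy_def plap pw set ..
  have "crit_exp DIM('a) s p - e = q" by (simp add: q P_eq)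
  then show "energy s p \<Omega> e u = 1 / p * seminorm_pow v - 1 / q * (\<integral>x. \<bar>v x\<bar> powr q \<partial>lborel)"
    unfolding energy_def using gagliardo_pow_eq[OF finite_energyD(1)[OF v] ae] set by simp
qed

lemma
  assumes v: "v \<in> finite_energy" and t: "0 < t"
  shows scale_finite_energy: "(\<lambda>x. t * v x) \<in> finite_energy"
    and scale_seminorm: "seminorm_pow (\<lambda>x. t * v x) = t powr p * seminorm_pow v"
    and scale_power_integral: "\<And>q. (\<integral>x. \<bar>t * v x\<bar> powr q \<partial>lborel) = t powr q * (\<integral>x. \<bar>v x\<bar> powr q \<partial>lborel)"
proof -
  note [measurable] = finite_energyD(1)[OF v]
  have pw: "\<bar>t * a\<bar> powr q = t powr q * \<bar>a\<bar> powr q" for a q using t by (simp add: abs_mult powr_mult)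
  have dq: "diff_quot s p (\<lambda>x. t * v x) x y = t powr p * diff_quot s p v x y" for x y
    unfolding diff_quot_eq using pw[of "v x - v y" p] by (simp add: right_diff_distrib)
  then have dq: "diff_quot s p (\<lambda>x. t * v x) = (\<lambda>x y. t powr p * diff_quot s p v x y)" by blast
  have c: "(\<lambda>(x, y). t powr p * diff_quot s p v x y) = (\<lambda>z. t powr p * (\<lambda>(x, y). diff_quot s p v x y) z)"
    by auto
  show "(\<lambda>x. t * v x) \<in> finite_energy"
    using finite_energyD(2,3)[OF v] by (simp add: finite_energy_def pw dq c)
  show "seminorm_pow (\<lambda>x. t * v x) = t powr p * seminorm_pow v"
    by (simp add: seminorm_pow_def dq c)
  show "(\<integral>x. \<bar>t * v x\<bar> powr q \<partial>lborel) = t powr q * (\<integral>x. \<bar>v x\<bar> powr q \<partial>lborel)" for q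
    by (simp add: pw)
qed

lemma power_integral_pos:
  assumes v: "v \<in> finite_energy" "0 < mass v" and i: "integrable lborel (\<lambda>x. \<bar>v x\<bar> powr q)"
  shows "0 < (\<integral>x. \<bar>v x\<bar> powr q \<partial>lborel)"
proof -
  have "(\<integral>x. \<bar>v x\<bar> powr q \<partial>lborel) \<noteq> 0"
    using integral_nonneg_eq_0_iff_AE[OF i] v(2) mass_pos_iff[OF v(1)] by simp
  moreover have "0 \<le> (\<integral>x. \<bar>v x\<bar> powr q \<partial>lborel)" by simp
  ultimately show ?thesis by linarith
qed

lemma seminorm_pos: "v \<in> finite_energy \<Longrightarrow> 0 < mass v \<Longrightarrow> 0 < seminorm_pow v"
  using S_mass_le_seminorm[of v] mult_pos_pos[OF S_pos, of v "mass v powr (p / P)"] by simp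

lemma nehariI:
  assumes v: "v \<in> finite_energy" "0 < mass v" and 0: "\<And>x. x \<notin> \<Omega> \<Longrightarrow> v x = 0"
    and q: "q = P - e" "0 < q" and eq: "seminorm_pow v = (\<integral>x. \<bar>v x\<bar> powr q \<partial>lborel)"
  shows "v \<in> nehari s p \<Omega> e"
proof -
  have ae: "AE x in lborel. v x = v x" by simp
  show ?thesis
    using finite_energy_in_W0[of v \<Omega>] d_energy_eq(1)[of v \<Omega> v q e] zero_ae_iff[OF finite_energyD(1)[OF v(1)] ae]
      mass_pos_iff[OF v(1)] assms by (simp add: nehari_def)
qed

text \<open>
  On the Nehari manifold the functional equals \<open>(1/p - 1/q) [u]\<^sup>p\<close>, so a ground state has least energy
  there. Any \<open>w\<close> reaches the manifold after multiplication by the number \<open>t\<close> that balances \<open>t\<^sup>p [w]\<^sup>p\<close>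
  against the \<open>q\<close>-th power integral of \<open>t w\<close>, and the energy of \<open>t w\<close> is the scale invariant quotient on the
  right-hand side.
\<close>

lemma ground_state_representative:
  assumes gs: "ground_state s p \<Omega> e u" and \<Omega>: "open \<Omega>" "bounded \<Omega>"
    and q: "q = P - e" "p < q" "0 < e"
  obtains v where "v \<in> finite_energy" "\<And>x. x \<notin> \<Omega> \<Longrightarrow> v x = 0" "AE x in lborel. u x = v x" "0 < mass v"
    "seminorm_pow v = (\<integral>x. \<bar>v x\<bar> powr q \<partial>lborel)"
    "\<And>w. w \<in> finite_energy \<Longrightarrow> (\<And>x. x \<notin> \<Omega> \<Longrightarrow> w x = 0) \<Longrightarrow> 0 < mass w \<Longrightarrow>
      seminorm_pow v \<le> (seminorm_pow w / (\<integral>x. \<bar>w x\<bar> powr q \<partial>lborel) powr (p / q)) powr (q / (q - p))"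
proof -
  have q0: "0 < q" using q p_gt by linarith
  have u: "u \<in> W0 s p \<Omega>" "\<not> zero_ae u" "d_energy s p \<Omega> e u u = 0"
    and min: "\<And>v. v \<in> nehari s p \<Omega> e \<Longrightarrow> energy s p \<Omega> e u \<le> energy s p \<Omega> e v"
    using gs by (auto simp: ground_state_def nehari_def)
  obtain v where v: "v \<in> finite_energy" "\<And>x. x \<notin> \<Omega> \<Longrightarrow> v x = 0" "AE x in lborel. u x = v x"
    using W0_representative[OF u(1) \<Omega>(1)] by blast
  have mass: "0 < mass v"
    using u(2) mass_pos_iff[OF v(1)] zero_ae_iff[OF finite_energyD(1)[OF v(1)] v(3)] by simp
  have eq: "seminorm_pow v = (\<integral>x. \<bar>v x\<bar> powr q \<partial>lborel)"
    using d_energy_eq(1)[OF v q(1) q0] u(3) by simp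
  have en: "energy s p \<Omega> e u = (1 / p - 1 / q) * seminorm_pow v"
    using d_energy_eq(2)[OF v q(1) q0] eq by (simp add: algebra_simps)
  have "seminorm_pow v \<le> (seminorm_pow w / (\<integral>x. \<bar>w x\<bar> powr q \<partial>lborel) powr (p / q)) powr (q / (q - p))"
    if w: "w \<in> finite_energy" "\<And>x. x \<notin> \<Omega> \<Longrightarrow> w x = 0" "0 < mass w" for w
  proof -
    define A where "A = seminorm_pow w"
    define L where "L = (\<integral>x. \<bar>w x\<bar> powr q \<partial>lborel)"
    have A: "0 < A" unfolding A_def by (rule seminorm_pos[OF w(1,3)])
    have L: "0 < L" unfolding L_def
      by (rule power_integral_pos[OF w(1,3) integrable_subcritical(1)[OF w(1,2) \<Omega> q0]]) (use q in auto)
    define t where "t = (A / L) powr (1 / (q - p))"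
    have t: "0 < t" using A L by (simp add: t_def)
    define z where "z x = t * w x" for x
    have z: "z \<in> finite_energy" "seminorm_pow z = t powr p * A" "(\<integral>x. \<bar>z x\<bar> powr q \<partial>lborel) = t powr q * L"
      "mass z = t powr P * mass w"
      unfolding z_def A_def L_def mass_def
      using scale_finite_energy[OF w(1) t] scale_seminorm[OF w(1) t] scale_power_integral[OF w(1) t] by auto
    have "t powr (q - p) = A / L" using A L q by (simp add: t_def powr_powr)
    then have bal: "t powr p * A = t powr q * L"
      using L t by (simp add: powr_diff field_simps)
    have zn: "z \<in> nehari s p \<Omega> e"
      by (rule nehariI[OF z(1) _ _ q(1) q0]) (use z bal t w in \<open>auto simp: z_def\<close>)
    have ae: "AE x in lborel. z x = z x" by simp
    have z0: "z x = 0" if "x \<notin> \<Omega>" for x using w(2)[OF that] by (simp add: z_def)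
    have "energy s p \<Omega> e z = (1 / p - 1 / q) * seminorm_pow z"
      using d_energy_eq(2)[OF z(1) z0 ae q(1) q0] z bal by (simp add: algebra_simps)
    then have "(1 / p - 1 / q) * seminorm_pow v \<le> (1 / p - 1 / q) * seminorm_pow z"
      using min[OF zn] en by simp
    moreover have "0 < 1 / p - 1 / q" using q p_gt by (simp add: field_simps)
    ultimately have "seminorm_pow v \<le> t powr p * A" using z(2) by simp
    also have "t powr p * A = (A / L powr (p / q)) powr (q / (q - p))"
    proof -
      have "t powr p * A = (A / L) powr (p / (q - p)) * A powr 1" using A by (simp add: t_def powr_powr)
      also have "\<dots> = A powr (p / (q - p) + 1) / L powr (p / (q - p))"
        using A L by (simp add: powr_divide powr_add)
      also have "p / (q - p) + 1 = q / (q - p)" using q by (simp add: field_simps)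
      also have "L powr (p / (q - p)) = (L powr (p / q)) powr (q / (q - p))"
        using q0 by (simp add: powr_powr)
      finally show ?thesis using A L by (simp add: powr_divide)
    qed
    finally show ?thesis by (simp add: A_def L_def)
  qed
  then show thesis using that v mass eq by blast
qed

end

section \<open>Limits of energy and mass\<close>

text \<open>
  What remains of the ground states: Borel representatives \<open>v n\<close>, for the subcritical exponents \<open>q n\<close>
  tending to \<open>P\<close>, with the Nehari identity and the minimality of the scale invariant quotient.
\<close>

locale ground_state_sequence = fractional_exponents s p N P S ty
  for s p N P S :: real and ty :: "'a::euclidean_space itself" +
  fixes \<Omega> :: "'a set" and q :: "nat \<Rightarrow> real" and v :: "nat \<Rightarrow> 'a \<Rightarrow> real"
  assumes open_dom: "open \<Omega>" and nonempty_dom: "\<Omega> \<noteq> {}" and bounded_dom: "bounded \<Omega>"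
    and p_less_q: "\<And>n. p < q n" and q_less_P: "\<And>n. q n < P" and q_lim: "q \<longlonglongrightarrow> P"
    and v_energy: "\<And>n. v n \<in> finite_energy"
    and v_outside: "\<And>n x. x \<notin> \<Omega> \<Longrightarrow> v n x = 0"
    and v_mass: "\<And>n. 0 < mass (v n)"
    and v_nehari: "\<And>n. seminorm_pow (v n) = (\<integral>x. \<bar>v n x\<bar> powr q n \<partial>lborel)"
    and v_minimal: "\<And>n w. w \<in> finite_energy \<Longrightarrow> (\<And>x. x \<notin> \<Omega> \<Longrightarrow> w x = 0) \<Longrightarrow> 0 < mass w \<Longrightarrow>
      seminorm_pow (v n) \<le> (seminorm_pow w / (\<integral>x. \<bar>w x\<bar> powr q n \<partial>lborel) powr (p / q n)) powr (q n / (q n - p))"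
begin

definition "T = S powr (P / (P - p))"

lemma q_pos: "0 < q n" using p_less_q[of n] p_gt by simp

lemma S_positive: "0 < S" by (rule S_pos[OF v_energy v_mass])

lemma T_pos: "0 < T" using S_positive by (simp add: T_def)

text \<open>
  A function of mass \<open>T\<close> for which the Sobolev inequality is an equality has energy \<open>T\<close>.
\<close>

lemma T_powr: "S * T powr (p / P) = T"
proof -
  have "S * T powr (p / P) = S powr 1 * S powr (P / (P - p) * (p / P))"
    using S_positive by (simp add: T_def powr_powr)
  also have "\<dots> = S powr (1 + P / (P - p) * (p / P))" by (simp only: powr_add)
  also have "1 + P / (P - p) * (p / P) = P / (P - p)"
    using P_gt P_pos by (simp add: field_simps)
  finally show ?thesis by (simp add: T_def)
qed

lemma power_integral_limit:
  assumes w: "w \<in> finite_energy" and 0: "\<And>x. x \<notin> \<Omega> \<Longrightarrow> w x = 0"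
  shows "(\<lambda>n. \<integral>x. \<bar>w x\<bar> powr q n \<partial>lborel) \<longlonglongrightarrow> mass w"
  unfolding mass_def
proof (rule integral_dominated_convergence)
  note [measurable] = finite_energyD(1)[OF w]
  note sub = integrable_subcritical[OF w 0 open_dom bounded_dom]
  show "integrable lborel (\<lambda>x. indicator \<Omega> x + \<bar>w x\<bar> powr P)"
    by (rule sub(3)[OF _ P_pos order_refl])
  show "AE x in lborel. norm (\<bar>w x\<bar> powr q n) \<le> indicator \<Omega> x + \<bar>w x\<bar> powr P" for n
    using sub(2)[OF _ q_pos less_imp_le[OF q_less_P]] by auto
  show "AE x in lborel. (\<lambda>n. \<bar>w x\<bar> powr q n) \<longlonglongrightarrow> \<bar>w x\<bar> powr P"
  proof (rule AE_I2)
    fix x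
    show "(\<lambda>n. \<bar>w x\<bar> powr q n) \<longlonglongrightarrow> \<bar>w x\<bar> powr P"
      by (cases "w x = 0") (auto intro!: tendsto_intros q_lim)
  qed
  show "(\<lambda>x. \<bar>w x\<bar> powr P) \<in> borel_measurable lborel"
    "(\<lambda>x. \<bar>w x\<bar> powr q n) \<in> borel_measurable lborel" for n by measurable
qed

text \<open>
  The minimality of \<open>v n\<close> is tested with a fixed almost extremal function supported in \<open>\<Omega>\<close>, whose
  subcritical quotients converge to the critical one.
\<close>

lemma eventually_energy_less:
  assumes c: "S < c"
  shows "eventually (\<lambda>n. seminorm_pow (v n) < c powr (P / (P - p))) sequentially"
proof -
  obtain w where w: "w \<in> finite_energy" "seminorm_pow w < c * mass w powr (p / P)" "\<And>x. x \<notin> \<Omega> \<Longrightarrow> w x = 0"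
    by (rule almost_extremal_supported[OF v_energy v_mass c open_dom nonempty_dom]) blast
  have "mass w \<noteq> 0"
    using w(2) seminorm_nonneg[of w] p_gt P_pos by auto
  then have m: "0 < mass w" using mass_nonneg[of w] by simp
  let ?R = "\<lambda>n. (seminorm_pow w / (\<integral>x. \<bar>w x\<bar> powr q n \<partial>lborel) powr (p / q n)) powr (q n / (q n - p))"
  have "?R \<longlonglongrightarrow> (seminorm_pow w / mass w powr (p / P)) powr (P / (P - p))"
    using m P_gt P_pos seminorm_pos[OF w(1) m]
    by (intro tendsto_intros power_integral_limit[OF w(1,3)] q_lim) auto
  moreover have "(seminorm_pow w / mass w powr (p / P)) powr (P / (P - p)) < c powr (P / (P - p))"
    using w(2) m P_gt P_pos seminorm_nonneg[of w]
    by (intro powr_less_mono2) (auto simp: pos_divide_less_eq)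
  ultimately have "eventually (\<lambda>n. ?R n < c powr (P / (P - p))) sequentially"
    by (rule order_tendstoD)
  then show ?thesis
    by eventually_elim (use v_minimal[OF w(1,3) m] in \<open>blast intro: le_less_trans\<close>)
qed

definition "hoelder_factor n = q n / P + (1 - q n / P) * measure lborel \<Omega>"

lemma hoelder_factor_pos: "0 < hoelder_factor n"
  using q_less_P[of n] q_pos[of n] P_pos by (auto simp: hoelder_factor_def intro!: add_pos_nonneg)

lemma hoelder_factor_limit: "hoelder_factor \<longlonglongrightarrow> 1"
proof -
  have "hoelder_factor \<longlonglongrightarrow> P / P + (1 - P / P) * measure lborel \<Omega>"
    unfolding hoelder_factor_def[abs_def] using P_pos by (intro tendsto_intros q_lim) auto
  then show ?thesis using P_pos by simp
qed

text \<open>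
  Hoelder's inequality on \<open>\<Omega>\<close> up to the factor \<open>hoelder_factor n\<close>, which tends to \<open>1\<close>: Young's inequality
  for the function normalised to unit mass, integrated over \<open>\<Omega>\<close>.
\<close>

lemma seminorm_le_mass: "seminorm_pow (v n) \<le> hoelder_factor n * mass (v n) powr (q n / P)"
proof -
  define B where "B = mass (v n)"
  have B: "0 < B" by (simp add: B_def v_mass)
  have i1: "integrable lborel (indicator \<Omega> :: 'a \<Rightarrow> real)"
    using open_dom emeasure_bounded_finite[OF bounded_dom] by (intro integrable_real_indicator) auto
  have iq: "integrable lborel (\<lambda>x. \<bar>v n x\<bar> powr q n)"
    by (rule integrable_subcritical(1)[OF v_energy v_outside open_dom bounded_dom q_pos less_imp_le[OF q_less_P]])
  note iP = finite_energyD(2)[OF v_energy[of n]]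
  have young: "\<bar>v n x\<bar> powr q n / B powr (q n / P) \<le> q n / P * (\<bar>v n x\<bar> powr P / B) + (1 - q n / P) * indicator \<Omega> x" for x
  proof (cases "v n x = 0")
    case True
    then show ?thesis using q_less_P[of n] P_pos q_pos[of n] by simp
  next
    case False
    then have x: "x \<in> \<Omega>" using v_outside by blast
    have "(\<bar>v n x\<bar> powr P / B) powr (q n / P) * 1 powr (1 - q n / P)
        \<le> q n / P * (\<bar>v n x\<bar> powr P / B) + (1 - q n / P) * 1"
      using False B q_less_P[of n] q_pos[of n] P_pos by (intro Youngs_inequality_0) auto
    then show ?thesis using x P_pos B by (simp add: powr_divide powr_powr)
  qed
  have "seminorm_pow (v n) / B powr (q n / P) = (\<integral>x. \<bar>v n x\<bar> powr q n / B powr (q n / P) \<partial>lborel)"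
    by (simp add: v_nehari)
  also have "\<dots> \<le> (\<integral>x. q n / P * (\<bar>v n x\<bar> powr P / B) + (1 - q n / P) * indicator \<Omega> x \<partial>lborel)"
    using iq iP i1 young by (intro integral_mono) auto
  also have "\<dots> = q n / P * (mass (v n) / B) + (1 - q n / P) * measure lborel \<Omega>"
    using iP i1 open_dom by (simp add: mass_def)
  also have "\<dots> = hoelder_factor n" using B by (simp add: hoelder_factor_def B_def)
  finally show ?thesis using B by (simp add: B_def pos_divide_le_eq)
qed

text \<open>
  The previous bound combined with the Sobolev inequality, solved for the energy.
\<close>

lemma seminorm_lower: "(S * hoelder_factor n powr (- (p / q n))) powr (q n / (q n - p)) \<le> seminorm_pow (v n)"
proof -
  let ?A = "seminorm_pow (v n)" and ?g = "hoelder_factor n"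
  have A: "0 < ?A" by (rule seminorm_pos[OF v_energy v_mass])
  note g = hoelder_factor_pos[of n]
  have "?A powr (p / q n) \<le> (?g * mass (v n) powr (q n / P)) powr (p / q n)"
    using seminorm_le_mass[of n] A p_gt q_pos[of n] by (intro powr_mono2) auto
  also have "\<dots> = ?g powr (p / q n) * mass (v n) powr (p / P)"
    using q_pos[of n] by (simp add: powr_mult powr_powr)
  finally have "S * ?g powr (- (p / q n)) * ?A powr (p / q n)
      \<le> S * ?g powr (- (p / q n)) * (?g powr (p / q n) * mass (v n) powr (p / P))"
    using S_positive by (intro mult_left_mono) auto
  also have "\<dots> = S * mass (v n) powr (p / P) * ?g powr (- (p / q n) + p / q n)"
    by (simp only: powr_add mult_ac)
  also have "\<dots> \<le> ?A" using g S_mass_le_seminorm[OF v_energy[of n]] by simp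
  finally have "S * ?g powr (- (p / q n)) \<le> ?A / ?A powr (p / q n)"
    using A by (simp add: pos_le_divide_eq)
  also have "\<dots> = ?A powr ((q n - p) / q n)"
    using A q_pos[of n] by (simp add: powr_diff diff_divide_distrib)
  finally have "(S * ?g powr (- (p / q n))) powr (q n / (q n - p)) \<le> (?A powr ((q n - p) / q n)) powr (q n / (q n - p))"
    using S_positive p_less_q[of n] q_pos[of n] by (intro powr_mono2) auto
  also have "\<dots> = ?A" using A p_less_q[of n] q_pos[of n] by (simp add: powr_powr)
  finally show ?thesis .
qed

lemma energy_limit: "(\<lambda>n. seminorm_pow (v n)) \<longlonglongrightarrow> T"
proof (rule order_tendstoI)
  fix y assume y: "T < y"
  define c where "c = y powr ((P - p) / P)"
  have y0: "0 < y" using y T_pos by simp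
  have "T powr ((P - p) / P) < c"
    unfolding c_def using y T_pos P_gt P_pos by (intro powr_less_mono2) auto
  moreover have "T powr ((P - p) / P) = S"
    using S_positive P_gt P_pos by (simp add: T_def powr_powr)
  moreover have "c powr (P / (P - p)) = y"
    using y0 P_gt P_pos by (simp add: c_def powr_powr)
  ultimately show "eventually (\<lambda>n. seminorm_pow (v n) < y) sequentially"
    using eventually_energy_less[of c] by simp
next
  fix y assume y: "y < T"
  have "(\<lambda>n. (S * hoelder_factor n powr (- (p / q n))) powr (q n / (q n - p)))
      \<longlonglongrightarrow> (S * 1 powr (- (p / P))) powr (P / (P - p))"
    using S_positive P_gt P_pos by (intro tendsto_intros hoelder_factor_limit q_lim) auto
  then have "eventually (\<lambda>n. y < (S * hoelder_factor n powr (- (p / q n))) powr (q n / (q n - p))) sequentially"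
    using y by (intro order_tendstoD(1)) (auto simp: T_def)
  then show "eventually (\<lambda>n. y < seminorm_pow (v n)) sequentially"
    by eventually_elim (use seminorm_lower in \<open>blast intro: less_le_trans\<close>)
qed

text \<open>
  The mass is squeezed between the bounds that Hoelder's inequality on \<open>\<Omega>\<close> and the Sobolev inequality
  give in terms of the energy.
\<close>

lemma mass_limit: "(\<lambda>n. mass (v n)) \<longlonglongrightarrow> T"
proof (rule tendsto_sandwich)
  show "(\<lambda>n. (seminorm_pow (v n) / hoelder_factor n) powr (P / q n)) \<longlonglongrightarrow> T"
  proof -
    have "(\<lambda>n. (seminorm_pow (v n) / hoelder_factor n) powr (P / q n)) \<longlonglongrightarrow> (T / 1) powr (P / P)"
      using T_pos P_pos by (intro tendsto_intros energy_limit hoelder_factor_limit q_lim) auto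
    then show ?thesis using P_pos T_pos by simp
  qed
  show "(\<lambda>n. (seminorm_pow (v n) / S) powr (P / p)) \<longlonglongrightarrow> T"
  proof -
    have "(\<lambda>n. (seminorm_pow (v n) / S) powr (P / p)) \<longlonglongrightarrow> (T / S) powr (P / p)"
      using T_pos S_positive p_gt by (intro tendsto_intros energy_limit) auto
    also have "T / S = T powr (p / P)" using T_powr S_positive by (simp add: field_simps)
    finally show ?thesis using P_pos T_pos p_gt by (simp add: powr_powr)
  qed
  show "eventually (\<lambda>n. (seminorm_pow (v n) / hoelder_factor n) powr (P / q n) \<le> mass (v n)) sequentially"
  proof (rule always_eventually, rule allI)
    fix n
    have "(seminorm_pow (v n) / hoelder_factor n) powr (P / q n) \<le> (mass (v n) powr (q n / P)) powr (P / q n)"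
      using seminorm_le_mass[of n] hoelder_factor_pos[of n] seminorm_nonneg[of "v n"] P_pos q_pos[of n]
      by (intro powr_mono2) (auto simp: pos_divide_le_eq mult.commute)
    then show "(seminorm_pow (v n) / hoelder_factor n) powr (P / q n) \<le> mass (v n)"
      using P_pos q_pos[of n] v_mass[of n] by (simp add: powr_powr)
  qed
  show "eventually (\<lambda>n. mass (v n) \<le> (seminorm_pow (v n) / S) powr (P / p)) sequentially"
  proof (rule always_eventually, rule allI)
    fix n
    have "(mass (v n) powr (p / P)) powr (P / p) \<le> (seminorm_pow (v n) / S) powr (P / p)"
      using S_mass_le_seminorm[OF v_energy[of n]] S_positive P_pos p_gt
      by (intro powr_mono2) (auto simp: pos_le_divide_eq mult.commute)
    then show "mass (v n) \<le> (seminorm_pow (v n) / S) powr (P / p)"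
      using P_pos p_gt v_mass[of n] by (simp add: powr_powr)
  qed
qed

lemma deficit_limit: "(\<lambda>n. seminorm_pow (v n) - S * mass (v n) powr (p / P)) \<longlonglongrightarrow> 0"
proof -
  have "(\<lambda>n. seminorm_pow (v n) - S * mass (v n) powr (p / P)) \<longlonglongrightarrow> T - S * T powr (p / P)"
    using T_pos by (intro tendsto_intros energy_limit mass_limit) auto
  then show ?thesis by (simp add: T_powr)
qed

end

section \<open>Vanishing in subcritical Lebesgue spaces\<close>

context fractional_exponents begin

lemma
  assumes v: "v \<in> finite_energy"
  shows abs_finite_energy: "(\<lambda>x. \<bar>v x\<bar>) \<in> finite_energy"
    and abs_mass: "mass (\<lambda>x. \<bar>v x\<bar>) = mass v"
    and abs_seminorm_le: "seminorm_pow (\<lambda>x. \<bar>v x\<bar>) \<le> seminorm_pow v"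
proof -
  note [measurable] = finite_energyD(1)[OF v]
  have dq: "diff_quot s p (\<lambda>x. \<bar>v x\<bar>) x y \<le> diff_quot s p v x y" for x y
    unfolding diff_quot_eq using p_gt by (intro mult_right_mono powr_mono2 kernel_nonneg) auto
  have i: "integrable lborel (\<lambda>(x, y). diff_quot s p (\<lambda>x. \<bar>v x\<bar>) x y)"
    by (rule integrable_pair_bound[OF finite_energyD(3)[OF v]]) (auto simp: dq diff_quot_nonneg)
  show "(\<lambda>x. \<bar>v x\<bar>) \<in> finite_energy"
    using finite_energyD(2)[OF v] i by (simp add: finite_energy_def)
  show "mass (\<lambda>x. \<bar>v x\<bar>) = mass v" by (simp add: mass_def)
  show "seminorm_pow (\<lambda>x. \<bar>v x\<bar>) \<le> seminorm_pow v"
    unfolding seminorm_pow_def by (intro integral_mono i finite_energyD(3)[OF v]) (auto simp: dq)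
qed

text \<open>
  The supports are disjoint, so only pairs of points with one in each support see both functions. There
  the difference is \<open>f x - t g y\<close>, smaller than \<open>f x\<close> as long as \<open>t\<close> is small, while the kernel is at
  least \<open>\<kappa>\<close>: this is the linear gain.
\<close>

lemma diff_quot_add_disjoint_le:
  fixes f g :: "'a \<Rightarrow> real"
  assumes nonneg: "\<And>x. 0 \<le> f x" "\<And>x. 0 \<le> g x" and t: "0 < t"
    and supp: "\<And>x. x \<notin> \<Omega> \<Longrightarrow> f x = 0" "\<And>x. x \<notin> D \<Longrightarrow> g x = 0" "\<Omega> \<inter> D = {}"
    and low: "\<And>x y. x \<in> \<Omega> \<Longrightarrow> y \<in> D \<Longrightarrow> \<kappa> \<le> kernel (x - y)"
  shows "diff_quot s p (\<lambda>x. f x + t * g x) x y \<le> diff_quot s p f x y + 2 * t powr p * diff_quot s p g x y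
    - \<kappa> * t * (g x * f y powr (p - 1) + f x powr (p - 1) * g y)"
proof -
  have scale: "\<bar>t * a\<bar> powr p = t powr p * \<bar>a\<bar> powr p" for a using t by (simp add: abs_mult powr_mult)
  have mixed: "diff_quot s p (\<lambda>x. f x + t * g x) x y \<le> diff_quot s p f x y + 2 * t powr p * diff_quot s p g x y
    - \<kappa> * t * (g x * f y powr (p - 1) + f x powr (p - 1) * g y)" if x: "x \<in> \<Omega>" and y: "y \<in> D" for x y
  proof -
    have z: "g x = 0" "f y = 0" using x y supp by auto
    have "\<bar>f x - t * g y\<bar> powr p \<le> f x powr p - f x powr (p - 1) * (t * g y) + 2 * (t * g y) powr p"
      using nonneg t p_gt by (intro powr_diff_le_linear) auto
    then have "\<bar>f x - t * g y\<bar> powr p * kernel (x - y)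
        \<le> (f x powr p - f x powr (p - 1) * (t * g y) + 2 * (t * g y) powr p) * kernel (x - y)"
      by (rule mult_right_mono[OF _ kernel_nonneg])
    also have "\<dots> = f x powr p * kernel (x - y) + 2 * t powr p * (g y powr p * kernel (x - y))
        - kernel (x - y) * (f x powr (p - 1) * (t * g y))"
      using scale[of "g y"] nonneg t by (simp add: algebra_simps)
    also have "\<dots> \<le> f x powr p * kernel (x - y) + 2 * t powr p * (g y powr p * kernel (x - y))
        - \<kappa> * (f x powr (p - 1) * (t * g y))"
      using low[OF x y] nonneg t by (intro diff_left_mono mult_right_mono) auto
    finally show ?thesis
      using z nonneg p_gt by (simp add: diff_quot_eq mult_ac)
  qed
  have dqs: "diff_quot s p w x y = diff_quot s p w y x" for w :: "'a \<Rightarrow> real" and x y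
    by (simp add: diff_quot_def norm_minus_commute abs_minus_commute)
  show ?thesis
  proof (cases "x \<in> \<Omega> \<or> y \<in> \<Omega>")
    case False
    then have "f x = 0" "f y = 0" using supp by auto
    then have "diff_quot s p (\<lambda>x. f x + t * g x) x y = t powr p * diff_quot s p g x y"
      "diff_quot s p f x y = 0"
      using scale[of "g x - g y"] by (simp_all add: diff_quot_eq right_diff_distrib)
    moreover have "0 \<le> t powr p * diff_quot s p g x y" by (simp add: diff_quot_nonneg)
    ultimately show ?thesis using \<open>f x = 0\<close> \<open>f y = 0\<close> p_gt by simp
  next
    case True
    consider "x \<in> \<Omega>" "y \<in> D" | "y \<in> \<Omega>" "x \<in> D" | "x \<notin> D" "y \<notin> D" using True supp(3) by blast
    then show ?thesis
    proof cases
      case 1 then show ?thesis by (rule mixed)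
    next
      case 2 then show ?thesis using mixed[of y x] by (simp add: dqs[of _ y x] algebra_simps)
    next
      case 3
      then have "g x = 0" "g y = 0" using supp by auto
      then show ?thesis using p_gt by (simp add: diff_quot_eq)
    qed
  qed
qed

text \<open>
  The Sobolev inequality for \<open>f + t g\<close>, whose mass is at least that of \<open>f\<close>, bounds the linear gain by the
  deficit of \<open>f\<close> in the Sobolev inequality and a term of order \<open>t\<^sup>p\<close>.
\<close>

lemma deficit_bounds_lower_power:
  assumes f: "f \<in> finite_energy" and g: "g \<in> finite_energy"
    and nonneg: "\<And>x. 0 \<le> f x" "\<And>x. 0 \<le> g x" and t: "0 < t"
    and supp: "\<And>x. x \<notin> \<Omega> \<Longrightarrow> f x = 0" "\<And>x. x \<notin> D \<Longrightarrow> g x = 0" "\<Omega> \<inter> D = {}"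
    and low: "\<And>x y. x \<in> \<Omega> \<Longrightarrow> y \<in> D \<Longrightarrow> \<kappa> \<le> kernel (x - y)" and S: "0 \<le> S"
    and int: "integrable lborel (\<lambda>x. f x powr (p - 1))" "integrable lborel g"
  shows "2 * \<kappa> * t * ((\<integral>x. g x \<partial>lborel) * (\<integral>x. f x powr (p - 1) \<partial>lborel))
    \<le> seminorm_pow f - S * mass f powr (p / P) + 2 * t powr p * seminorm_pow g"
proof -
  note [measurable] = finite_energyD(1)[OF f] finite_energyD(1)[OF g]
  let ?w = "\<lambda>x. f x + t * g x"
  have prod: "integrable lborel (\<lambda>(x, y). h x * k y)"
    "(\<integral>(x, y). h x * k y \<partial>lborel) = (\<integral>x. h x \<partial>lborel) * (\<integral>y. k y \<partial>lborel)"
    if "integrable lborel h" "integrable lborel k" for h k :: "'a \<Rightarrow> real"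
  proof -
    have i: "integrable (lborel \<Otimes>\<^sub>M lborel) (\<lambda>(x, y). h x * k y)"
      using that by (intro lborel_pair.Fubini_integrable) (auto simp: abs_mult)
    then show "integrable lborel (\<lambda>(x, y). h x * k y)" by (simp add: lborel_prod)
    show "(\<integral>(x, y). h x * k y \<partial>lborel) = (\<integral>x. h x \<partial>lborel) * (\<integral>y. k y \<partial>lborel)"
      using lborel_pair.integral_fst'[OF i] by (simp add: lborel_prod)
  qed
  let ?G = "\<lambda>z. (\<lambda>(x, y). diff_quot s p f x y) z + 2 * t powr p * (\<lambda>(x, y). diff_quot s p g x y) z
    - \<kappa> * t * ((\<lambda>(x, y). g x * f y powr (p - 1)) z + (\<lambda>(x, y). f x powr (p - 1) * g y) z)"
  note ints = finite_energyD(3)[OF f] finite_energyD(3)[OF g] prod(1)[OF int(2,1)] prod(1)[OF int]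
  have iG: "integrable lborel ?G"
    by (intro Bochner_Integration.integrable_diff Bochner_Integration.integrable_add integrable_mult_right ints)
  have le: "diff_quot s p ?w x y \<le> ?G (x, y)" for x y
    using diff_quot_add_disjoint_le[OF nonneg t supp low, where x = x and y = y] by simp
  have iw: "integrable lborel (\<lambda>(x, y). diff_quot s p ?w x y)"
    by (rule integrable_pair_bound[OF iG]) (use le in \<open>auto simp: diff_quot_nonneg\<close>)
  have wP: "\<bar>?w x\<bar> powr P = \<bar>f x\<bar> powr P + t powr P * \<bar>g x\<bar> powr P" for x
  proof (cases "x \<in> \<Omega>")
    case True
    then have "g x = 0" using supp by auto
    then show ?thesis using P_pos by simp
  next
    case False
    then have "f x = 0" using supp by auto
    then show ?thesis using P_pos t by (simp add: abs_mult powr_mult)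
  qed
  have iP: "integrable lborel (\<lambda>x. \<bar>?w x\<bar> powr P)"
    unfolding wP using finite_energyD(2)[OF f] finite_energyD(2)[OF g] by simp
  have w: "?w \<in> finite_energy" using iP iw by (simp add: finite_energy_def)
  have "mass f \<le> mass ?w"
    unfolding mass_def by (intro integral_mono finite_energyD(2)[OF f] iP) (simp add: wP)
  then have "S * mass f powr (p / P) \<le> S * mass ?w powr (p / P)"
    using S p_gt P_pos mass_nonneg[of f] by (intro mult_left_mono powr_mono2) auto
  also have "\<dots> \<le> seminorm_pow ?w" by (rule S_mass_le_seminorm[OF w])
  also have "\<dots> \<le> integral\<^sup>L lborel ?G"
    unfolding seminorm_pow_def by (intro integral_mono iw iG) (use le in auto)
  also have "\<dots> = seminorm_pow f + 2 * t powr p * seminorm_pow g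
     - \<kappa> * t * ((\<integral>x. g x \<partial>lborel) * (\<integral>x. f x powr (p - 1) \<partial>lborel)
       + (\<integral>x. f x powr (p - 1) \<partial>lborel) * (\<integral>x. g x \<partial>lborel))"
    by (simp only: ints Bochner_Integration.integral_add Bochner_Integration.integral_diff
        Bochner_Integration.integrable_diff Bochner_Integration.integrable_add integrable_mult_right
        integral_mult_right_zero prod(2)[OF int(2,1)] prod(2)[OF int] seminorm_pow_def)
  finally show ?thesis by (simp add: algebra_simps)
qed

end

context ground_state_sequence begin

lemma abs_v_subcritical:
  assumes "0 < a" "a \<le> P"
  shows "integrable lborel (\<lambda>x. \<bar>v n x\<bar> powr a)"
  by (rule integrable_subcritical(1)[OF v_energy v_outside open_dom bounded_dom assms])

text \<open>
  The bump is a translate of \<open>\<bar>v 0\<bar>\<close>. Dividing the preceding bound by \<open>t\<close> leaves the deficit, which tends to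
  \<open>0\<close> for fixed \<open>t\<close>, and a term of order \<open>t\<^bsup>p-1\<^esup>\<close>, which is small for small \<open>t\<close>.
\<close>

lemma lower_power_limit: "(\<lambda>n. \<integral>x. \<bar>v n x\<bar> powr (p - 1) \<partial>lborel) \<longlonglongrightarrow> 0"
proof -
  obtain R where R: "0 < R" "\<And>x. x \<in> \<Omega> \<Longrightarrow> norm x \<le> R"
    using bounded_dom bounded_pos by blast
  obtain e :: 'a where e: "e \<in> Basis" using nonempty_Basis by blast
  \<comment> \<open>A translation by three times the radius of a ball containing \<open>\<Omega>\<close> separates \<open>\<Omega>\<close> from its image.\<close>
  define a where "a = (3 * R) *\<^sub>R e"
  have a: "norm a = 3 * R" using e R by (simp add: a_def)
  define D where "D = {x. x - a \<in> \<Omega>}"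
  define g where "g x = \<bar>v 0 (x - a)\<bar>" for x
  have g: "g \<in> finite_energy"
    unfolding g_def using abs_finite_energy[OF rescale_finite_energy[OF v_energy, of 1 0 a]] by simp
  have D: "R < norm x" "norm x \<le> 4 * R" if "x \<in> D" for x
  proof -
    have "norm (x - a) \<le> R" using that R(2) by (simp add: D_def)
    then show "R < norm x" "norm x \<le> 4 * R"
      using norm_triangle_ineq2[of a x] norm_triangle_ineq2[of x a] a R(1)
      by (auto simp: norm_minus_commute)
  qed
  have disj: "\<Omega> \<inter> D = {}" using D(1) R(2) by fastforce
  define \<kappa> where "\<kappa> = 1 / (5 * R) powr (N + p * s)"
  have \<kappa>: "0 < \<kappa>" using R by (simp add: \<kappa>_def)
  have low: "\<kappa> \<le> kernel (x - y)" if "x \<in> \<Omega>" "y \<in> D" for x y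
  proof -
    have "norm (x - y) \<le> 5 * R" using norm_triangle_ineq4[of x y] R(2)[OF that(1)] D(2)[OF that(2)] by simp
    moreover have "0 < norm (x - y)" using that disj by auto
    ultimately show ?thesis
      using R(1) unfolding \<kappa>_def kernel_def using N_ps_pos by (intro divide_left_mono powr_mono2) auto
  qed
  have ig: "integrable lborel g"
    unfolding g_def using abs_v_subcritical[of 1 0] integrable_lborel_shift[of "\<lambda>x. \<bar>v 0 x\<bar>" a] P_gt_1 by simp
  have G: "0 < (\<integral>x. g x \<partial>lborel)" (is "0 < ?I")
  proof -
    have i1: "integrable lborel (\<lambda>x. \<bar>v 0 x\<bar> powr 1)" using P_gt_1 by (intro abs_v_subcritical) auto
    have "0 < (\<integral>x. \<bar>v 0 x\<bar> powr 1 \<partial>lborel)" by (rule power_integral_pos[OF v_energy v_mass i1])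
    then show ?thesis
      unfolding g_def using i1 integral_lborel_shift[of "\<lambda>x. \<bar>v 0 x\<bar>" a] by simp
  qed
  have key: "(\<integral>x. \<bar>v n x\<bar> powr (p - 1) \<partial>lborel)
      \<le> (seminorm_pow (v n) - S * mass (v n) powr (p / P)) / (2 * \<kappa> * t * ?I) + t powr (p - 1) * (seminorm_pow g / (\<kappa> * ?I))"
    if t: "0 < t" for n t
  proof -
    have "2 * \<kappa> * t * (?I * (\<integral>x. \<bar>v n x\<bar> powr (p - 1) \<partial>lborel))
      \<le> seminorm_pow (\<lambda>x. \<bar>v n x\<bar>) - S * mass (\<lambda>x. \<bar>v n x\<bar>) powr (p / P) + 2 * t powr p * seminorm_pow g"
    proof (rule deficit_bounds_lower_power[OF abs_finite_energy[OF v_energy] g _ _ t _ _ disj low])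
      show "integrable lborel (\<lambda>x. \<bar>v n x\<bar> powr (p - 1))"
        using p_gt P_gt by (intro abs_v_subcritical) auto
    qed (use S_positive ig v_outside in \<open>auto simp: g_def D_def\<close>)
    also have "\<dots> \<le> (seminorm_pow (v n) - S * mass (v n) powr (p / P)) + 2 * t powr p * seminorm_pow g"
      using abs_seminorm_le[OF v_energy] by (simp add: abs_mass[OF v_energy])
    finally have "(\<integral>x. \<bar>v n x\<bar> powr (p - 1) \<partial>lborel)
        \<le> ((seminorm_pow (v n) - S * mass (v n) powr (p / P)) + 2 * t powr p * seminorm_pow g) / (2 * \<kappa> * t * ?I)"
      using \<kappa> t G by (simp add: pos_le_divide_eq mult_ac)
    also have "\<dots> = (seminorm_pow (v n) - S * mass (v n) powr (p / P)) / (2 * \<kappa> * t * ?I) + t powr p / t * (seminorm_pow g / (\<kappa> * ?I))"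
      using \<kappa> t G by (simp add: add_divide_distrib)
    also have "t powr p / t = t powr (p - 1)" using t by (simp add: powr_diff)
    finally show ?thesis .
  qed
  show ?thesis
  proof (rule order_tendstoI)
    fix y :: real assume "y < 0"
    moreover have "0 \<le> (\<integral>x. \<bar>v n x\<bar> powr (p - 1) \<partial>lborel)" for n by simp
    ultimately show "eventually (\<lambda>n. y < (\<integral>x. \<bar>v n x\<bar> powr (p - 1) \<partial>lborel)) sequentially"
      by (intro always_eventually allI) (rule less_le_trans)
  next
    fix y :: real assume y: "0 < y"
    let ?C = "seminorm_pow g / (\<kappa> * ?I)"
    have "((\<lambda>t. t powr (p - 1) * ?C) \<longlongrightarrow> 0 powr (p - 1) * ?C) (at_right 0)"
      using p_gt by (intro tendsto_intros tendsto_powr') (auto simp: eventually_at_right_less eventually_at_filter)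
    then have "eventually (\<lambda>t. t powr (p - 1) * ?C < y) (at_right 0)"
      using y by (intro order_tendstoD(2)) auto
    then have "eventually (\<lambda>t. t powr (p - 1) * ?C < y \<and> 0 < t) (at_right 0)"
      using eventually_at_right_less by (rule eventually_conj)
    then obtain t where t: "0 < t" "t powr (p - 1) * ?C < y"
      using eventually_happens[of _ "at_right (0::real)"] trivial_limit_at_right_real by auto
    have "(\<lambda>n. (seminorm_pow (v n) - S * mass (v n) powr (p / P)) / (2 * \<kappa> * t * ?I) + t powr (p - 1) * ?C)
        \<longlonglongrightarrow> 0 / (2 * \<kappa> * t * ?I) + t powr (p - 1) * ?C"
      using \<kappa> t G by (intro tendsto_intros deficit_limit) auto
    then have "eventually (\<lambda>n. (seminorm_pow (v n) - S * mass (v n) powr (p / P)) / (2 * \<kappa> * t * ?I) + t powr (p - 1) * ?C < y) sequentially"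
      using t by (intro order_tendstoD(2)) auto
    then show "eventually (\<lambda>n. (\<integral>x. \<bar>v n x\<bar> powr (p - 1) \<partial>lborel) < y) sequentially"
      by eventually_elim (use key[OF t(1)] in \<open>blast intro: le_less_trans\<close>)
  qed
qed

text \<open>
  Values at most \<open>d\<close> contribute little because \<open>\<Omega>\<close> has finite measure, values above \<open>M\<close> because the masses
  are bounded and \<open>a < P\<close>, and on the values in between the \<open>a\<close>-th power is comparable to the \<open>(p-1)\<close>-th,
  whose integrals tend to \<open>0\<close>.
\<close>

lemma subcritical_power_limit:
  assumes a: "0 < a" "a < P"
  shows "(\<lambda>n. \<integral>x. \<bar>v n x\<bar> powr a \<partial>lborel) \<longlonglongrightarrow> 0"
proof (rule order_tendstoI)
  fix y :: real assume "y < 0"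
  moreover have "0 \<le> (\<integral>x. \<bar>v n x\<bar> powr a \<partial>lborel)" for n by simp
  ultimately show "eventually (\<lambda>n. y < (\<integral>x. \<bar>v n x\<bar> powr a \<partial>lborel)) sequentially"
    by (intro always_eventually allI) (rule less_le_trans)
next
  fix y :: real assume y: "0 < y"
  have i1: "integrable lborel (indicator \<Omega> :: 'a \<Rightarrow> real)"
    using open_dom emeasure_bounded_finite[OF bounded_dom] by (intro integrable_real_indicator) auto
  have ip: "integrable lborel (\<lambda>x. \<bar>v n x\<bar> powr (p - 1))" for n
    using p_gt P_gt by (intro abs_v_subcritical) auto
  have ia: "integrable lborel (\<lambda>x. \<bar>v n x\<bar> powr a)" for n
    using a by (intro abs_v_subcritical) auto
  note iP = finite_energyD(2)[OF v_energy]
  have pw: "\<bar>v n x\<bar> powr a \<le> d powr a * indicator \<Omega> x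
      + ((d powr (a - (p - 1)) + M powr (a - (p - 1))) * \<bar>v n x\<bar> powr (p - 1) + M powr (a - P) * \<bar>v n x\<bar> powr P)"
    (is "_ \<le> ?l + (?m + ?h)") if d: "0 < d" "0 < M" for d M n x
  proof -
    have pos: "0 \<le> ?l" "0 \<le> ?m" "0 \<le> ?h" by simp_all
    consider "x \<notin> \<Omega>" | "x \<in> \<Omega>" "\<bar>v n x\<bar> \<le> d" | "d < \<bar>v n x\<bar>" "\<bar>v n x\<bar> \<le> M" | "d < \<bar>v n x\<bar>" "M < \<bar>v n x\<bar>"
      by linarith
    then show ?thesis
    proof cases
      case 1
      then show ?thesis using v_outside[of x n] pos a by simp
    next
      case 2
      then have "\<bar>v n x\<bar> powr a \<le> ?l" using a by (auto intro: powr_mono2)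
      then show ?thesis using pos by linarith
    next
      case 3
      have "\<bar>v n x\<bar> powr (a - (p - 1)) \<le> d powr (a - (p - 1)) + M powr (a - (p - 1))"
      proof (cases "0 \<le> a - (p - 1)")
        case True
        then have "\<bar>v n x\<bar> powr (a - (p - 1)) \<le> M powr (a - (p - 1))" using 3 by (intro powr_mono2) auto
        then show ?thesis by (simp add: add_increasing)
      next
        case False
        then have "\<bar>v n x\<bar> powr (a - (p - 1)) \<le> d powr (a - (p - 1))" using 3 d by (intro powr_mono2') auto
        then show ?thesis by (simp add: add_increasing2)
      qed
      then have "\<bar>v n x\<bar> powr (a - (p - 1)) * \<bar>v n x\<bar> powr (p - 1) \<le> ?m" by (intro mult_right_mono) auto
      then have "\<bar>v n x\<bar> powr a \<le> ?m" by (simp flip: powr_add)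
      then show ?thesis using pos by linarith
    next
      case 4
      have "\<bar>v n x\<bar> powr (a - P) \<le> M powr (a - P)" using 4 d a by (intro powr_mono2') auto
      then have "\<bar>v n x\<bar> powr (a - P) * \<bar>v n x\<bar> powr P \<le> ?h" by (intro mult_right_mono) auto
      then have "\<bar>v n x\<bar> powr a \<le> ?h" by (simp flip: powr_add)
      then show ?thesis using pos by linarith
    qed
  qed
  have bound: "(\<integral>x. \<bar>v n x\<bar> powr a \<partial>lborel) \<le> d powr a * measure lborel \<Omega>
      + ((d powr (a - (p - 1)) + M powr (a - (p - 1))) * (\<integral>x. \<bar>v n x\<bar> powr (p - 1) \<partial>lborel) + M powr (a - P) * mass (v n))"
    if d: "0 < d" "0 < M" for d M n
  proof -
    have "(\<integral>x. \<bar>v n x\<bar> powr a \<partial>lborel) \<le> (\<integral>x. d powr a * indicator \<Omega> x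
      + ((d powr (a - (p - 1)) + M powr (a - (p - 1))) * \<bar>v n x\<bar> powr (p - 1) + M powr (a - P) * \<bar>v n x\<bar> powr P) \<partial>lborel)"
      using i1 ip iP by (intro integral_mono ia pw[OF d]) auto
    also have "\<dots> = d powr a * measure lborel \<Omega>
      + ((d powr (a - (p - 1)) + M powr (a - (p - 1))) * (\<integral>x. \<bar>v n x\<bar> powr (p - 1) \<partial>lborel) + M powr (a - P) * mass (v n))"
      using i1 ip iP open_dom by (simp add: mass_def)
    finally show ?thesis .
  qed
  have "((\<lambda>d. d powr a * measure lborel \<Omega>) \<longlongrightarrow> 0 powr a * measure lborel \<Omega>) (at_right 0)"
    using a by (intro tendsto_intros tendsto_powr') (auto simp: eventually_at_filter)
  then have "eventually (\<lambda>d. d powr a * measure lborel \<Omega> < y / 2) (at_right 0)"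
    using y by (intro order_tendstoD(2)) auto
  then have "eventually (\<lambda>d. d powr a * measure lborel \<Omega> < y / 2 \<and> 0 < d) (at_right 0)"
    using eventually_at_right_less by (rule eventually_conj)
  then obtain d where d: "0 < d" "d powr a * measure lborel \<Omega> < y / 2"
    using eventually_happens[of _ "at_right (0::real)"] trivial_limit_at_right_real by auto
  have "((\<lambda>M. M powr (a - P) * T) \<longlongrightarrow> 0 * T) at_top"
    using a by (intro tendsto_intros tendsto_neg_powr filterlim_ident) auto
  then have "eventually (\<lambda>M. M powr (a - P) * T < y / 2) at_top"
    using y by (intro order_tendstoD(2)) auto
  then have "eventually (\<lambda>M. M powr (a - P) * T < y / 2 \<and> 0 < M) at_top"
    using eventually_gt_at_top by (rule eventually_conj)
  then obtain M where M: "0 < M" "M powr (a - P) * T < y / 2"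
    using eventually_happens[of _ "at_top :: real filter"] by auto
  let ?F = "\<lambda>n. d powr a * measure lborel \<Omega>
      + ((d powr (a - (p - 1)) + M powr (a - (p - 1))) * (\<integral>x. \<bar>v n x\<bar> powr (p - 1) \<partial>lborel) + M powr (a - P) * mass (v n))"
  have "?F \<longlonglongrightarrow> d powr a * measure lborel \<Omega>
      + ((d powr (a - (p - 1)) + M powr (a - (p - 1))) * 0 + M powr (a - P) * T)"
    by (intro tendsto_intros lower_power_limit mass_limit)
  then have "eventually (\<lambda>n. ?F n < y) sequentially"
    by (rule order_tendstoD(2)) (use d(2) M(2) in simp)
  then show "eventually (\<lambda>n. (\<integral>x. \<bar>v n x\<bar> powr a \<partial>lborel) < y) sequentially"
    by eventually_elim (use bound[OF d(1) M(1)] in \<open>blast intro: le_less_trans\<close>)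
qed

end

section \<open>Concentration at a single point\<close>

lemma powr_add_gt:
  fixes a b \<theta> :: real
  assumes "0 < a" "0 < b" "0 < \<theta>" "\<theta> < 1"
  shows "(a + b) powr \<theta> < a powr \<theta> + b powr \<theta>"
proof -
  have *: "x / (a + b) < (x / (a + b)) powr \<theta>" if "0 < x" "x < a + b" for x
    using powr_less_mono'[of "x / (a + b)" \<theta> 1] that assms by simp
  have "1 = a / (a + b) + b / (a + b)" using assms by (simp flip: add_divide_distrib)
  also have "\<dots> < (a / (a + b)) powr \<theta> + (b / (a + b)) powr \<theta>"
    using *[of a] *[of b] assms by simp
  also have "\<dots> = (a powr \<theta> + b powr \<theta>) / (a + b) powr \<theta>"
    using assms by (simp add: powr_divide add_divide_distrib)
  finally show ?thesis using assms by (simp add: pos_less_divide_eq)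
qed

lemma C0_funs_compact_support:
  fixes f :: "'a::euclidean_space \<Rightarrow> real"
  assumes "continuous_on UNIV f" "\<And>x. R \<le> norm x \<Longrightarrow> f x = 0"
  shows "f \<in> C0_funs"
proof -
  have "eventually (\<lambda>x. f x = 0) at_infinity"
    using assms(2) by (auto simp: eventually_at_infinity)
  then show ?thesis using assms(1) by (simp add: C0_funs_def tendsto_eventually)
qed

lemma C0_funs_bounded:
  fixes f :: "'a::euclidean_space \<Rightarrow> real"
  assumes "f \<in> C0_funs"
  obtains K where "0 \<le> K" "\<And>x. \<bar>f x\<bar> \<le> K"
proof -
  have "eventually (\<lambda>x. dist (f x) 0 < 1) at_infinity"
    using assms by (intro tendstoD) (auto simp: C0_funs_def)
  then obtain R where R: "\<And>x. R \<le> norm x \<Longrightarrow> \<bar>f x\<bar> < 1"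
    by (auto simp: eventually_at_infinity)
  have "compact (f ` cball 0 R)"
    using assms by (intro compact_continuous_image) (auto simp: C0_funs_def intro: continuous_on_subset)
  then obtain B where B: "\<And>x. x \<in> cball 0 R \<Longrightarrow> \<bar>f x\<bar> \<le> B"
    using compact_imp_bounded bounded_iff by (metis imageI real_norm_def)
  have "\<bar>f x\<bar> \<le> max 1 B" for x
  proof (cases "norm x \<le> R")
    case True then show ?thesis using B[of x] by simp
  next
    case False then show ?thesis using R[of x] by simp
  qed
  then show thesis using that[of "max 1 B"] by simp
qed

context ground_state_sequence begin

text \<open>
  The Sobolev inequality for \<open>\<eta> (v n)\<close>. The last summand tends to \<open>0\<close> as \<open>n\<close> grows, for any fixed \<open>l\<close>.
\<close>

lemma weighted_mass_le:
  assumes eta[measurable]: "\<eta> \<in> borel_measurable borel" and eta01: "\<And>x. 0 \<le> \<eta> x" "\<And>x. \<eta> x \<le> 1"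
    and osc: "\<And>x y. \<bar>\<eta> x - \<eta> y\<bar> powr p \<le> h (x - y)" and h: "integrable lborel (\<lambda>z. h z * kernel z)"
    and l: "0 < l" "l < 1"
  shows "S * (\<integral>x. \<eta> x powr P * \<bar>v n x\<bar> powr P \<partial>lborel) powr (p / P)
    \<le> l powr (1 - p) * (\<integral>x. \<eta> x powr p * dens (v n) x \<partial>lborel)
      + (1 - l) powr (1 - p) * ((\<integral>z. h z * kernel z \<partial>lborel) * (\<integral>x. \<bar>v n x\<bar> powr p \<partial>lborel))"
proof -
  have vp: "integrable lborel (\<lambda>x. \<bar>v n x\<bar> powr p)"
    using p_gt P_gt by (intro abs_v_subcritical) auto
  have "mass (\<lambda>x. \<eta> x * v n x) = (\<integral>x. \<eta> x powr P * \<bar>v n x\<bar> powr P \<partial>lborel)"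
    unfolding mass_def using eta01 by (simp add: abs_mult powr_mult)
  then show ?thesis
    using S_mass_le_seminorm[OF cutoff_finite_energy[OF v_energy vp eta eta01 osc h]]
      cutoff_seminorm_le[OF v_energy vp eta eta01 osc h l] by simp
qed

lemma remainder_limit:
  "(\<lambda>n. C * (c * (\<integral>x. \<bar>v n x\<bar> powr p \<partial>lborel))) \<longlonglongrightarrow> 0"
proof -
  have "(\<lambda>n. C * (c * (\<integral>x. \<bar>v n x\<bar> powr p \<partial>lborel))) \<longlonglongrightarrow> C * (c * 0)"
    using p_gt P_gt by (intro tendsto_intros subcritical_power_limit) auto
  then show ?thesis by simp
qed

end

locale concentration = ground_state_sequence s p N P S ty \<Omega> q v
  for s p N P S :: real and ty :: "'a::euclidean_space itself"
    and \<Omega> :: "'a set" and q :: "nat \<Rightarrow> real" and v :: "nat \<Rightarrow> 'a \<Rightarrow> real" +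
  fixes \<nu> :: "'a measure"
  assumes sets_nu [measurable_cong]: "sets \<nu> = sets borel" and finite_nu: "finite_measure \<nu>"
    and conv_nu: "\<And>\<phi>. \<phi> \<in> C0_funs \<Longrightarrow> (\<lambda>n. \<integral>x. \<phi> x * \<bar>v n x\<bar> powr P \<partial>lborel) \<longlonglongrightarrow> (\<integral>x. \<phi> x \<partial>\<nu>)"
begin

lemma space_nu: "space \<nu> = UNIV"
  using sets_eq_imp_space_eq[OF sets_nu] by simp

lemma borel_measurable_nu: "f \<in> borel_measurable borel \<Longrightarrow> f \<in> borel_measurable \<nu>"
  for f :: "'a \<Rightarrow> real"
  using measurable_cong_sets[OF sets_nu refl] by blast

lemma integrable_nu_bounded:
  fixes f :: "'a \<Rightarrow> real"
  assumes "f \<in> borel_measurable borel" "\<And>x. \<bar>f x\<bar> \<le> B"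
  shows "integrable \<nu> f"
proof -
  interpret finite_measure \<nu> by (rule finite_nu)
  show ?thesis using assms by (intro integrable_const_bound[of _ B]) (auto intro: borel_measurable_nu)
qed

text \<open>
  The test function vanishes exactly on \<open>closure \<Omega>\<close>; the factor \<open>1 / (1 + norm x)\<close> makes it vanish at infinity.
\<close>

lemma nu_supported: "AE x in \<nu>. x \<in> closure \<Omega>"
proof -
  define \<psi> where "\<psi> x = min 1 (infdist x (closure \<Omega>)) * (1 / (1 + norm x))" for x
  have c: "continuous_on UNIV \<psi>"
    unfolding \<psi>_def by (intro continuous_intros) (auto simp: add_nonneg_eq_0_iff)
  have nn: "0 \<le> \<psi> x" for x by (simp add: \<psi>_def infdist_nonneg)
  have b: "\<psi> x \<le> 1 / (1 + norm x)" for x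
    unfolding \<psi>_def by (rule mult_left_le_one_le) (auto simp: infdist_nonneg)
  have "((\<lambda>x::'a. 1 / (1 + norm x)) \<longlongrightarrow> 0) at_infinity"
    by (rule tendsto_divide_0[OF tendsto_const])
      (intro filterlim_at_top_imp_at_infinity filterlim_tendsto_add_at_top[OF tendsto_const] filterlim_norm_at_top)
  then have "(\<psi> \<longlongrightarrow> 0) at_infinity"
    using tendsto_sandwich[of "\<lambda>_. 0" \<psi> at_infinity "\<lambda>x. 1 / (1 + norm x)" 0] by (simp add: nn b)
  with c have "\<psi> \<in> C0_funs" by (simp add: C0_funs_def)
  then have lim: "(\<lambda>n. \<integral>x. \<psi> x * \<bar>v n x\<bar> powr P \<partial>lborel) \<longlonglongrightarrow> (\<integral>x. \<psi> x \<partial>\<nu>)"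
    by (rule conv_nu)
  have "\<psi> x * \<bar>v n x\<bar> powr P = 0" for x n
  proof (cases "x \<in> \<Omega>")
    case True
    then have "x \<in> closure \<Omega>" using closure_subset by blast
    then show ?thesis by (simp add: \<psi>_def)
  qed (use v_outside P_pos in simp)
  then have "(\<integral>x. \<psi> x * \<bar>v n x\<bar> powr P \<partial>lborel) = 0" for n
    by (intro integral_eq_zero_AE) auto
  with lim have "(\<lambda>n. 0) \<longlonglongrightarrow> (\<integral>x. \<psi> x \<partial>\<nu>)" by simp
  then have z: "(\<integral>x. \<psi> x \<partial>\<nu>) = 0" by (simp add: LIMSEQ_const_iff)
  have b1: "\<bar>\<psi> x\<bar> \<le> 1" for x
  proof -
    have "1 / (1 + norm x) \<le> 1" by (simp add: divide_le_eq_1 add_pos_nonneg)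
    then show ?thesis using nn[of x] b[of x] by linarith
  qed
  have m: "\<psi> \<in> borel_measurable borel" using c by (simp add: borel_measurable_continuous_onI)
  have "AE x in \<nu>. \<psi> x = 0"
    using integral_nonneg_eq_0_iff_AE[OF integrable_nu_bounded[OF m b1]] nn z by simp
  then show ?thesis
  proof eventually_elim
    fix x assume "\<psi> x = 0"
    moreover have "1 / (1 + norm x) \<noteq> 0" using norm_ge_zero[of x] by (simp add: add_nonneg_eq_0_iff)
    ultimately have "infdist x (closure \<Omega>) = 0" by (auto simp: \<psi>_def min_def split: if_splits)
    then show "x \<in> closure \<Omega>"
      using in_closed_iff_infdist_zero[of "closure \<Omega>" x] nonempty_dom by (simp add: closure_eq_empty)
  qed
qed

text \<open>
  All measures live on the bounded set \<open>closure \<Omega>\<close>, so any continuous function may be replaced by its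
  product with a cut-off function.
\<close>

lemma conv_nu_continuous:
  assumes g: "continuous_on UNIV g"
  shows "(\<lambda>n. \<integral>x. g x * \<bar>v n x\<bar> powr P \<partial>lborel) \<longlonglongrightarrow> (\<integral>x. g x \<partial>\<nu>)"
proof -
  have "bounded (closure \<Omega>)" using bounded_dom by (rule bounded_closure)
  then obtain R where R: "0 < R" "\<And>x. x \<in> closure \<Omega> \<Longrightarrow> norm x \<le> R" using bounded_pos by blast
  define f where "f x = g x * cutoff 0 R x" for x
  have f: "f x = g x" if "x \<in> closure \<Omega>" for x
    using R(2)[OF that] cutoff_eq_1[of R x 0] R(1) by (simp add: f_def)
  have fc: "continuous_on UNIV f"
    unfolding f_def by (intro continuous_intros g cutoff_continuous)
  have "f \<in> C0_funs"
    using fc cutoff_eq_0[of R _ 0] R(1) by (intro C0_funs_compact_support[of _ "2 * R"]) (auto simp: f_def)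
  then have "(\<lambda>n. \<integral>x. f x * \<bar>v n x\<bar> powr P \<partial>lborel) \<longlonglongrightarrow> (\<integral>x. f x \<partial>\<nu>)" by (rule conv_nu)
  moreover have "f x * \<bar>v n x\<bar> powr P = g x * \<bar>v n x\<bar> powr P" for x n
    using f[of x] v_outside[of x n] closure_subset[of \<Omega>] by (cases "x \<in> \<Omega>") auto
  moreover have "(\<integral>x. f x \<partial>\<nu>) = (\<integral>x. g x \<partial>\<nu>)"
  proof (rule integral_cong_AE)
    show "f \<in> borel_measurable \<nu>" "g \<in> borel_measurable \<nu>"
      using fc g by (auto intro!: borel_measurable_nu borel_measurable_continuous_onI)
    show "AE x in \<nu>. f x = g x" using nu_supported by eventually_elim (rule f)
  qed
  ultimately show ?thesis by simp
qed

lemma measure_nu: "measure \<nu> UNIV = T"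
proof -
  have "(\<lambda>n. mass (v n)) \<longlonglongrightarrow> (\<integral>x. 1 \<partial>\<nu>)"
    using conv_nu_continuous[of "\<lambda>_. 1"] by (simp add: mass_def)
  then have "(\<integral>x. 1 \<partial>\<nu>) = T" using mass_limit LIMSEQ_unique by blast
  then show ?thesis by (simp add: space_nu)
qed

text \<open>
  As \<open>\<eta>\<^sup>p + (1 - \<eta>)\<^sup>p \<le> 1\<close>, the energies of the two pieces add up to at most the total energy, which tends
  to \<open>T = S T\<^bsup>p/P\<^esup>\<close>. The Sobolev inequality bounds each energy from below by the mass of the piece;
  first \<open>n\<close> tends to infinity, then \<open>l\<close> to \<open>1\<close>.
\<close>

lemma partition_inequality:
  assumes c: "continuous_on UNIV \<eta>" and eta01: "\<And>x. 0 \<le> \<eta> x" "\<And>x. \<eta> x \<le> 1"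
    and osc: "\<And>x y. \<bar>\<eta> x - \<eta> y\<bar> powr p \<le> h (x - y)" and h: "integrable lborel (\<lambda>z. h z * kernel z)"
  shows "(\<integral>x. \<eta> x powr P \<partial>\<nu>) powr (p / P) + (\<integral>x. (1 - \<eta> x) powr P \<partial>\<nu>) powr (p / P) \<le> T powr (p / P)"
proof -
  have m: "\<eta> \<in> borel_measurable borel" using c by (simp add: borel_measurable_continuous_onI)
  have m': "(\<lambda>x. 1 - \<eta> x) \<in> borel_measurable borel" using m by simp
  have osc': "\<bar>(1 - \<eta> x) - (1 - \<eta> y)\<bar> powr p \<le> h (x - y)" for x y
    using osc[of x y] by (simp add: abs_minus_commute)
  have pb: "\<bar>t powr p\<bar> \<le> 1" if "0 \<le> t" "t \<le> 1" for t :: real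
    using powr_mono2[of p t 1] that p_gt by simp
  define b1 where "b1 n = (\<integral>x. \<eta> x powr P * \<bar>v n x\<bar> powr P \<partial>lborel)" for n
  define b2 where "b2 n = (\<integral>x. (1 - \<eta> x) powr P * \<bar>v n x\<bar> powr P \<partial>lborel)" for n
  define c0 where "c0 = (\<integral>z. h z * kernel z \<partial>lborel)"
  define M where "M n = (\<integral>x. \<bar>v n x\<bar> powr p \<partial>lborel)" for n
  have le: "S * (b1 n powr (p / P) + b2 n powr (p / P))
      \<le> l powr (1 - p) * seminorm_pow (v n) + 2 * (1 - l) powr (1 - p) * (c0 * M n)" if l: "0 < l" "l < 1" for l n
  proof -
    have i1: "integrable lborel (\<lambda>x. \<eta> x powr p * dens (v n) x)"
      using m eta01 by (intro integrable_weighted_dens[OF v_energy, of _ 1] pb) auto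
    have i2: "integrable lborel (\<lambda>x. (1 - \<eta> x) powr p * dens (v n) x)"
      using m eta01 by (intro integrable_weighted_dens[OF v_energy, of _ 1] pb) auto
    have sum: "(\<integral>x. \<eta> x powr p * dens (v n) x \<partial>lborel) + (\<integral>x. (1 - \<eta> x) powr p * dens (v n) x \<partial>lborel)
        \<le> seminorm_pow (v n)"
    proof -
      have "(\<integral>x. \<eta> x powr p * dens (v n) x \<partial>lborel) + (\<integral>x. (1 - \<eta> x) powr p * dens (v n) x \<partial>lborel)
          = (\<integral>x. \<eta> x powr p * dens (v n) x + (1 - \<eta> x) powr p * dens (v n) x \<partial>lborel)"
        using i1 i2 by simp
      also have "\<dots> \<le> (\<integral>x. dens (v n) x \<partial>lborel)"
      proof (rule integral_mono)
        fix x
        have "t powr p \<le> t" if "0 \<le> t" "t \<le> 1" for t :: real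
          using powr_mono'[of 1 p t] that p_gt by (cases "t = 0") auto
        from this[of "\<eta> x"] this[of "1 - \<eta> x"] have le1: "\<eta> x powr p + (1 - \<eta> x) powr p \<le> 1"
          using eta01[of x] by simp
        show "\<eta> x powr p * dens (v n) x + (1 - \<eta> x) powr p * dens (v n) x \<le> dens (v n) x"
          using mult_right_mono[OF le1 dens_nonneg[of "v n" x]] by (simp add: distrib_right)
      qed (use i1 i2 integrable_dens[OF v_energy] in auto)
      finally show ?thesis by (simp add: integral_dens[OF v_energy])
    qed
    have "S * b1 n powr (p / P) \<le> l powr (1 - p) * (\<integral>x. \<eta> x powr p * dens (v n) x \<partial>lborel)
        + (1 - l) powr (1 - p) * (c0 * M n)"
      unfolding b1_def c0_def M_def by (rule weighted_mass_le[OF m eta01 osc h l])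
    moreover have "S * b2 n powr (p / P) \<le> l powr (1 - p) * (\<integral>x. (1 - \<eta> x) powr p * dens (v n) x \<partial>lborel)
        + (1 - l) powr (1 - p) * (c0 * M n)"
      unfolding b2_def c0_def M_def by (rule weighted_mass_le[OF m' _ _ osc' h l]) (use eta01 in auto)
    moreover have "l powr (1 - p) * ((\<integral>x. \<eta> x powr p * dens (v n) x \<partial>lborel)
        + (\<integral>x. (1 - \<eta> x) powr p * dens (v n) x \<partial>lborel)) \<le> l powr (1 - p) * seminorm_pow (v n)"
      using sum by (intro mult_left_mono) auto
    ultimately show ?thesis by (simp add: distrib_left)
  qed
  have c1: "continuous_on UNIV (\<lambda>x. \<eta> x powr P)" "continuous_on UNIV (\<lambda>x. (1 - \<eta> x) powr P)"
    using c eta01 P_pos by (auto intro!: continuous_intros continuous_on_powr')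
  let ?L = "(\<integral>x. \<eta> x powr P \<partial>\<nu>) powr (p / P) + (\<integral>x. (1 - \<eta> x) powr P \<partial>\<nu>) powr (p / P)"
  have l1: "(\<lambda>n. S * (b1 n powr (p / P) + b2 n powr (p / P))) \<longlonglongrightarrow> S * ?L"
    unfolding b1_def b2_def using P_pos p_gt
    by (intro tendsto_intros tendsto_powr'[OF conv_nu_continuous[OF c1(1)]] tendsto_powr'[OF conv_nu_continuous[OF c1(2)]])
      (auto intro!: always_eventually)
  have l2: "S * ?L \<le> l powr (1 - p) * T" if l: "0 < l" "l < 1" for l
  proof (rule LIMSEQ_le[OF l1])
    have "(\<lambda>n. l powr (1 - p) * seminorm_pow (v n) + 2 * (1 - l) powr (1 - p) * (c0 * M n)) \<longlonglongrightarrow> l powr (1 - p) * T + 0"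
      unfolding M_def by (intro tendsto_intros energy_limit remainder_limit)
    then show "(\<lambda>n. l powr (1 - p) * seminorm_pow (v n) + 2 * (1 - l) powr (1 - p) * (c0 * M n)) \<longlonglongrightarrow> l powr (1 - p) * T"
      by simp
  qed (use le[OF l] in blast)
  have "((\<lambda>l. l powr (1 - p) * T) \<longlongrightarrow> 1 powr (1 - p) * T) (at_left 1)"
    by (intro tendsto_intros) auto
  moreover have "eventually (\<lambda>l. S * ?L \<le> l powr (1 - p) * T) (at_left 1)"
    using l2 by (intro eventually_at_leftI[of 0]) auto
  ultimately have "S * ?L \<le> 1 powr (1 - p) * T"
    by (rule tendsto_lowerbound) (rule trivial_limit_at_left_real)
  then have "S * ?L \<le> S * T powr (p / P)" by (simp add: T_powr)
  then show ?thesis using S_positive by simp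
qed

text \<open>
  The indicator function of \<open>F\<close> is a pointwise limit of Lipschitz functions, so the preceding inequality
  holds for \<open>F\<close> and its complement. As the exponent \<open>p/P\<close> is less than \<open>1\<close>, it excludes
  any proper splitting of the total mass \<open>T\<close>.
\<close>

lemma nu_zero_one:
  assumes F: "closed F"
  shows "measure \<nu> F = 0 \<or> measure \<nu> F = T"
proof (cases "F = {}")
  case False
  interpret finite_measure \<nu> by (rule finite_nu)
  define \<eta> where "\<eta> k x = max 0 (1 - real (Suc k) * infdist x F)" for k x
  have c: "continuous_on UNIV (\<eta> k)" for k unfolding \<eta>_def by (intro continuous_intros)
  have m[measurable]: "\<eta> k \<in> borel_measurable borel" for k using c by (rule borel_measurable_continuous_onI)
  have e01: "0 \<le> \<eta> k x" "\<eta> k x \<le> 1" for k x by (auto simp: \<eta>_def infdist_nonneg)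
  have osc: "\<bar>\<eta> k x - \<eta> k y\<bar> powr p \<le> cutoff_modulus (1 / real (Suc k)) (x - y)" for k x y
  proof -
    have "\<bar>infdist x F - infdist y F\<bar> \<le> norm (x - y)"
      using infdist_triangle_abs[of x F y] by (simp add: dist_norm)
    then have "\<bar>real (Suc k) * infdist x F - real (Suc k) * infdist y F\<bar> \<le> real (Suc k) * norm (x - y)"
      by (simp only: right_diff_distrib[symmetric] abs_mult) (simp add: mult_left_mono)
    then have "\<bar>\<eta> k x - \<eta> k y\<bar> \<le> real (Suc k) * norm (x - y)" unfolding \<eta>_def by linarith
    moreover have "\<bar>\<eta> k x - \<eta> k y\<bar> \<le> 1" using e01[of k x] e01[of k y] by (simp add: abs_le_iff)
    ultimately show ?thesis unfolding cutoff_modulus_def using p_gt by (intro powr_mono2) (auto simp: mult.commute)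
  qed
  have lim: "(\<lambda>k. \<eta> k x) \<longlonglongrightarrow> indicator F x" for x
  proof (cases "x \<in> F")
    case True
    then show ?thesis by (simp add: \<eta>_def)
  next
    case False
    then have d: "0 < infdist x F"
      using in_closed_iff_infdist_zero[OF F \<open>F \<noteq> {}\<close>, of x] infdist_nonneg[of x F] by auto
    obtain k0 where k0: "1 < real k0 * infdist x F" using reals_Archimedean3[OF d] by blast
    have "eventually (\<lambda>k. \<eta> k x = 0) sequentially"
      using eventually_ge_at_top[of k0]
    proof eventually_elim
      case (elim k)
      have "real k0 * infdist x F \<le> real (Suc k) * infdist x F" using elim d by (intro mult_right_mono) auto
      then show ?case using k0 by (simp add: \<eta>_def)
    qed
    then show ?thesis using False by (simp add: tendsto_eventually)
  qed
  have F': "F \<in> sets \<nu>" "- F \<in> sets \<nu>" using F by (auto simp: sets_nu)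
  have bnd: "\<bar>t powr P\<bar> \<le> 1" if "0 \<le> t" "t \<le> 1" for t :: real
    using powr_mono2[of P t 1] that P_pos by simp
  have "(\<lambda>k. \<integral>x. \<eta> k x powr P \<partial>\<nu>) \<longlonglongrightarrow> (\<integral>x. indicator F x \<partial>\<nu>)"
  proof (rule integral_dominated_convergence)
    show "integrable \<nu> (\<lambda>_. 1 :: real)" by simp
    show "AE x in \<nu>. (\<lambda>k. \<eta> k x powr P) \<longlonglongrightarrow> indicator F x"
    proof (rule AE_I2)
      fix x
      have "(\<lambda>k. \<eta> k x powr P) \<longlonglongrightarrow> indicator F x powr P"
        using P_pos e01 by (intro tendsto_powr'[OF lim tendsto_const]) auto
      then show "(\<lambda>k. \<eta> k x powr P) \<longlonglongrightarrow> indicator F x" using P_pos by (auto simp: indicator_def)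
    qed
    show "AE x in \<nu>. norm (\<eta> k x powr P) \<le> 1" for k using bnd e01 by auto
  qed (use F' in \<open>auto intro: borel_measurable_nu\<close>)
  then have l1: "(\<lambda>k. \<integral>x. \<eta> k x powr P \<partial>\<nu>) \<longlonglongrightarrow> measure \<nu> F" using F' by simp
  have "(\<lambda>k. \<integral>x. (1 - \<eta> k x) powr P \<partial>\<nu>) \<longlonglongrightarrow> (\<integral>x. indicator (- F) x \<partial>\<nu>)"
  proof (rule integral_dominated_convergence)
    show "integrable \<nu> (\<lambda>_. 1 :: real)" by simp
    show "AE x in \<nu>. (\<lambda>k. (1 - \<eta> k x) powr P) \<longlonglongrightarrow> indicator (- F) x"
    proof (rule AE_I2)
      fix x
      have "(\<lambda>k. (1 - \<eta> k x) powr P) \<longlonglongrightarrow> (1 - indicator F x) powr P"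
        using P_pos e01 by (intro tendsto_powr'[OF tendsto_diff[OF tendsto_const lim] tendsto_const]) auto
      then show "(\<lambda>k. (1 - \<eta> k x) powr P) \<longlonglongrightarrow> indicator (- F) x" using P_pos by (auto simp: indicator_def)
    qed
    show "AE x in \<nu>. norm ((1 - \<eta> k x) powr P) \<le> 1" for k using bnd e01 by auto
  qed (use F' in \<open>auto intro: borel_measurable_nu\<close>)
  then have l2: "(\<lambda>k. \<integral>x. (1 - \<eta> k x) powr P \<partial>\<nu>) \<longlonglongrightarrow> measure \<nu> (- F)" using F' by simp
  have "(\<lambda>k. (\<integral>x. \<eta> k x powr P \<partial>\<nu>) powr (p / P) + (\<integral>x. (1 - \<eta> k x) powr P \<partial>\<nu>) powr (p / P))
      \<longlonglongrightarrow> measure \<nu> F powr (p / P) + measure \<nu> (- F) powr (p / P)"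
    using p_gt P_pos by (intro tendsto_add tendsto_powr'[OF l1 tendsto_const] tendsto_powr'[OF l2 tendsto_const]) auto
  then have le: "measure \<nu> F powr (p / P) + measure \<nu> (- F) powr (p / P) \<le> T powr (p / P)"
    using partition_inequality[OF c e01 osc cutoff_modulus_integrable]
    by (intro LIMSEQ_le_const2) auto
  have sum: "measure \<nu> F + measure \<nu> (- F) = T"
    using finite_measure_compl[OF F'(1)] by (simp add: space_nu measure_nu Compl_eq_Diff_UNIV)
  show ?thesis
  proof (rule ccontr)
    assume "\<not> ?thesis"
    then have "0 < measure \<nu> F" "0 < measure \<nu> (- F)"
      using sum measure_nonneg[of \<nu> F] measure_nonneg[of \<nu> "- F"] by linarith+
    then show False
      using powr_add_gt[of "measure \<nu> F" "measure \<nu> (- F)" "p / P"] sum le p_gt P_gt P_pos by simp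
  qed
qed simp

text \<open>
  If no point of \<open>closure \<Omega>\<close> carried the mass \<open>T\<close>, each of them would be the centre of a closed ball of mass
  less than \<open>T\<close>, hence zero, and finitely many such balls cover the compact set on which \<open>\<nu>\<close> lives.
\<close>

lemma nu_point:
  obtains x where "x \<in> closure \<Omega>" "measure \<nu> {x} = T"
proof -
  interpret finite_measure \<nu> by (rule finite_nu)
  have "\<exists>x\<in>closure \<Omega>. measure \<nu> {x} = T"
  proof (rule ccontr)
    assume none: "\<not> ?thesis"
    have "\<exists>k. measure \<nu> (cball x (1 / real (Suc k))) = 0" if x: "x \<in> closure \<Omega>" for x
    proof (rule ccontr)
      assume "\<nexists>k. measure \<nu> (cball x (1 / real (Suc k))) = 0"
      then have all: "measure \<nu> (cball x (1 / real (Suc k))) = T" for k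
        using nu_zero_one[of "cball x (1 / real (Suc k))"] by auto
      have "(\<Inter>k. cball x (1 / real (Suc k))) = {x}"
      proof (intro equalityI subsetI)
        fix y assume y: "y \<in> (\<Inter>k. cball x (1 / real (Suc k)))"
        have "dist x y \<le> 0"
          by (rule LIMSEQ_le_const[OF LIMSEQ_Suc[OF lim_1_over_n]]) (use y in auto)
        then show "y \<in> {x}" by simp
      qed auto
      moreover have "(\<lambda>k. measure \<nu> (cball x (1 / real (Suc k)))) \<longlonglongrightarrow> measure \<nu> (\<Inter>k. cball x (1 / real (Suc k)))"
        by (rule finite_Lim_measure_decseq)
          (auto simp: sets_nu decseq_def intro!: subset_cball divide_left_mono)
      ultimately have "measure \<nu> {x} = T" using all by (simp add: LIMSEQ_const_iff)
      then show False using none x by blast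
    qed
    then obtain k where k: "\<And>x. x \<in> closure \<Omega> \<Longrightarrow> measure \<nu> (cball x (1 / real (Suc (k x)))) = 0" by metis
    have "compact (closure \<Omega>)" using bounded_dom by (simp add: compact_closure)
    then obtain D where D: "D \<subseteq> closure \<Omega>" "finite D" "closure \<Omega> \<subseteq> (\<Union>x\<in>D. ball x (1 / real (Suc (k x))))"
      by (rule compactE_image[of _ "closure \<Omega>" "\<lambda>x. ball x (1 / real (Suc (k x)))"]) auto
    have "measure \<nu> (closure \<Omega>) \<le> measure \<nu> (\<Union>x\<in>D. cball x (1 / real (Suc (k x))))"
      using D ball_subset_cball by (intro finite_measure_mono) (force simp: sets_nu)+
    also have "\<dots> \<le> (\<Sum>x\<in>D. measure \<nu> (cball x (1 / real (Suc (k x)))))"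
      using D(2) by (intro finite_measure_subadditive_finite) (auto simp: sets_nu)
    also have "\<dots> = 0" using D(1) k by (intro sum.neutral) blast
    finally have "measure \<nu> (closure \<Omega>) = 0" using measure_nonneg[of \<nu> "closure \<Omega>"] by linarith
    moreover have "measure \<nu> (closure \<Omega>) = measure \<nu> UNIV"
      using nu_supported by (intro finite_measure_eq_AE) (auto simp: sets_nu)
    ultimately show False using T_pos by (simp add: measure_nu)
  qed
  then show thesis using that by blast
qed

lemma integral_nu:
  assumes x: "measure \<nu> {x} = T" and g: "g \<in> borel_measurable borel"
  shows "(\<integral>z. g z \<partial>\<nu>) = T * g x"
proof -
  interpret finite_measure \<nu> by (rule finite_nu)
  have "measure \<nu> (- {x}) = 0"
    using finite_measure_compl[of "{x}"] x by (simp add: sets_nu space_nu measure_nu Compl_eq_Diff_UNIV)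
  then have "AE z in \<nu>. z \<notin> - {x}"
    by (intro AE_not_in) (auto simp: null_sets_def emeasure_eq_measure sets_nu)
  then have "(\<integral>z. g z \<partial>\<nu>) = (\<integral>z. g x \<partial>\<nu>)"
    by (intro integral_cong_AE borel_measurable_nu g) auto
  then show ?thesis by (simp add: space_nu measure_nu)
qed

text \<open>
  Near the point the Sobolev inequality forces an energy of at least \<open>S T\<^bsup>p/P\<^esup> = T\<close>.
\<close>

lemma dens_concentrates:
  assumes x: "measure \<nu> {x} = T" and \<rho>: "0 < \<rho>"
  shows "(\<lambda>n. \<integral>z. cutoff x \<rho> z powr p * dens (v n) z \<partial>lborel) \<longlonglongrightarrow> T"
proof (rule order_tendstoI)
  have pb: "\<bar>cutoff x \<rho> z powr p\<bar> \<le> 1" for z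
    using powr_mono2[of p "cutoff x \<rho> z" 1] p_gt by simp
  have up: "(\<integral>z. cutoff x \<rho> z powr p * dens (v n) z \<partial>lborel) \<le> seminorm_pow (v n)" for n
    unfolding integral_dens[OF v_energy, symmetric] using pb
    by (intro integral_mono integrable_weighted_dens[OF v_energy _ pb] integrable_dens[OF v_energy])
      (auto intro!: mult_left_le_one_le dens_nonneg)
  fix y
  show "eventually (\<lambda>n. (\<integral>z. cutoff x \<rho> z powr p * dens (v n) z \<partial>lborel) < y) sequentially" if "T < y"
    using order_tendstoD(2)[OF energy_limit that] by eventually_elim (use up in \<open>blast intro: le_less_trans\<close>)
  show "eventually (\<lambda>n. y < (\<integral>z. cutoff x \<rho> z powr p * dens (v n) z \<partial>lborel)) sequentially" if y: "y < T"
  proof -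
    have "((\<lambda>l. l powr (1 - p) * y) \<longlongrightarrow> 1 powr (1 - p) * y) (at_left 1)"
      by (intro tendsto_intros) auto
    then have "eventually (\<lambda>l. l powr (1 - p) * y < T) (at_left 1)"
      using y by (intro order_tendstoD(2)) auto
    moreover have "eventually (\<lambda>l. l \<in> {0<..<1}) (at_left (1::real))"
      by (intro eventually_at_leftI[of 0]) auto
    ultimately have "eventually (\<lambda>l. l powr (1 - p) * y < T \<and> l \<in> {0<..<1}) (at_left 1)"
      by (rule eventually_conj)
    then obtain l where l: "l powr (1 - p) * y < T" "0 < l" "l < 1"
      using eventually_happens[of _ "at_left (1::real)"] trivial_limit_at_left_real by auto
    let ?b = "\<lambda>n. \<integral>z. cutoff x \<rho> z powr P * \<bar>v n z\<bar> powr P \<partial>lborel"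
    let ?r = "\<lambda>n. (1 - l) powr (1 - p) * ((\<integral>z. cutoff_modulus \<rho> z * kernel z \<partial>lborel) * (\<integral>x. \<bar>v n x\<bar> powr p \<partial>lborel))"
    have cP: "continuous_on UNIV (\<lambda>z. cutoff x \<rho> z powr P)"
      using P_pos by (intro continuous_on_powr' cutoff_continuous continuous_intros) auto
    have "?b \<longlonglongrightarrow> T"
      using conv_nu_continuous[OF cP] integral_nu[OF x borel_measurable_continuous_onI[OF cP]] cutoff_eq_1[OF \<rho>, of x x] \<rho>
      by simp
    then have "(\<lambda>n. S * ?b n powr (p / P) - ?r n) \<longlonglongrightarrow> S * T powr (p / P) - 0"
      using T_pos by (intro tendsto_intros remainder_limit) auto
    then have "eventually (\<lambda>n. l powr (1 - p) * y < S * ?b n powr (p / P) - ?r n) sequentially"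
      using l(1) by (intro order_tendstoD(1)) (auto simp: T_powr)
    then show ?thesis
    proof eventually_elim
      case (elim n)
      have "S * ?b n powr (p / P) \<le> l powr (1 - p) * (\<integral>z. cutoff x \<rho> z powr p * dens (v n) z \<partial>lborel) + ?r n"
        by (rule weighted_mass_le[OF cutoff_measurable cutoff_bounds cutoff_modulus_bound[OF \<rho>] cutoff_modulus_integrable[OF \<rho>] l(2,3)])
      with elim have "l powr (1 - p) * y < l powr (1 - p) * (\<integral>z. cutoff x \<rho> z powr p * dens (v n) z \<partial>lborel)"
        by linarith
      then show ?case using l(2) by simp
    qed
  qed
qed

text \<open>
  Where the cut-off function is positive, \<open>\<phi>\<close> differs from \<open>\<phi> x\<close> by at most \<open>e\<close>; the energy elsewhere tends
  to \<open>0\<close>, since the localised energy has the same limit as the total one.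
\<close>

lemma dens_limit:
  assumes x: "measure \<nu> {x} = T" and \<phi>: "\<phi> \<in> C0_funs"
  shows "(\<lambda>n. \<integral>z. \<phi> z * dens (v n) z \<partial>lborel) \<longlonglongrightarrow> T * \<phi> x"
proof -
  obtain K where K: "0 \<le> K" "\<And>x. \<bar>\<phi> x\<bar> \<le> K" using C0_funs_bounded[OF \<phi>] by blast
  have cont: "continuous_on UNIV \<phi>" using \<phi> by (simp add: C0_funs_def)
  then have m[measurable]: "\<phi> \<in> borel_measurable borel" by (rule borel_measurable_continuous_onI)
  have i: "integrable lborel (\<lambda>z. \<phi> z * dens (v n) z)" for n
    by (rule integrable_weighted_dens[OF v_energy m K(2)])
  define d where "d n = (\<integral>z. \<phi> z * dens (v n) z \<partial>lborel) - \<phi> x * seminorm_pow (v n)" for n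
  have "d \<longlonglongrightarrow> 0"
  proof (rule LIMSEQ_I)
    fix e0 :: real assume e0: "0 < e0"
    define e where "e = e0 / (2 * T)"
    have e: "0 < e" "e * T < e0" using e0 T_pos by (auto simp: e_def)
    have "\<exists>\<delta>>0. \<forall>z. dist z x < \<delta> \<longrightarrow> dist (\<phi> z) (\<phi> x) < e"
      using cont e(1) by (auto simp: continuous_on_iff)
    then obtain \<delta> where \<delta>: "0 < \<delta>" "\<And>z. dist z x < \<delta> \<Longrightarrow> \<bar>\<phi> z - \<phi> x\<bar> < e" by (auto simp: dist_real_def)
    define \<rho> where "\<rho> = \<delta> / 2"
    have \<rho>: "0 < \<rho>" using \<delta> by (simp add: \<rho>_def)
    let ?c = "\<lambda>z. cutoff x \<rho> z powr p"
    have pb: "\<bar>?c z\<bar> \<le> 1" for z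
      using powr_mono2[of p "cutoff x \<rho> z" 1] p_gt by simp
    have ic: "integrable lborel (\<lambda>z. ?c z * dens (v n) z)" for n
      by (rule integrable_weighted_dens[OF v_energy _ pb]) simp
    have pw: "\<bar>\<phi> z - \<phi> x\<bar> \<le> e + 2 * K * (1 - ?c z)" for z
    proof (cases "dist z x < \<delta>")
      case True
      have "0 \<le> 2 * K * (1 - ?c z)" using K(1) pb[of z] by simp
      then show ?thesis using \<delta>(2)[OF True] by linarith
    next
      case False
      then have "cutoff x \<rho> z = 0" using \<rho> by (intro cutoff_eq_0) (auto simp: \<rho>_def dist_norm)
      then show ?thesis using K(2)[of z] K(2)[of x] e(1) p_gt by simp
    qed
    have bound: "\<bar>d n\<bar> \<le> e * seminorm_pow (v n) + 2 * K * (seminorm_pow (v n) - (\<integral>z. ?c z * dens (v n) z \<partial>lborel))" for n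
    proof -
      note idn = integrable_dens[OF v_energy[of n]]
      have i2: "integrable lborel (\<lambda>z. \<phi> z * dens (v n) z - \<phi> x * dens (v n) z)" using i[of n] idn by simp
      have i3: "integrable lborel (\<lambda>z. e * dens (v n) z + 2 * K * (dens (v n) z - ?c z * dens (v n) z))"
        using ic[of n] idn by simp
      have "d n = (\<integral>z. \<phi> z * dens (v n) z - \<phi> x * dens (v n) z \<partial>lborel)"
        using i[of n] idn by (simp add: d_def integral_dens[OF v_energy])
      also have "\<bar>\<dots>\<bar> \<le> (\<integral>z. \<bar>\<phi> z * dens (v n) z - \<phi> x * dens (v n) z\<bar> \<partial>lborel)" by (rule integral_abs_bound)
      also have "\<dots> \<le> (\<integral>z. e * dens (v n) z + 2 * K * (dens (v n) z - ?c z * dens (v n) z) \<partial>lborel)"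
      proof (rule integral_mono[OF integrable_abs[OF i2] i3])
        fix z
        have "\<bar>\<phi> z * dens (v n) z - \<phi> x * dens (v n) z\<bar> = \<bar>\<phi> z - \<phi> x\<bar> * dens (v n) z"
          using dens_nonneg[of "v n" z] by (simp add: abs_mult flip: left_diff_distrib)
        also have "\<dots> \<le> (e + 2 * K * (1 - ?c z)) * dens (v n) z" by (rule mult_right_mono[OF pw dens_nonneg])
        finally show "\<bar>\<phi> z * dens (v n) z - \<phi> x * dens (v n) z\<bar>
            \<le> e * dens (v n) z + 2 * K * (dens (v n) z - ?c z * dens (v n) z)" by (simp add: algebra_simps)
      qed
      also have "\<dots> = e * seminorm_pow (v n) + 2 * K * (seminorm_pow (v n) - (\<integral>z. ?c z * dens (v n) z \<partial>lborel))"
        using ic[of n] idn by (simp add: integral_dens[OF v_energy])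
      finally show ?thesis .
    qed
    have "(\<lambda>n. e * seminorm_pow (v n) + 2 * K * (seminorm_pow (v n) - (\<integral>z. ?c z * dens (v n) z \<partial>lborel)))
        \<longlonglongrightarrow> e * T + 2 * K * (T - T)"
      by (intro tendsto_intros energy_limit dens_concentrates[OF x \<rho>])
    then have "eventually (\<lambda>n. e * seminorm_pow (v n) + 2 * K * (seminorm_pow (v n) - (\<integral>z. ?c z * dens (v n) z \<partial>lborel)) < e0) sequentially"
      by (rule order_tendstoD(2)) (use e(2) in simp)
    then obtain n0 where n0: "\<And>n. n0 \<le> n \<Longrightarrow>
        e * seminorm_pow (v n) + 2 * K * (seminorm_pow (v n) - (\<integral>z. ?c z * dens (v n) z \<partial>lborel)) < e0"
      by (auto simp: eventually_sequentially)
    show "\<exists>no. \<forall>n\<ge>no. norm (d n - 0) < e0"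
    proof (intro exI[of _ n0] allI impI)
      fix n assume "n0 \<le> n"
      from le_less_trans[OF bound n0[OF this]] show "norm (d n - 0) < e0" by simp
    qed
  qed
  then have "(\<lambda>n. d n + \<phi> x * seminorm_pow (v n)) \<longlonglongrightarrow> 0 + \<phi> x * T"
    by (intro tendsto_intros energy_limit)
  then show ?thesis by (simp add: d_def mult.commute)
qed

end

section \<open>Weak convergence to a multiple of a Dirac measure\<close>

lemma integral_density_lebesgue_AE_borel:
  fixes f g \<phi> :: "'a::euclidean_space \<Rightarrow> real"
  assumes ae: "AE x in lborel. f x = g x" and g: "g \<in> borel_measurable borel" "\<And>x. 0 \<le> g x"
    and \<phi>: "\<phi> \<in> borel_measurable borel"
  shows "(\<integral>x. \<phi> x \<partial>density lebesgue (\<lambda>x. ennreal (f x))) = (\<integral>x. \<phi> x * g x \<partial>lborel)"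
proof -
  note fm = lebesgue_measurable_if_AE_borel[OF g(1) ae]
  have "AE x in lebesgue. f x = g x" using ae by (rule AE_completion)
  then have "AE x in lebesgue. 0 \<le> f x" by eventually_elim (simp add: g)
  moreover have "\<phi> \<in> borel_measurable lebesgue" using \<phi> by (simp add: measurable_completion)
  ultimately have "(\<integral>x. \<phi> x \<partial>density lebesgue (\<lambda>x. ennreal (f x))) = (\<integral>x. f x *\<^sub>R \<phi> x \<partial>lebesgue)"
    using fm by (intro integral_density)
  also have "\<dots> = (\<integral>x. \<phi> x * g x \<partial>lborel)"
  proof (rule integral_lebesgue_eq_borel)
    show "(\<lambda>x. \<phi> x * g x) \<in> borel_measurable borel" using g \<phi> by measurable
    show "AE x in lborel. f x *\<^sub>R \<phi> x = \<phi> x * g x" using ae by eventually_elim simp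
  qed
  finally show ?thesis .
qed

lemma weak_lim_measure_scaled_return:
  fixes x :: "'a::euclidean_space"
  assumes c: "0 \<le> c"
    and lim: "\<And>\<phi>. \<phi> \<in> C0_funs \<Longrightarrow>
      (\<lambda>n. \<integral>z. \<phi> z \<partial>density lebesgue (\<lambda>z. ennreal (f n z))) \<longlonglongrightarrow> c * \<phi> x"
  shows "weak_lim_measure f (scale_measure (ennreal c) (return borel x))"
  unfolding weak_lim_measure_def
proof (intro conjI ballI)
  show "sets (scale_measure (ennreal c) (return borel x)) = sets borel" by simp
  show "finite_measure (scale_measure (ennreal c) (return borel x))"
    by (rule finite_measureI) (simp add: space_scale_measure ennreal_mult_eq_top_iff)
  fix \<phi> :: "'a \<Rightarrow> real" assume \<phi>: "\<phi> \<in> C0_funs"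
  then have m: "\<phi> \<in> borel_measurable borel"
    by (auto simp: C0_funs_def intro: borel_measurable_continuous_onI)
  have "scale_measure (ennreal c) (return borel x) = density (return borel x) (\<lambda>_. ennreal c)"
    by (rule measure_eqI) (simp_all add: emeasure_density_const)
  then have "(\<integral>z. \<phi> z \<partial>scale_measure (ennreal c) (return borel x)) = (\<integral>z. c *\<^sub>R \<phi> z \<partial>return borel x)"
    using c m by (simp add: integral_density)
  also have "\<dots> = c * \<phi> x" using m by (subst integral_return) auto
  finally show "(\<lambda>n. \<integral>z. \<phi> z \<partial>density lebesgue (\<lambda>z. ennreal (f n z)))
      \<longlonglongrightarrow> (\<integral>z. \<phi> z \<partial>scale_measure (ennreal c) (return borel x))"
    using lim[OF \<phi>] by simp
qed

theorem theorem1p1: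
  fixes s p :: real
    and \<Omega> :: "'a::euclidean_space set"
    and \<epsilon> :: "nat \<Rightarrow> real"
    and u :: "nat \<Rightarrow> 'a \<Rightarrow> real"
    and r :: "nat \<Rightarrow> nat"
  assumes "0 < s" and "s < 1" and "1 < p" and "p * s < real DIM('a)"
    and "open \<Omega>" and "connected \<Omega>" and "\<Omega> \<noteq> {}" and "bounded \<Omega>"
    and "decseq \<epsilon>" and "\<epsilon> \<longlonglongrightarrow> 0"
    and "\<And>n. 0 < \<epsilon> n" and "\<And>n. p < crit_exp DIM('a) s p - \<epsilon> n"
    and "\<And>n. ground_state s p \<Omega> (\<epsilon> n) (u n)"
    and "strict_mono r"
    and "\<exists>\<mu>. weak_lim_measure (\<lambda>n x. \<bar>u (r n) x\<bar> powr crit_exp DIM('a) s p) \<mu>"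
  shows "(\<forall>q. 1 \<le> q \<and> q < crit_exp DIM('a) s p \<longrightarrow>
            (\<forall>n. u (r n) \<in> Lspace q) \<and> (\<lambda>n. Lnorm q (u (r n))) \<longlonglongrightarrow> 0) \<and>
         (\<exists>x \<in> closure \<Omega>.
            weak_lim_measure (\<lambda>n. Ds_pow s p (u (r n)))
              (scale_measure (ennreal (sobolev_const TYPE('a) s p powr (real DIM('a) / (p * s))))
                 (return borel x)) \<and>
            weak_lim_measure (\<lambda>n x. \<bar>u (r n) x\<bar> powr crit_exp DIM('a) s p)
              (scale_measure (ennreal (sobolev_const TYPE('a) s p powr (real DIM('a) / (p * s))))
                 (return borel x)))"
proof -
  define N where "N = real DIM('a)"
  define P where "P = crit_exp DIM('a) s p"
  define S where "S = sobolev_const TYPE('a) s p"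
  interpret fractional_exponents s p N P S "TYPE('a)"
    by unfold_locales (use assms in \<open>auto simp: N_def P_def S_def\<close>)
  define q where "q n = P - \<epsilon> (r n)" for n
  have pq: "p < q n" for n using assms(12)[of "r n"] by (simp add: q_def P_def)
  have "\<exists>v. \<forall>n. v n \<in> finite_energy \<and> (\<forall>x. x \<notin> \<Omega> \<longrightarrow> v n x = 0) \<and> (AE x in lborel. u (r n) x = v n x) \<and>
    0 < mass (v n) \<and> seminorm_pow (v n) = (\<integral>x. \<bar>v n x\<bar> powr q n \<partial>lborel) \<and>
    (\<forall>w. w \<in> finite_energy \<longrightarrow> (\<forall>x. x \<notin> \<Omega> \<longrightarrow> w x = 0) \<longrightarrow> 0 < mass w \<longrightarrow>
      seminorm_pow (v n) \<le> (seminorm_pow w / (\<integral>x. \<bar>w x\<bar> powr q n \<partial>lborel) powr (p / q n)) powr (q n / (q n - p)))"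
  proof (rule choice, rule allI)
    fix n
    show "\<exists>v. v \<in> finite_energy \<and> (\<forall>x. x \<notin> \<Omega> \<longrightarrow> v x = 0) \<and> (AE x in lborel. u (r n) x = v x) \<and>
      0 < mass v \<and> seminorm_pow v = (\<integral>x. \<bar>v x\<bar> powr q n \<partial>lborel) \<and>
      (\<forall>w. w \<in> finite_energy \<longrightarrow> (\<forall>x. x \<notin> \<Omega> \<longrightarrow> w x = 0) \<longrightarrow> 0 < mass w \<longrightarrow>
        seminorm_pow v \<le> (seminorm_pow w / (\<integral>x. \<bar>w x\<bar> powr q n \<partial>lborel) powr (p / q n)) powr (q n / (q n - p)))"
      by (rule ground_state_representative[OF assms(13)[of "r n"] assms(5,8) q_def pq assms(11)]) blast
  qed
  then obtain v where v: "\<And>n. v n \<in> finite_energy" "\<And>n x. x \<notin> \<Omega> \<Longrightarrow> v n x = 0"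
    "\<And>n. AE x in lborel. u (r n) x = v n x" "\<And>n. 0 < mass (v n)"
    "\<And>n. seminorm_pow (v n) = (\<integral>x. \<bar>v n x\<bar> powr q n \<partial>lborel)"
    "\<And>n w. w \<in> finite_energy \<Longrightarrow> (\<And>x. x \<notin> \<Omega> \<Longrightarrow> w x = 0) \<Longrightarrow> 0 < mass w \<Longrightarrow>
      seminorm_pow (v n) \<le> (seminorm_pow w / (\<integral>x. \<bar>w x\<bar> powr q n \<partial>lborel) powr (p / q n)) powr (q n / (q n - p))"
    by blast
  have "(\<lambda>n. \<epsilon> (r n)) \<longlonglongrightarrow> 0"
    using LIMSEQ_subseq_LIMSEQ[OF assms(10,14)] by (simp add: o_def)
  then have "(\<lambda>n. P - \<epsilon> (r n)) \<longlonglongrightarrow> P - 0" by (intro tendsto_intros)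
  then have q_lim: "q \<longlonglongrightarrow> P" by (simp add: q_def[abs_def])
  interpret ground_state_sequence s p N P S "TYPE('a)" \<Omega> q v
  proof unfold_locales
    show "q n < P" for n using assms(11)[of "r n"] by (simp add: q_def)
  qed (fact assms(5,7,8) pq q_lim v)+
  have T: "sobolev_const TYPE('a) s p powr (real DIM('a) / (p * s)) = T"
    using N_div_ps by (simp add: T_def S_def[symmetric] N_def[symmetric])
  note vm = finite_energyD(1)[OF v(1)]
  have vP: "(\<lambda>x. \<bar>v n x\<bar> powr P) \<in> borel_measurable borel" for n using vm[of n] by measurable
  have uP: "(\<integral>x. \<phi> x \<partial>density lebesgue (\<lambda>x. ennreal (\<bar>u (r n) x\<bar> powr P))) = (\<integral>x. \<phi> x * \<bar>v n x\<bar> powr P \<partial>lborel)"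
    if "\<phi> \<in> C0_funs" for \<phi> n
  proof (rule integral_density_lebesgue_AE_borel[OF _ vP])
    show "AE x in lborel. \<bar>u (r n) x\<bar> powr P = \<bar>v n x\<bar> powr P" using v(3)[of n] by eventually_elim simp
  qed (use that in \<open>auto simp: C0_funs_def intro: borel_measurable_continuous_onI\<close>)
  have uD: "(\<integral>x. \<phi> x \<partial>density lebesgue (\<lambda>x. ennreal (Ds_pow s p (u (r n)) x))) = (\<integral>x. \<phi> x * dens (v n) x \<partial>lborel)"
    if "\<phi> \<in> C0_funs" for \<phi> n
    by (rule integral_density_lebesgue_AE_borel[OF Ds_pow_eq[OF vm v(3)] dens_measurable[OF vm] dens_nonneg])
      (use that in \<open>auto simp: C0_funs_def intro: borel_measurable_continuous_onI\<close>)
  obtain \<nu> where nu: "weak_lim_measure (\<lambda>n x. \<bar>u (r n) x\<bar> powr P) \<nu>" using assms(15) by (auto simp: P_def)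
  interpret concentration s p N P S "TYPE('a)" \<Omega> q v \<nu>
  proof (intro concentration.intro concentration_axioms.intro)
    show "ground_state_sequence s p N P S \<Omega> q v" by unfold_locales
    show "sets \<nu> = sets borel" "finite_measure \<nu>" using nu by (auto simp: weak_lim_measure_def)
    fix \<phi> :: "'a \<Rightarrow> real" assume \<phi>: "\<phi> \<in> C0_funs"
    then show "(\<lambda>n. \<integral>x. \<phi> x * \<bar>v n x\<bar> powr P \<partial>lborel) \<longlonglongrightarrow> (\<integral>x. \<phi> x \<partial>\<nu>)"
      unfolding uP[OF \<phi>, symmetric] using nu by (simp add: weak_lim_measure_def)
  qed
  have part1: "(\<forall>n. u (r n) \<in> Lspace a) \<and> (\<lambda>n. Lnorm a (u (r n))) \<longlonglongrightarrow> 0" if a: "1 \<le> a" "a < P" for a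
  proof
    show "\<forall>n. u (r n) \<in> Lspace a"
      using integrable_abs_powr_iff[OF vm v(3), of _ a] abs_v_subcritical[of a] a
        lebesgue_measurable_if_AE_borel[OF vm v(3)] by (simp add: Lspace_def)
    have "(\<lambda>n. (\<integral>x. \<bar>v n x\<bar> powr a \<partial>lborel) powr (1 / a)) \<longlonglongrightarrow> 0 powr (1 / a)"
      using a by (intro tendsto_powr' subcritical_power_limit tendsto_const) auto
    then show "(\<lambda>n. Lnorm a (u (r n))) \<longlonglongrightarrow> 0"
      using a by (simp add: Lnorm_def integral_abs_powr_eq[OF vm v(3)])
  qed
  obtain x where x: "x \<in> closure \<Omega>" "measure \<nu> {x} = T" by (rule nu_point)
  have "weak_lim_measure (\<lambda>n. Ds_pow s p (u (r n))) (scale_measure (ennreal T) (return borel x))"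
    using T_pos dens_limit[OF x(2)] uD by (intro weak_lim_measure_scaled_return) auto
  moreover have "weak_lim_measure (\<lambda>n x. \<bar>u (r n) x\<bar> powr P) (scale_measure (ennreal T) (return borel x))"
  proof (rule weak_lim_measure_scaled_return)
    fix \<phi> :: "'a \<Rightarrow> real" assume \<phi>: "\<phi> \<in> C0_funs"
    then have "\<phi> \<in> borel_measurable borel" by (auto simp: C0_funs_def intro: borel_measurable_continuous_onI)
    then show "(\<lambda>n. \<integral>z. \<phi> z \<partial>density lebesgue (\<lambda>z. ennreal (\<bar>u (r n) z\<bar> powr P))) \<longlonglongrightarrow> T * \<phi> x"
      using conv_nu[OF \<phi>] integral_nu[OF x(2)] uP[OF \<phi>] by simp
  qed (use T_pos in simp)
  ultimately show ?thesis using part1 x(1) unfolding T P_def[symmetric] by blast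
qed

end
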